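(* Let $(M,g)$ be a conformally flat pseudo-Riemannian manifold of dimension $n=3$ and $x_0\in M$. Then for any totally symmetric, trace-free tensor $S_{ijk}(x_0)$ at $x_0$ the system \begin{align*} \nabla_i\bar t_j&=\Big(\tfrac{3}{n-2}R_{ij}+\tfrac{1}{3(n-2)}S_i{}^{ab}S_{jab}+\tfrac13\bar t_i\bar t_j\Big)_\circ+\tfrac1n g_{ij}\nabla^a\bar t_a,\\ \nabla^a\bar t_a&=\tfrac{3}{2(n-1)}R+\tfrac{3n+2}{6(n-1)(n+2)}S^{abc}S_{abc}-\tfrac{n-2}{6}\bar t^a\bar t_a,\\ \nabla_lS_{ijk}&=\tfrac1{18}\Pi_{ijk}\Big(S_{il}{}^{a}S_{jka}+3S_{ijl}\bar t_k+S_{ijk}\bar t_l+\big(\tfrac{4}{n-2}S_j{}^{ab}S_{kab}-3S_{jka}\bar t^a\big)g_{il}\Big) \end{align*} (with $n=3$) for a function $\bar t$, $\bar t_i=\nabla_i\bar t$, and a totally symmetric trace-free tensor field $S_{ijk}$ can be integrated, i.e. has a solution in a neighbourhood of $x_0$ with the given value $S_{ijk}(x_0)$.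
   Context: $\nabla$ is the Levi-Civita connection of $g$ (assumed analytic), $R_{ij}$ the Ricci tensor and $R$ the scalar curvature (positive on round spheres); indices are raised with $g$; $\circ$ denotes the trace-free part. $\Pi_{ijk}X_{ijkl}$ means: sum over all $6$ permutations of $i,j,k$ (no normalisation), then take the part that is trace-free with respect to the indices $i,j,k$ (for each fixed $l$). *)

theory Defs
  imports "HOL-Analysis.Analysis"
begin

section \<open>Smooth and real-analytic functions on open subsets of coordinate space\<close>

definition pd :: "'n::finite \<Rightarrow> (real^'n \<Rightarrow> real) \<Rightarrow> real^'n \<Rightarrow> real" where
  "pd i f x = frechet_derivative f (at x) (axis i 1)"

primrec Ck_on :: "nat \<Rightarrow> (real^'n::finite) set \<Rightarrow> (real^'n \<Rightarrow> real) \<Rightarrow> bool" where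
  "Ck_on 0 U f \<longleftrightarrow> continuous_on U f"
| "Ck_on (Suc k) U f \<longleftrightarrow> (\<forall>x\<in>U. f differentiable (at x)) \<and> (\<forall>i. Ck_on k U (pd i f))"

definition smooth_on :: "(real^'n::finite) set \<Rightarrow> (real^'n \<Rightarrow> real) \<Rightarrow> bool" where
  "smooth_on U f \<longleftrightarrow> (\<forall>k. Ck_on k U f)"

text \<open>The second conjunct says that \<open>f\<close> is, near every point, the sum of an (unconditionally)
  convergent power series; \<open>\<alpha> :: nat^'n\<close> is a multi-index. It implies smoothness, which is
  kept as an explicit conjunct.\<close>

definition real_analytic_on :: "(real^'n::finite) set \<Rightarrow> (real^'n \<Rightarrow> real) \<Rightarrow> bool" where
  "real_analytic_on U f \<longleftrightarrow> smooth_on U f \<and>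
     (\<forall>a\<in>U. \<exists>r>0. \<exists>c :: nat^'n \<Rightarrow> real. \<forall>x\<in>ball a r.
        ((\<lambda>\<alpha>. c \<alpha> * (\<Prod>i\<in>UNIV. (x $ i - a $ i) ^ (\<alpha> $ i))) has_sum f x) UNIV)"


section \<open>Analytic manifolds and pseudo-Riemannian metrics\<close>

text \<open>The manifold is the whole of a type \<open>'m\<close> (Hausdorff and second countable in the statement),
  equipped with an atlas \<open>A\<close>; its dimension is \<open>CARD('n)\<close>. A chart is its domain together with
  its coordinate map; the map is irrelevant outside the domain.\<close>

type_synonym ('m, 'n) chart = "'m set \<times> ('m \<Rightarrow> real^'n)"

definition is_chart :: "('m::topological_space, 'n::finite) chart \<Rightarrow> bool" where
  "is_chart c \<longleftrightarrow> open (fst c) \<and> open (snd c ` fst c) \<and>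
     (\<exists>\<psi>. homeomorphism (fst c) (snd c ` fst c) (snd c) \<psi>)"

definition in_chart :: "('m, 'n::finite) chart \<Rightarrow> ('m \<Rightarrow> 'b) \<Rightarrow> real^'n \<Rightarrow> 'b" where
  "in_chart c h x = h (inv_into (fst c) (snd c) x)"

definition transition :: "('m, 'n::finite) chart \<Rightarrow> ('m, 'n) chart \<Rightarrow> real^'n \<Rightarrow> real^'n" where
  "transition c d = in_chart c (snd d)"

definition analytic_atlas :: "('m::topological_space, 'n::finite) chart set \<Rightarrow> bool" where
  "analytic_atlas A \<longleftrightarrow> (\<forall>c\<in>A. is_chart c) \<and> (\<Union>c\<in>A. fst c) = UNIV \<and>
     (\<forall>c\<in>A. \<forall>d\<in>A. \<forall>i. real_analytic_on (snd c ` (fst c \<inter> fst d)) (\<lambda>x. transition c d x $ i))"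

text \<open>A metric is given by its component matrix \<open>g c\<close> in every chart \<open>c\<close> of the atlas, subject to
  the transformation law of covariant 2-tensors.\<close>

definition analytic_metric ::
    "('m, 'n::finite) chart set \<Rightarrow> (('m, 'n) chart \<Rightarrow> real^'n \<Rightarrow> real^'n^'n) \<Rightarrow> bool" where
  "analytic_metric A g \<longleftrightarrow>
     (\<forall>c\<in>A. (\<forall>i j. real_analytic_on (snd c ` fst c) (\<lambda>x. g c x $ i $ j)) \<and>
        (\<forall>x\<in>snd c ` fst c. transpose (g c x) = g c x \<and> det (g c x) \<noteq> 0)) \<and>
     (\<forall>c\<in>A. \<forall>d\<in>A. \<forall>x\<in>snd c ` (fst c \<inter> fst d). \<forall>i j.
        g c x $ i $ j = (\<Sum>a\<in>UNIV. \<Sum>b\<in>UNIV.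
          pd i (\<lambda>y. transition c d y $ a) x * pd j (\<lambda>y. transition c d y $ b) x *
          g d (transition c d x) $ a $ b))"


section \<open>Levi-Civita connection and curvature in coordinates\<close>

text \<open>\<open>christoffel g k i j\<close> is \<open>\<Gamma>\<^sup>k\<^sub>i\<^sub>j\<close>; \<open>riemann g l k i j\<close> is \<open>R\<^sup>l\<^sub>k\<^sub>i\<^sub>j\<close>, i.e. the \<open>l\<close>-component
  of \<open>R(\<partial>\<^sub>i, \<partial>\<^sub>j) \<partial>\<^sub>k\<close> with \<open>R(X,Y) = [\<nabla>\<^sub>X, \<nabla>\<^sub>Y] - \<nabla>\<^bsub>[X,Y]\<^esub>\<close>. With the contraction in
  \<open>ricci\<close>, round spheres have positive scalar curvature.\<close>

definition christoffel ::
    "(real^'n \<Rightarrow> real^'n^'n) \<Rightarrow> 'n \<Rightarrow> 'n \<Rightarrow> 'n::finite \<Rightarrow> real^'n \<Rightarrow> real" where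
  "christoffel g k i j x = 1/2 * (\<Sum>l\<in>UNIV. matrix_inv (g x) $ k $ l *
     (pd i (\<lambda>y. g y $ j $ l) x + pd j (\<lambda>y. g y $ i $ l) x - pd l (\<lambda>y. g y $ i $ j) x))"

definition riemann ::
    "(real^'n \<Rightarrow> real^'n^'n) \<Rightarrow> 'n \<Rightarrow> 'n \<Rightarrow> 'n \<Rightarrow> 'n::finite \<Rightarrow> real^'n \<Rightarrow> real" where
  "riemann g l k i j x = pd i (christoffel g l j k) x - pd j (christoffel g l i k) x +
     (\<Sum>m\<in>UNIV. christoffel g l i m x * christoffel g m j k x
              - christoffel g l j m x * christoffel g m i k x)"

definition ricci :: "(real^'n \<Rightarrow> real^'n^'n) \<Rightarrow> 'n \<Rightarrow> 'n::finite \<Rightarrow> real^'n \<Rightarrow> real" where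
  "ricci g k j x = (\<Sum>i\<in>UNIV. riemann g i k i j x)"

definition scalar_curv :: "(real^'n::finite \<Rightarrow> real^'n^'n) \<Rightarrow> real^'n \<Rightarrow> real" where
  "scalar_curv g x = (\<Sum>i\<in>UNIV. \<Sum>j\<in>UNIV. matrix_inv (g x) $ i $ j * ricci g i j x)"

text \<open>\<open>cov1 g \<omega> i j\<close> is \<open>\<nabla>\<^sub>i \<omega>\<^sub>j\<close> and \<open>cov3 g S l i j k\<close> is \<open>\<nabla>\<^sub>l S\<^sub>i\<^sub>j\<^sub>k\<close>.\<close>

definition cov1 ::
    "(real^'n \<Rightarrow> real^'n^'n) \<Rightarrow> (real^'n \<Rightarrow> 'n \<Rightarrow> real) \<Rightarrow> 'n \<Rightarrow> 'n::finite \<Rightarrow> real^'n \<Rightarrow> real" where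
  "cov1 g \<omega> i j x = pd i (\<lambda>y. \<omega> y j) x - (\<Sum>a\<in>UNIV. christoffel g a i j x * \<omega> x a)"

definition cov3 ::
    "(real^'n \<Rightarrow> real^'n^'n) \<Rightarrow> (real^'n \<Rightarrow> 'n \<Rightarrow> 'n \<Rightarrow> 'n \<Rightarrow> real) \<Rightarrow>
     'n \<Rightarrow> 'n \<Rightarrow> 'n \<Rightarrow> 'n::finite \<Rightarrow> real^'n \<Rightarrow> real" where
  "cov3 g S l i j k x = pd l (\<lambda>y. S y i j k) x -
     (\<Sum>a\<in>UNIV. christoffel g a l i x * S x a j k + christoffel g a l j x * S x i a k
              + christoffel g a l k x * S x i j a)"

text \<open>Conformally flat: around every point some rescaling \<open>e\<^sup>2\<^sup>f g\<close> with smooth \<open>f\<close> is a flat metric.\<close>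

definition conformally_flat ::
    "('m::topological_space, 'n::finite) chart set \<Rightarrow>
     (('m, 'n) chart \<Rightarrow> real^'n \<Rightarrow> real^'n^'n) \<Rightarrow> bool" where
  "conformally_flat A g \<longleftrightarrow>
     (\<forall>p. \<exists>W f. open W \<and> p \<in> W \<and>
        (\<forall>c\<in>A. smooth_on (snd c ` (fst c \<inter> W)) (in_chart c f) \<and>
           (\<forall>x\<in>snd c ` (fst c \<inter> W). \<forall>l k i j.
              riemann (\<lambda>y. exp (2 * in_chart c f y) *\<^sub>R g c y) l k i j x = 0)))"


section \<open>Pointwise tensor algebra\<close>

text \<open>Here \<open>G\<close> is the matrix of a metric at one point; indices are raised with \<open>matrix_inv G\<close>.\<close>

definition totally_symmetric :: "('n \<Rightarrow> 'n \<Rightarrow> 'n \<Rightarrow> real) \<Rightarrow> bool" where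
  "totally_symmetric S \<longleftrightarrow> (\<forall>i j k. S i j k = S j i k \<and> S i j k = S i k j)"

text \<open>The trace over the first two slots; for totally symmetric tensors all traces agree.\<close>

definition trace3 :: "real^'n^'n \<Rightarrow> ('n::finite \<Rightarrow> 'n \<Rightarrow> 'n \<Rightarrow> real) \<Rightarrow> 'n \<Rightarrow> real" where
  "trace3 G S k = (\<Sum>a\<in>UNIV. \<Sum>b\<in>UNIV. matrix_inv G $ a $ b * S a b k)"

definition sym_tracefree :: "real^'n^'n \<Rightarrow> ('n::finite \<Rightarrow> 'n \<Rightarrow> 'n \<Rightarrow> real) \<Rightarrow> bool" where
  "sym_tracefree G S \<longleftrightarrow> totally_symmetric S \<and> (\<forall>k. trace3 G S k = 0)"

definition trace2 :: "real^'n^'n \<Rightarrow> ('n::finite \<Rightarrow> 'n \<Rightarrow> real) \<Rightarrow> real" where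
  "trace2 G T = (\<Sum>a\<in>UNIV. \<Sum>b\<in>UNIV. matrix_inv G $ a $ b * T a b)"

definition tracefree2 :: "real^'n^'n \<Rightarrow> ('n::finite \<Rightarrow> 'n \<Rightarrow> real) \<Rightarrow> 'n \<Rightarrow> 'n \<Rightarrow> real" where
  "tracefree2 G T i j = T i j - 1 / real CARD('n) * G $ i $ j * trace2 G T"

text \<open>The trace-free part of a totally symmetric 3-tensor: the pure-trace correction is
  \<open>g\<^sub>i\<^sub>j v\<^sub>k + g\<^sub>i\<^sub>k v\<^sub>j + g\<^sub>j\<^sub>k v\<^sub>i\<close>, whose trace is \<open>(n + 2) v\<close>.\<close>

definition tracefree3 ::
    "real^'n^'n \<Rightarrow> ('n::finite \<Rightarrow> 'n \<Rightarrow> 'n \<Rightarrow> real) \<Rightarrow> 'n \<Rightarrow> 'n \<Rightarrow> 'n \<Rightarrow> real" where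
  "tracefree3 G Y i j k = Y i j k - 1 / (real CARD('n) + 2) *
     (G $ i $ j * trace3 G Y k + G $ i $ k * trace3 G Y j + G $ j $ k * trace3 G Y i)"

definition sym3 :: "('n \<Rightarrow> 'n \<Rightarrow> 'n \<Rightarrow> real) \<Rightarrow> 'n \<Rightarrow> 'n \<Rightarrow> 'n \<Rightarrow> real" where
  "sym3 X i j k = X i j k + X i k j + X j i k + X j k i + X k i j + X k j i"

text \<open>\<open>(\<Pi>\<^sub>i\<^sub>j\<^sub>k X\<^sub>i\<^sub>j\<^sub>k\<^sub>l)\<close> as a tensor with indices \<open>i j k l\<close>.\<close>

definition Pi3 ::
    "real^'n^'n \<Rightarrow> ('n::finite \<Rightarrow> 'n \<Rightarrow> 'n \<Rightarrow> 'n \<Rightarrow> real) \<Rightarrow> 'n \<Rightarrow> 'n \<Rightarrow> 'n \<Rightarrow> 'n \<Rightarrow> real" where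
  "Pi3 G X i j k l = tracefree3 G (sym3 (\<lambda>p q r. X p q r l)) i j k"

text \<open>\<open>SS2 G S i j\<close> is \<open>S\<^sub>i\<^sup>a\<^sup>b S\<^sub>j\<^sub>a\<^sub>b\<close>, so \<open>trace2 G (SS2 G S)\<close> is \<open>S\<^sup>a\<^sup>b\<^sup>c S\<^sub>a\<^sub>b\<^sub>c\<close>;
  \<open>SS4 G S i l j k\<close> is \<open>S\<^sub>i\<^sub>l\<^sup>a S\<^sub>j\<^sub>k\<^sub>a\<close>; \<open>St G S w j k\<close> is \<open>S\<^sub>j\<^sub>k\<^sub>a w\<^sup>a\<close>;
  \<open>norm2 G w\<close> is \<open>w\<^sup>a w\<^sub>a\<close>.\<close>

definition SS2 :: "real^'n^'n \<Rightarrow> ('n::finite \<Rightarrow> 'n \<Rightarrow> 'n \<Rightarrow> real) \<Rightarrow> 'n \<Rightarrow> 'n \<Rightarrow> real" where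
  "SS2 G S i j = (\<Sum>a\<in>UNIV. \<Sum>b\<in>UNIV. \<Sum>c\<in>UNIV. \<Sum>d\<in>UNIV.
     matrix_inv G $ a $ c * matrix_inv G $ b $ d * S i c d * S j a b)"

definition SS4 ::
    "real^'n^'n \<Rightarrow> ('n::finite \<Rightarrow> 'n \<Rightarrow> 'n \<Rightarrow> real) \<Rightarrow> 'n \<Rightarrow> 'n \<Rightarrow> 'n \<Rightarrow> 'n \<Rightarrow> real" where
  "SS4 G S i l j k = (\<Sum>a\<in>UNIV. \<Sum>b\<in>UNIV. matrix_inv G $ a $ b * S i l b * S j k a)"

definition St ::
    "real^'n^'n \<Rightarrow> ('n::finite \<Rightarrow> 'n \<Rightarrow> 'n \<Rightarrow> real) \<Rightarrow> ('n \<Rightarrow> real) \<Rightarrow> 'n \<Rightarrow> 'n \<Rightarrow> real" where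
  "St G S w j k = (\<Sum>a\<in>UNIV. \<Sum>b\<in>UNIV. matrix_inv G $ a $ b * S j k a * w b)"

definition norm2 :: "real^'n^'n \<Rightarrow> ('n::finite \<Rightarrow> real) \<Rightarrow> real" where
  "norm2 G w = trace2 G (\<lambda>a b. w a * w b)"


section \<open>The structural equations\<close>

definition grad :: "(real^'n \<Rightarrow> real) \<Rightarrow> real^'n \<Rightarrow> 'n::finite \<Rightarrow> real" where
  "grad t x i = pd i t x"

definition divergence :: "(real^'n::finite \<Rightarrow> real^'n^'n) \<Rightarrow> (real^'n \<Rightarrow> 'n \<Rightarrow> real) \<Rightarrow> real^'n \<Rightarrow> real" where
  "divergence g \<omega> x = trace2 (g x) (\<lambda>a b. cov1 g \<omega> a b x)"

text \<open>The system at the point with coordinates \<open>x\<close>, for coordinate expressions of the metric \<open>g\<close>,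
  the function \<open>t\<close> and the tensor field \<open>S\<close>. A tensor field on an open subset of a chart domain is
  represented by its component functions in that chart; all terms of the system are tensors, so it
  holds in every chart as soon as it holds in one.\<close>

definition structural_system ::
    "(real^'n::finite \<Rightarrow> real^'n^'n) \<Rightarrow> (real^'n \<Rightarrow> real) \<Rightarrow>
     (real^'n \<Rightarrow> 'n \<Rightarrow> 'n \<Rightarrow> 'n \<Rightarrow> real) \<Rightarrow> real^'n \<Rightarrow> bool" where
  "structural_system g t S x \<longleftrightarrow>
    (let n = real CARD('n); G = g x; w = grad t x; Sx = S x in
      (\<forall>i j. cov1 g (grad t) i j x =
         tracefree2 G (\<lambda>p q. 3 / (n - 2) * ricci g p q x + 1 / (3 * (n - 2)) * SS2 G Sx p q
                            + 1/3 * w p * w q) i j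
         + 1 / n * G $ i $ j * divergence g (grad t) x) \<and>
      divergence g (grad t) x =
         3 / (2 * (n - 1)) * scalar_curv g x
         + (3 * n + 2) / (6 * (n - 1) * (n + 2)) * trace2 G (SS2 G Sx)
         - (n - 2) / 6 * norm2 G w \<and>
      (\<forall>l i j k. cov3 g S l i j k x =
         1/18 * Pi3 G (\<lambda>i j k l. SS4 G Sx i l j k + 3 * Sx i j l * w k + Sx i j k * w l
                        + (4 / (n - 2) * SS2 G Sx j k - 3 * St G Sx w j k) * G $ i $ l) i j k l))"

end

theory Submission
  imports Defs
begin

text \<open>Near a point, conformal flatness provides a flat metric \<open>h = e\<^sup>2\<^sup>f g\<close>. A flat metric has a frame of parallel
vector fields with \<open>h(E\<^sub>a, E\<^sub>b) = e\<^sub>a \<delta>\<^sub>a\<^sub>b\<close> and \<open>e\<^sub>a = \<plusminus>1\<close>; the dual 1-forms \<open>\<theta>\<^sup>a\<close> are closed and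
\<open>h = \<Sum>\<^sub>a e\<^sub>a \<theta>\<^sup>a \<theta>\<^sup>a\<close> (\<open>flat_metric_coframe\<close>). They replace the differentials of Cartesian coordinates, so that
no change of chart is ever needed: a tensor field is given by its components in the coframe, and \<open>D a\<close>, the
derivative along \<open>E\<^sub>a\<close>, replaces the partial derivative. The fields \<open>E\<^sub>a\<close> commute.

The system is conformally covariant. With \<open>\<sigma> = - f\<close>, so that \<open>g = e\<^sup>2\<^sup>\<sigma> h\<close>, a pair \<open>(t', S')\<close> solves it for \<open>h\<close>
if and only if \<open>t = t' - 3 \<sigma>\<close>, \<open>S = e\<^sup>2\<^sup>\<sigma> S'\<close> solves it for \<open>g\<close>. The summand \<open>3 R\<^sub>i\<^sub>j\<close> in the equation for the
Hessian produces \<open>- 3 \<nabla>\<^sub>i \<nabla>\<^sub>j \<sigma>\<close>, which accounts for the shift of \<open>t\<close>, and the other terms that contain \<open>d\<sigma>\<close>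
match the change of the Levi-Civita connection (\<open>hess_rhs_conformal\<close>, \<open>deriv_rhs_conformal\<close>,
\<open>ricci_conformal\<close>).

There remains the flat system. In the coframe a symmetric trace-free tensor has seven independent components
and \<open>dt'\<close> has three; let \<open>u\<close> be the vector of these ten functions. Since the curvature is zero, the system reads
\<open>du = \<Sum>\<^sub>a Q\<^sub>a(u) \<theta>\<^sup>a\<close>, where \<open>Q\<^sub>1, Q\<^sub>2, Q\<^sub>3\<close> are quadratic vector fields on the ten-dimensional space with
constant coefficients that depend only on the signs \<open>e\<^sub>a\<close> (\<open>deriv_rhs_flat\<close>, \<open>hess_rhs_flat\<close>). Because \<open>d\<theta>\<^sup>a = 0\<close>, the
integrability condition is that the \<open>Q\<^sub>a\<close> commute. This is where dimension three enters: the commutators are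
cubic polynomials which vanish identically (\<open>flat_form_commute\<close>), so that no condition is imposed on the
initial value. The Frobenius theorem (\<open>frobenius_at_origin\<close>) yields a solution \<open>u\<close> with any prescribed value
at the point. The right-hand side of the Hessian equation is symmetric, hence the linear part of \<open>u\<close> is a
closed 1-form, and the Poincare lemma gives \<open>t'\<close>.

The Frobenius theorem is proved by Picard iteration along the rays through the base point. The integrability
condition makes the defect \<open>du - F(x, u)\<close> of the iterates decay geometrically, so that their derivatives
converge as well (\<open>picard_step_derivative\<close>). The same theorem gives the parallel frame of a flat metric and
the Poincare lemma.\<close>

section \<open>Calculus of smooth functions\<close>

lemma has_derivative_cong_open:
  assumes "open U" "\<And>x. x \<in> U \<Longrightarrow> f x = g x" "x \<in> U"
  shows "(f has_derivative D) (at x) \<longleftrightarrow> (g has_derivative D) (at x)"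
  using has_derivative_transform_within_open[of f D x UNIV U g]
    has_derivative_transform_within_open[of g D x UNIV U f] assms by auto

lemma pd_cong:
  assumes "open U" "\<And>x. x \<in> U \<Longrightarrow> f x = g x" "x \<in> U"
  shows "pd i f x = pd i g x"
  using has_derivative_cong_open[OF assms] by (simp add: pd_def frechet_derivative_def)

lemma Ck_on_cong:
  assumes "open U" "\<And>x. x \<in> U \<Longrightarrow> f x = g x"
  shows "Ck_on k U f \<longleftrightarrow> Ck_on k U g"
  using assms(2)
proof (induction k arbitrary: f g)
  case 0
  then show ?case by (auto intro: continuous_on_cong)
next
  case (Suc k)
  have "f differentiable at x \<longleftrightarrow> g differentiable at x" if "x \<in> U" for x
    using has_derivative_cong_open[OF assms(1) Suc.prems that] by (simp add: differentiable_def)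
  moreover have "Ck_on k U (pd i f) \<longleftrightarrow> Ck_on k U (pd i g)" for i
    by (intro Suc.IH pd_cong[OF assms(1) Suc.prems])
  ultimately show ?case by simp
qed

lemma pd_eq: "(f has_derivative D) (at x) \<Longrightarrow> pd i f x = D (axis i 1)"
  unfolding pd_def using frechet_derivative_at by metis

lemma has_derivative_pd:
  assumes "f differentiable at x"
  shows "(f has_derivative (\<lambda>h. \<Sum>i\<in>UNIV. h $ i * pd i f x)) (at x)"
proof -
  have D: "(f has_derivative frechet_derivative f (at x)) (at x)"
    using assms frechet_derivative_works by blast
  have "frechet_derivative f (at x) h = (\<Sum>i\<in>UNIV. h $ i * pd i f x)" for h
  proof -
    have l: "linear (frechet_derivative f (at x))"
      using D has_derivative_linear by blast
    have "frechet_derivative f (at x) h = frechet_derivative f (at x) (\<Sum>i\<in>UNIV. (h $ i) *\<^sub>R axis i 1)"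
      by (subst basis_expansion[of h, symmetric]) (simp add: scalar_mult_eq_scaleR)
    also have "\<dots> = (\<Sum>i\<in>UNIV. h $ i * pd i f x)"
      by (simp add: linear_sum[OF l] linear_cmul[OF l] pd_def)
    finally show ?thesis .
  qed
  then show ?thesis using D by (simp add: has_derivative_eq_rhs[OF D] fun_eq_iff)
qed

lemma pd_const [simp]: "pd i (\<lambda>_. c) x = 0"
  using pd_eq[OF has_derivative_const] by auto

lemma pd_add: "f differentiable at x \<Longrightarrow> g differentiable at x \<Longrightarrow>
    pd i (\<lambda>y. f y + g y) x = pd i f x + pd i g x"
  unfolding frechet_derivative_works by (subst pd_eq[OF has_derivative_add]) (auto simp: pd_def)

lemma pd_diff: "f differentiable at x \<Longrightarrow> g differentiable at x \<Longrightarrow>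
    pd i (\<lambda>y. f y - g y) x = pd i f x - pd i g x"
  unfolding frechet_derivative_works by (subst pd_eq[OF has_derivative_diff]) (auto simp: pd_def)

lemma pd_mult: "f differentiable at x \<Longrightarrow> g differentiable at x \<Longrightarrow>
    pd i (\<lambda>y. f y * g y) x = pd i f x * g x + f x * pd i g x"
  unfolding frechet_derivative_works
  by (subst pd_eq[OF has_derivative_mult]) (auto simp: pd_def)

lemma pd_sum: "(\<And>a. a \<in> I \<Longrightarrow> f a differentiable at x) \<Longrightarrow>
    pd i (\<lambda>y. \<Sum>a\<in>I. f a y) x = (\<Sum>a\<in>I. pd i (f a) x)"
  unfolding frechet_derivative_works
  by (subst pd_eq[OF has_derivative_sum]) (auto simp: pd_def)

lemma pd_exp: "f differentiable at x \<Longrightarrow> pd i (\<lambda>y. exp (f y)) x = exp (f x) * pd i f x"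
  unfolding frechet_derivative_works
  by (subst pd_eq[OF has_derivative_exp]) (auto simp: pd_def)

lemma pd_inverse: "f differentiable at x \<Longrightarrow> f x \<noteq> 0 \<Longrightarrow>
    pd i (\<lambda>y. inverse (f y)) x = - (inverse (f x) * pd i f x * inverse (f x))"
  unfolding frechet_derivative_works
  by (subst pd_eq[OF Deriv.has_derivative_inverse]) (auto simp: pd_def)

lemma Ck_on_imp_continuous_on: "Ck_on k U f \<Longrightarrow> continuous_on U f"
  by (cases k) (auto intro!: continuous_at_imp_continuous_on differentiable_imp_continuous_within)

lemma Ck_on_Suc_imp: "Ck_on (Suc k) U f \<Longrightarrow> Ck_on k U f"
proof (induction k arbitrary: f)
  case 0
  then show ?case by (simp only: Ck_on.simps(1) Ck_on_imp_continuous_on)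
next
  case (Suc k)
  then show ?case by (metis Ck_on.simps(2))
qed

lemma Ck_on_subset: "Ck_on k U f \<Longrightarrow> V \<subseteq> U \<Longrightarrow> Ck_on k V f"
  by (induction k arbitrary: f) (auto intro: continuous_on_subset)

lemma Ck_on_const: "Ck_on k U (\<lambda>_. c)"
proof (induction k arbitrary: c)
  case (Suc k)
  then show ?case by (simp add: pd_const[abs_def])
qed auto

lemma Ck_on_add: "open U \<Longrightarrow> Ck_on k U f \<Longrightarrow> Ck_on k U g \<Longrightarrow> Ck_on k U (\<lambda>x. f x + g x)"
proof (induction k arbitrary: f g)
  case (Suc k)
  have "Ck_on k U (pd i (\<lambda>x. f x + g x)) \<longleftrightarrow> Ck_on k U (\<lambda>x. pd i f x + pd i g x)" for i
    using Suc.prems by (intro Ck_on_cong) (auto simp: pd_add)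
  then show ?case using Suc by auto
qed (auto intro: continuous_intros)

lemma Ck_on_mult: "open U \<Longrightarrow> Ck_on k U f \<Longrightarrow> Ck_on k U g \<Longrightarrow> Ck_on k U (\<lambda>x. f x * g x)"
proof (induction k arbitrary: f g)
  case (Suc k)
  have "Ck_on k U (pd i (\<lambda>x. f x * g x)) \<longleftrightarrow> Ck_on k U (\<lambda>x. pd i f x * g x + f x * pd i g x)" for i
    using Suc.prems by (intro Ck_on_cong) (auto simp: pd_mult)
  moreover have "Ck_on k U f" "Ck_on k U g" using Suc.prems Ck_on_Suc_imp by blast+
  ultimately show ?case using Suc by (auto intro!: Ck_on_add)
qed (auto intro: continuous_intros)

lemma Ck_on_uminus: "open U \<Longrightarrow> Ck_on k U f \<Longrightarrow> Ck_on k U (\<lambda>x. - f x)"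
  using Ck_on_mult[OF _ Ck_on_const[of k U "-1"], of f] by simp

lemma Ck_on_diff: "open U \<Longrightarrow> Ck_on k U f \<Longrightarrow> Ck_on k U g \<Longrightarrow> Ck_on k U (\<lambda>x. f x - g x)"
  using Ck_on_add[of U k f "\<lambda>x. - g x"] Ck_on_uminus by auto

lemma Ck_on_sum: "open U \<Longrightarrow> (\<And>a. a \<in> I \<Longrightarrow> Ck_on k U (f a)) \<Longrightarrow> Ck_on k U (\<lambda>x. \<Sum>a\<in>I. f a x)"
  by (induction I rule: infinite_finite_induct) (auto intro: Ck_on_const Ck_on_add)

lemma Ck_on_exp: "open U \<Longrightarrow> Ck_on k U f \<Longrightarrow> Ck_on k U (\<lambda>x. exp (f x))"
proof (induction k arbitrary: f)
  case (Suc k)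
  have "Ck_on k U (pd i (\<lambda>x. exp (f x))) \<longleftrightarrow> Ck_on k U (\<lambda>x. exp (f x) * pd i f x)" for i
    using Suc.prems by (intro Ck_on_cong) (auto simp: pd_exp)
  moreover have "Ck_on k U f" using Suc.prems Ck_on_Suc_imp by blast
  moreover have "(\<lambda>x. exp (f x)) differentiable at x" if "f differentiable at x" for x
    using that unfolding differentiable_def by (blast intro: has_derivative_exp)
  ultimately show ?case using Suc by (auto intro!: Ck_on_mult)
qed (auto intro: continuous_intros)

lemma Ck_on_inverse: "open U \<Longrightarrow> Ck_on k U f \<Longrightarrow> (\<And>x. x \<in> U \<Longrightarrow> f x \<noteq> 0) \<Longrightarrow> Ck_on k U (\<lambda>x. inverse (f x))"
proof (induction k)
  case (Suc k)
  have "Ck_on k U (pd i (\<lambda>x. inverse (f x))) \<longleftrightarrow> Ck_on k U (\<lambda>x. - (inverse (f x) * pd i f x * inverse (f x)))" for i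
    using Suc.prems by (intro Ck_on_cong) (auto simp: pd_inverse)
  moreover have "Ck_on k U f" using Suc.prems Ck_on_Suc_imp by blast
  ultimately show ?case using Suc by (auto intro!: Ck_on_mult Ck_on_uminus)
qed (auto intro: continuous_intros)

lemma smooth_on_pd: "smooth_on U f \<Longrightarrow> smooth_on U (pd i f)"
  unfolding smooth_on_def by (metis Ck_on.simps(2))

lemma smooth_on_differentiable: "smooth_on U f \<Longrightarrow> x \<in> U \<Longrightarrow> f differentiable at x"
  unfolding smooth_on_def by (metis Ck_on.simps(2))

lemma smooth_on_continuous_on: "smooth_on U f \<Longrightarrow> continuous_on U f"
  unfolding smooth_on_def using Ck_on_imp_continuous_on by blast

lemma smooth_on_subset: "smooth_on U f \<Longrightarrow> V \<subseteq> U \<Longrightarrow> smooth_on V f"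
  unfolding smooth_on_def using Ck_on_subset by blast

lemma smooth_on_cong: "open U \<Longrightarrow> (\<And>x. x \<in> U \<Longrightarrow> f x = g x) \<Longrightarrow> smooth_on U f \<longleftrightarrow> smooth_on U g"
  unfolding smooth_on_def using Ck_on_cong by blast

lemma smooth_on_const [simp]: "smooth_on U (\<lambda>_. c)"
  by (simp add: smooth_on_def Ck_on_const)

lemma smooth_on_arith:
  assumes "open U"
  shows smooth_on_add: "smooth_on U f \<Longrightarrow> smooth_on U g \<Longrightarrow> smooth_on U (\<lambda>x. f x + g x)"
    and smooth_on_diff: "smooth_on U f \<Longrightarrow> smooth_on U g \<Longrightarrow> smooth_on U (\<lambda>x. f x - g x)"
    and smooth_on_mult: "smooth_on U f \<Longrightarrow> smooth_on U g \<Longrightarrow> smooth_on U (\<lambda>x. f x * g x)"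
    and smooth_on_uminus: "smooth_on U f \<Longrightarrow> smooth_on U (\<lambda>x. - f x)"
    and smooth_on_sum: "(\<And>a. a \<in> I \<Longrightarrow> smooth_on U (F a)) \<Longrightarrow> smooth_on U (\<lambda>x. \<Sum>a\<in>I. F a x)"
    and smooth_on_exp: "smooth_on U f \<Longrightarrow> smooth_on U (\<lambda>x. exp (f x))"
    and smooth_on_inverse: "smooth_on U f \<Longrightarrow> (\<And>x. x \<in> U \<Longrightarrow> f x \<noteq> 0) \<Longrightarrow> smooth_on U (\<lambda>x. inverse (f x))"
  using assms by (auto simp: smooth_on_def intro: Ck_on_add Ck_on_diff Ck_on_mult Ck_on_uminus
      Ck_on_sum Ck_on_exp Ck_on_inverse)

text \<open>Two applications of the mean value theorem in either order to the second difference of \<open>f\<close> over a small square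
make it equal to a value of one mixed derivative and to a value of the other at nearby points. Continuity of
the mixed derivatives then forces equality at \<open>x\<close>.\<close>

lemma pd_commute:
  assumes "open U" "smooth_on U f" "x \<in> U"
  shows "pd i (pd j f) x = pd j (pd i f) x"
proof -
  have key: "\<exists>y\<in>ball x (2 * h). \<exists>z\<in>ball x (2 * h). pd i (pd j f) y = pd j (pd i f) z"
    if h: "0 < h" "ball x (2 * h) \<subseteq> U" for h
  proof -
    define P where "P = (\<lambda>s t. x + s *\<^sub>R axis i 1 + t *\<^sub>R axis j 1)"
    have PB: "P s t \<in> ball x (2 * h)" if "\<bar>s\<bar> \<le> a" "\<bar>t\<bar> \<le> b" "a + b < 2 * h" for s t a b
    proof -
      have "norm (s *\<^sub>R axis i (1::real) + t *\<^sub>R axis j 1) \<le> \<bar>s\<bar> + \<bar>t\<bar>"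
        using norm_triangle_ineq[of "s *\<^sub>R axis i (1::real)" "t *\<^sub>R axis j 1"]
        by (simp add: norm_axis_1)
      then show ?thesis using that by (simp add: P_def dist_norm norm_minus_commute algebra_simps)
    qed
    have ds: "((\<lambda>s. k (P s t)) has_real_derivative pd i k (P s t)) (at s)"
      if "k differentiable at (P s t)" for k s t
    proof -
      have "((\<lambda>s. P s t) has_derivative (\<lambda>r. r *\<^sub>R axis i 1)) (at s)"
        unfolding P_def by (auto intro!: derivative_eq_intros)
      from has_derivative_compose[OF this that[unfolded frechet_derivative_works]]
      show ?thesis unfolding has_field_derivative_def
        by (rule has_derivative_eq_rhs)
           (use linear_cmul[OF has_derivative_linear[OF that[unfolded frechet_derivative_works]]]
            in \<open>auto simp: pd_def mult.commute\<close>)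
    qed
    have dt: "((\<lambda>t. k (P s t)) has_real_derivative pd j k (P s t)) (at t)"
      if "k differentiable at (P s t)" for k s t
    proof -
      have "((\<lambda>t. P s t) has_derivative (\<lambda>r. r *\<^sub>R axis j 1)) (at t)"
        unfolding P_def by (auto intro!: derivative_eq_intros)
      from has_derivative_compose[OF this that[unfolded frechet_derivative_works]]
      show ?thesis unfolding has_field_derivative_def
        by (rule has_derivative_eq_rhs)
           (use linear_cmul[OF has_derivative_linear[OF that[unfolded frechet_derivative_works]]]
            in \<open>auto simp: pd_def mult.commute\<close>)
    qed
    \<comment> \<open>The side of the square; the corners \<open>P s t\<close> stay in the ball because \<open>2 \<eta> = h < 2 h\<close>.\<close>
    define \<eta> where "\<eta> = h / 2"
    have \<eta>: "0 < \<eta>" "\<eta> + \<eta> < 2 * h" using h by (auto simp: \<eta>_def)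
    have dif: "f differentiable at (P s t)" "pd k f differentiable at (P s t)"
      if "0 \<le> s" "s \<le> \<eta>" "0 \<le> t" "t \<le> \<eta>" for k s t
      using PB[of s \<eta> t \<eta>] that \<eta> h(2) assms(2)
      by (auto intro!: smooth_on_differentiable[where U=U] smooth_on_pd)
    define \<Delta> where "\<Delta> = f (P \<eta> \<eta>) - f (P \<eta> 0) - f (P 0 \<eta>) + f (P 0 0)"
    have "\<exists>s>0. s < \<eta> \<and> (f (P \<eta> \<eta>) - f (P \<eta> 0)) - (f (P 0 \<eta>) - f (P 0 0)) =
       (\<eta> - 0) * (pd i f (P s \<eta>) - pd i f (P s 0))"
      by (rule MVT2[OF \<eta>(1)]) (use dif \<eta> in \<open>auto intro!: DERIV_diff ds\<close>)
    then obtain s where s: "0 < s" "s < \<eta>" "\<Delta> = \<eta> * (pd i f (P s \<eta>) - pd i f (P s 0))"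
      by (auto simp: \<Delta>_def)
    have "\<exists>t>0. t < \<eta> \<and> pd i f (P s \<eta>) - pd i f (P s 0) = (\<eta> - 0) * pd j (pd i f) (P s t)"
      by (rule MVT2[OF \<eta>(1)]) (use dif s in \<open>auto intro!: dt\<close>)
    then obtain t where t: "0 < t" "t < \<eta>" "\<Delta> = \<eta> * (\<eta> * pd j (pd i f) (P s t))"
      using s by auto
    have "\<exists>t'>0. t' < \<eta> \<and> (f (P \<eta> \<eta>) - f (P 0 \<eta>)) - (f (P \<eta> 0) - f (P 0 0)) =
       (\<eta> - 0) * (pd j f (P \<eta> t') - pd j f (P 0 t'))"
      by (rule MVT2[OF \<eta>(1)]) (use dif \<eta> in \<open>auto intro!: DERIV_diff dt\<close>)
    then obtain t' where t': "0 < t'" "t' < \<eta>" "\<Delta> = \<eta> * (pd j f (P \<eta> t') - pd j f (P 0 t'))"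
      by (auto simp: \<Delta>_def algebra_simps)
    have "\<exists>s'>0. s' < \<eta> \<and> pd j f (P \<eta> t') - pd j f (P 0 t') = (\<eta> - 0) * pd i (pd j f) (P s' t')"
      by (rule MVT2[OF \<eta>(1)]) (use dif t' in \<open>auto intro!: ds\<close>)
    then obtain s' where s': "0 < s'" "s' < \<eta>" "\<Delta> = \<eta> * (\<eta> * pd i (pd j f) (P s' t'))"
      using t' by auto
    have "pd i (pd j f) (P s' t') = pd j (pd i f) (P s t)" using t s' \<eta> by auto
    moreover have "P s' t' \<in> ball x (2 * h)" "P s t \<in> ball x (2 * h)"
      using s t s' t' \<eta> by (auto intro!: PB[where a=\<eta> and b=\<eta>] simp del: mem_ball)
    ultimately show ?thesis by blast
  qed
  have cont: "isCont (pd i (pd j f)) x" "isCont (pd j (pd i f)) x"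
    using smooth_on_continuous_on[OF smooth_on_pd[OF smooth_on_pd[OF assms(2)]]] assms
    by (auto simp: continuous_on_eq_continuous_at)
  obtain \<delta> where \<delta>: "\<delta> > 0" "ball x \<delta> \<subseteq> U" using assms openE by blast
  show ?thesis
  proof (rule ccontr)
    assume ne: "\<not> ?thesis"
    define e where "e = \<bar>pd i (pd j f) x - pd j (pd i f) x\<bar> / 2"
    have e: "e > 0" using ne by (simp add: e_def)
    obtain d1 where d1: "d1 > 0" "\<And>y. dist y x < d1 \<Longrightarrow> dist (pd i (pd j f) y) (pd i (pd j f) x) < e"
      using cont(1) e unfolding continuous_at_eps_delta by blast
    obtain d2 where d2: "d2 > 0" "\<And>y. dist y x < d2 \<Longrightarrow> dist (pd j (pd i f) y) (pd j (pd i f) x) < e"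
      using cont(2) e unfolding continuous_at_eps_delta by blast
    define h where "h = min \<delta> (min d1 d2) / 2"
    have h: "h > 0" "2 * h \<le> \<delta>" "2 * h \<le> d1" "2 * h \<le> d2" using \<delta> d1 d2 by (auto simp: h_def)
    have "ball x (2 * h) \<subseteq> U" using h \<delta> by auto
    from key[OF h(1) this] obtain y z where yz: "y \<in> ball x (2 * h)" "z \<in> ball x (2 * h)"
      "pd i (pd j f) y = pd j (pd i f) z" by blast
    have "dist y x < d1" "dist z x < d2" using yz h by (auto simp: dist_commute)
    from d1(2)[OF this(1)] d2(2)[OF this(2)]
    have "dist (pd i (pd j f) y) (pd i (pd j f) x) < e" "dist (pd j (pd i f) z) (pd j (pd i f) x) < e" .
    moreover have "\<bar>a - b\<bar> \<le> \<bar>c - a\<bar> + \<bar>c - b\<bar>" for a b c :: real by arith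
    ultimately show False using yz(3) unfolding e_def dist_real_def
      by (smt (verit) field_sum_of_halves)
  qed
qed

section \<open>The Frobenius theorem\<close>

text \<open>For the integrable system \<open>du = F(x, u)\<close> one Picard step \<open>v\<close> along rays need not satisfy the equation, but it
misses it by little if \<open>u\<close> does. The integrand of \<open>v'(x) h\<close> is
\<open>F h + s F'(h, u' h) x\<close>, while \<open>F(x, u x) h\<close> is the integral of
\<open>d/ds (s F(s x, u (s x)) h) = F h + s F'(x, u' x) h\<close>. By the integrability condition \<open>compat\<close> the two integrands
agree where \<open>u' = F\<close>, hence in general they differ by terms linear in the defect \<open>u' - F\<close>. On a small ball the
factor \<open>2 L r\<close> is small, and the defect contracts.\<close>

lemma picard_step_derivative:
  fixes F :: "'a::euclidean_space \<times> 'b::euclidean_space \<Rightarrow> 'a \<Rightarrow>\<^sub>L 'b"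
    and F' :: "'a \<times> 'b \<Rightarrow> ('a \<times> 'b) \<Rightarrow>\<^sub>L ('a \<Rightarrow>\<^sub>L 'b)"
    and u :: "'a \<Rightarrow> 'b" and u' :: "'a \<Rightarrow> 'a \<Rightarrow>\<^sub>L 'b" and D :: "('a \<times> 'b) set" and u0 :: 'b
  assumes derF: "\<And>z. z \<in> D \<Longrightarrow> (F has_derivative F' z) (at z)"
    and contF': "continuous_on D F'"
    and compat: "\<And>z v w. z \<in> D \<Longrightarrow> F' z (v, F z v) w = F' z (w, F z w) v"
    and bound: "\<And>z. z \<in> D \<Longrightarrow> norm (F' z) \<le> L"
    and uD: "\<And>x. x \<in> ball 0 r \<Longrightarrow> (x, u x) \<in> D"
    and deru: "\<And>x. x \<in> ball 0 r \<Longrightarrow> (u has_derivative u' x) (at x)"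
    and contu': "continuous_on (ball 0 r) u'"
    and defect: "\<And>x. x \<in> ball 0 r \<Longrightarrow> norm (u' x - F (x, u x)) \<le> e"
  defines "v \<equiv> (\<lambda>x. u0 + integral {0..1} (\<lambda>s::real. F (s *\<^sub>R x, u (s *\<^sub>R x)) x))"
  shows "\<exists>v'. continuous_on (ball 0 r) v' \<and>
     (\<forall>x\<in>ball 0 r. (v has_derivative blinfun_apply (v' x)) (at x) \<and>
        norm (v' x - F (x, u x)) \<le> 2 * L * r * e)"
proof -
  define B where "B = ball (0::'a) r"
  have sB: "s *\<^sub>R x \<in> B" if "x \<in> B" "s \<in> {0..1}" for s x
  proof -
    have "\<bar>s\<bar> * norm x \<le> 1 * norm x" using that by (intro mult_right_mono) auto
    then show ?thesis using that by (auto simp: B_def)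
  qed
  define z where "z = (\<lambda>s x. (s *\<^sub>R x, u (s *\<^sub>R x)))"
  have zD: "z s x \<in> D" if "x \<in> B" "s \<in> {0..1}" for s x
    using uD sB[OF that] by (simp add: z_def B_def)
  define G where "G = (\<lambda>x s. Blinfun (\<lambda>h. F (z s x) h +
       s *\<^sub>R F' (z s x) (h, u' (s *\<^sub>R x) h) x))"
  have G: "G x s h = F (z s x) h + s *\<^sub>R F' (z s x) (h, u' (s *\<^sub>R x) h) x" for x s h
  proof -
    have "bounded_linear (\<lambda>h. F (z s x) h + s *\<^sub>R F' (z s x) (h, u' (s *\<^sub>R x) h) x)"
      by (intro bounded_linear_add bounded_linear_scaleR_right bounded_linear_compose[OF bounded_linear_scaleR_right]
          bounded_linear_compose[OF blinfun.bounded_linear_left] bounded_linear_compose[OF blinfun.bounded_linear_right]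
          bounded_linear_Pair bounded_linear_ident blinfun.bounded_linear_right)
    then show ?thesis by (simp add: G_def bounded_linear_Blinfun_apply)
  qed
  have derz: "((\<lambda>x. z s x) has_derivative (\<lambda>h. (s *\<^sub>R h, s *\<^sub>R u' (s *\<^sub>R x) h))) (at x)"
    if "x \<in> B" "s \<in> {0..1}" for s x
  proof -
    have "((\<lambda>x. u (s *\<^sub>R x)) has_derivative (\<lambda>h. u' (s *\<^sub>R x) (s *\<^sub>R h))) (at x)"
      using deru sB[OF that]
      by (intro has_derivative_compose[where f="\<lambda>x. s *\<^sub>R x" and g=u])
         (auto intro!: derivative_eq_intros simp: B_def)
    then show ?thesis unfolding z_def
      by (auto intro!: derivative_eq_intros simp: blinfun.scaleR_right)
  qed
  have contu: "continuous_on B u"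
    using deru by (auto simp: B_def intro!: has_derivative_continuous continuous_at_imp_continuous_on)
  have contF: "continuous_on D F"
    using derF by (auto intro!: has_derivative_continuous continuous_at_imp_continuous_on)
  have contz: "continuous_on (B \<times> {0..1}) (\<lambda>(x, s). z s x)"
    unfolding z_def case_prod_unfold using sB
    by (intro continuous_intros continuous_on_compose2[OF contu]) auto
  have contFz: "continuous_on (B \<times> {0..1}) (\<lambda>p. F (z (snd p) (fst p)))"
    using contz zD by (intro continuous_on_compose2[OF contF]) (auto simp: case_prod_unfold)
  have contFz': "continuous_on (B \<times> {0..1}) (\<lambda>p. F' (z (snd p) (fst p)))"
    using contz zD by (intro continuous_on_compose2[OF contF']) (auto simp: case_prod_unfold)
  have contuz': "continuous_on (B \<times> {0..1}) (\<lambda>p. u' (snd p *\<^sub>R fst p))"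
    using sB by (intro continuous_on_compose2[OF contu'[folded B_def]]) (auto intro!: continuous_intros)
  have contG: "continuous_on (B \<times> cbox 0 1) (\<lambda>(x, s). G x s)"
    unfolding case_prod_unfold cbox_interval
    by (rule continuous_on_blinfun_componentwise, unfold G)
       (intro continuous_intros contFz contFz' contuz')
  have int0: "(\<lambda>s. F (z s x) x) integrable_on cbox 0 1" if "x \<in> B" for x
    unfolding cbox_interval
  proof (intro integrable_continuous_interval continuous_intros)
    show "continuous_on {0..1} (\<lambda>s. F (z s x))"
      by (rule continuous_on_compose2[OF contFz, where f="\<lambda>s. (x, s)", simplified])
         (use that in \<open>auto intro!: continuous_intros\<close>)
  qed
  have contG1: "continuous_on {0..1} (G x)" if "x \<in> B" for x
    by (rule continuous_on_compose2[OF contG, where f="\<lambda>s. (x, s)", simplified])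
       (use that in \<open>auto intro!: continuous_intros\<close>)
  define v' where "v' = (\<lambda>x. integral (cbox 0 1) (G x))"
  have derFx: "((\<lambda>x. F (z s x) x) has_derivative G x s) (at x)" if "x \<in> B" "s \<in> {0..1}" for s x
  proof -
    have 1: "((\<lambda>x. F (z s x)) has_derivative (\<lambda>h. F' (z s x) (s *\<^sub>R h, s *\<^sub>R u' (s *\<^sub>R x) h))) (at x)"
      using derz[OF that] derF[OF zD[OF that]] by (rule has_derivative_compose)
    have "((\<lambda>x. F (z s x) x) has_derivative
       (\<lambda>h. F (z s x) h + F' (z s x) (s *\<^sub>R h, s *\<^sub>R u' (s *\<^sub>R x) h) x)) (at x)"
      using blinfun.FDERIV[OF 1 has_derivative_ident] by simp
    moreover have "F' (z s x) (s *\<^sub>R h, s *\<^sub>R u' (s *\<^sub>R x) h) x =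
        s *\<^sub>R F' (z s x) (h, u' (s *\<^sub>R x) h) x" for h
      by (metis scaleR_Pair blinfun.scaleR_right blinfun.scaleR_left)
    ultimately show ?thesis by (simp add: G[abs_def])
  qed
  have derv: "(v has_derivative v' x) (at x)" if "x \<in> B" for x
  proof -
    have "((\<lambda>x. integral (cbox 0 1) (\<lambda>s. F (z s x) x)) has_derivative integral (cbox 0 1) (G x)) (at x within B)"
      using derFx int0 contG that
      by (intro leibniz_rule) (auto intro: has_derivative_at_withinI simp: B_def)
    then have "((\<lambda>x. u0 + integral (cbox 0 1) (\<lambda>s. F (z s x) x)) has_derivative v' x) (at x within B)"
      by (auto intro!: derivative_eq_intros simp: v'_def)
    then show ?thesis using that by (simp add: v_def z_def B_def at_within_open[OF _ open_ball])
  qed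
  have contv': "continuous_on B v'"
    unfolding v'_def by (rule integral_continuous_on_param[OF contG])
  have est: "norm (v' x - F (x, u x)) \<le> 2 * L * r * e" if x: "x \<in> B" for x
  proof -
    have L0: "0 \<le> L" using order_trans[OF norm_ge_zero bound[OF uD]] x by (auto simp: B_def)
    have e0: "0 \<le> e" using order_trans[OF norm_ge_zero defect] x by (auto simp: B_def)
    have r0: "0 \<le> r" using order_trans[OF norm_ge_zero[of x]] x by (auto simp: B_def)
    have "norm ((v' x - F (x, u x)) h) \<le> 2 * L * r * e * norm h" for h
    proof -
      define E where "E = (\<lambda>s. u' (s *\<^sub>R x) - F (z s x))"
      have Eb: "norm (E s w) \<le> e * norm w" if "s \<in> {0..1}" for s w
      proof -
        have "norm (E s) \<le> e" using defect[of "s *\<^sub>R x"] sB[OF x that] by (simp add: E_def z_def B_def)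
        then show ?thesis by (meson norm_blinfun order_trans mult_right_mono norm_ge_zero)
      qed
      define R where "R = (\<lambda>s. s *\<^sub>R (F' (z s x) (0, E s h) x - F' (z s x) (0, E s x) h))"
      \<comment> \<open>\<open>d s\<close> is the derivative of \<open>s F(s x, u (s x)) h\<close> with respect to \<open>s\<close>.\<close>
      define d where "d = (\<lambda>s. F (z s x) h + s *\<^sub>R F' (z s x) (x, u' (s *\<^sub>R x) x) h)"
      \<comment> \<open>Split \<open>u' = F + E\<close>: integrability applies to the first part, and the second is the defect.\<close>
      have sp: "s *\<^sub>R F' (z s x) (w, u' (s *\<^sub>R x) w) y = s *\<^sub>R F' (z s x) (w, F (z s x) w) y
          + s *\<^sub>R F' (z s x) (0, E s w) y" for s w y
      proof -
        have "(w, u' (s *\<^sub>R x) w) = (w, F (z s x) w) + (0, E s w)"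
          by (simp add: E_def blinfun.diff_left)
        then show ?thesis by (simp only: blinfun.add_right blinfun.add_left scaleR_add_right)
      qed
      have Gd: "G x s h = d s + R s" if "s \<in> {0..1}" for s
        unfolding G d_def R_def sp using compat[OF zD[OF x that], of h x]
        by (simp add: algebra_simps)
      have dint: "(d has_integral F (x, u x) h) {0..1}"
      proof -
        have "((\<lambda>s. s *\<^sub>R F (z s x) h) has_vector_derivative d s) (at s within {0..1})" if "s \<in> {0..1}" for s
        proof -
          have sx: "((\<lambda>s. s *\<^sub>R x) has_derivative (\<lambda>k. k *\<^sub>R x)) (at s)"
            by (auto intro!: derivative_eq_intros)
          have "((\<lambda>s. u (s *\<^sub>R x)) has_derivative (\<lambda>k. u' (s *\<^sub>R x) (k *\<^sub>R x))) (at s)"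
            using deru sB[OF x that] by (intro has_derivative_compose[OF sx]) (auto simp: B_def)
          then have "((\<lambda>s. z s x) has_derivative (\<lambda>k. (k *\<^sub>R x, k *\<^sub>R u' (s *\<^sub>R x) x))) (at s)"
            unfolding z_def by (auto intro!: derivative_eq_intros simp: blinfun.scaleR_right)
          from has_derivative_compose[OF this derF[OF zD[OF x that]]]
          have "((\<lambda>s. F (z s x)) has_derivative (\<lambda>k. F' (z s x) (k *\<^sub>R x, k *\<^sub>R u' (s *\<^sub>R x) x))) (at s)" .
          then have "((\<lambda>s. F (z s x) h) has_derivative (\<lambda>k. F' (z s x) (k *\<^sub>R x, k *\<^sub>R u' (s *\<^sub>R x) x) h)) (at s)"
            using blinfun.FDERIV[where g="\<lambda>_. h" and g'="\<lambda>_. 0"] by fastforce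
          moreover have "F' (z s x) (k *\<^sub>R x, k *\<^sub>R u' (s *\<^sub>R x) x) h = k *\<^sub>R F' (z s x) (x, u' (s *\<^sub>R x) x) h" for k
            by (metis scaleR_Pair blinfun.scaleR_right blinfun.scaleR_left)
          ultimately have D1: "((\<lambda>s. F (z s x) h) has_derivative (\<lambda>k. k *\<^sub>R F' (z s x) (x, u' (s *\<^sub>R x) x) h)) (at s)"
            by simp
          have "((\<lambda>s. s *\<^sub>R F (z s x) h) has_derivative (\<lambda>k. k *\<^sub>R d s)) (at s)"
            by (rule has_derivative_eq_rhs[OF has_derivative_scaleR[OF has_derivative_ident D1]])
               (simp add: d_def algebra_simps)
          then show ?thesis unfolding has_vector_derivative_def by (rule has_derivative_at_withinI)
        qed
        from fundamental_theorem_of_calculus[OF _ this] show ?thesis by (simp add: z_def)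
      qed
      have Gint: "((\<lambda>s. G x s h) has_integral v' x h) {0..1}"
      proof -
        have "(G x) integrable_on {0..1}" by (intro integrable_continuous_interval contG1 x)
        from has_integral_linear[OF integrable_integral[OF this] blinfun.bounded_linear_left[of h]]
        show ?thesis by (simp add: v'_def o_def cbox_interval)
      qed
      have "((\<lambda>s. G x s h - d s) has_integral (v' x h - F (x, u x) h)) {0..1}"
        by (rule has_integral_diff[OF Gint dint])
      then have Rint: "(R has_integral (v' x h - F (x, u x) h)) {0..1}"
        by (rule has_integral_eq[rotated]) (simp add: Gd)
      have "norm (v' x h - F (x, u x) h) \<le> 2 * L * r * e * norm h * Henstock_Kurzweil_Integration.content {0..1::real}"
      proof (rule has_integral_bound_real[OF _ finite.emptyI Rint])
        show "0 \<le> 2 * L * r * e * norm h" using L0 e0 r0 by simp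
        fix s :: real assume "s \<in> {0..1} - {}"
        then have s: "s \<in> {0..1}" by simp
        have F'b: "norm (F' (z s x) (0, w) y) \<le> L * norm w * norm y" for w y
        proof -
          have "norm (F' (z s x) (0, w) y) \<le> norm (F' (z s x) (0, w)) * norm y" by (rule norm_blinfun)
          also have "\<dots> \<le> norm (F' (z s x)) * norm (0::'a, w) * norm y"
            by (intro mult_right_mono norm_blinfun) auto
          also have "\<dots> \<le> L * norm w * norm y"
            using bound[OF zD[OF x s]] by (auto simp: norm_Pair intro!: mult_right_mono)
          finally show ?thesis .
        qed
        have xr: "norm x \<le> r" using x by (simp add: B_def)
        have "norm (R s) \<le> 1 * (norm (F' (z s x) (0, E s h) x) + norm (F' (z s x) (0, E s x) h))"
          unfolding R_def norm_scaleR using s by (intro mult_mono norm_triangle_ineq4) auto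
        also have "\<dots> \<le> L * norm (E s h) * norm x + L * norm (E s x) * norm h"
          using F'b[of "E s h" x] F'b[of "E s x" h] by simp
        also have "\<dots> \<le> L * (e * norm h) * norm x + L * (e * norm x) * norm h"
          using L0 by (intro add_mono mult_right_mono mult_left_mono Eb s) auto
        also have "\<dots> = 2 * L * e * norm h * norm x" by simp
        also have "\<dots> \<le> 2 * L * e * norm h * r" using L0 e0 by (intro mult_left_mono xr) auto
        finally show "norm (R s) \<le> 2 * L * r * e * norm h" by (simp add: mult_ac)
      qed
      then show ?thesis by (simp add: blinfun.diff_left)
    qed
    then show ?thesis using L0 e0 r0 by (intro norm_blinfun_bound) auto
  qed
  show ?thesis using contv' derv est unfolding B_def by blast
qed

text \<open>The Picard operator \<open>T\<close> contracts uniform distances by the factor \<open>1/8\<close>, and the defect of the \<open>k\<close>-th iterate is at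
most \<open>A / 2\<^sup>k\<close> by \<open>picard_step_derivative\<close>. Therefore the derivatives of the iterates converge uniformly to
\<open>F(x, u x)\<close>, where \<open>u\<close> is the limit, and differentiation may be exchanged with the limit.\<close>

theorem frobenius_at_origin:
  fixes F :: "'a::euclidean_space \<times> 'b::euclidean_space \<Rightarrow> 'a \<Rightarrow>\<^sub>L 'b"
    and F' :: "'a \<times> 'b \<Rightarrow> ('a \<times> 'b) \<Rightarrow>\<^sub>L ('a \<Rightarrow>\<^sub>L 'b)"
    and D :: "('a \<times> 'b) set" and u0 :: 'b
  assumes D: "open D" "(0, u0) \<in> D"
    and derF: "\<And>z. z \<in> D \<Longrightarrow> (F has_derivative F' z) (at z)"
    and contF': "continuous_on D F'"
    and compat: "\<And>z v w. z \<in> D \<Longrightarrow> F' z (v, F z v) w = F' z (w, F z w) v"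
  shows "\<exists>r>0. \<exists>u. u 0 = u0 \<and>
     (\<forall>x\<in>ball 0 r. (x, u x) \<in> D \<and> (u has_derivative blinfun_apply (F (x, u x))) (at x))"
proof -
  obtain \<rho>' where \<rho>': "\<rho>' > 0" "cball (0, u0) \<rho>' \<subseteq> D"
    using D open_contains_cball by blast
  define \<rho> where "\<rho> = \<rho>' / 2"
  have \<rho>: "\<rho> > 0" using \<rho>' by (simp add: \<rho>_def)
  define K where "K = cball (0::'a) \<rho> \<times> cball u0 \<rho>"
  have KD: "K \<subseteq> D"
  proof
    fix z assume "z \<in> K"
    then obtain a b where z: "z = (a, b)" "norm a \<le> \<rho>" "dist u0 b \<le> \<rho>" by (auto simp: K_def)
    have "dist (0, u0) (a, b) \<le> norm a + dist u0 b"
      unfolding dist_Pair_Pair dist_0_norm by (rule sqrt_sum_squares_le_sum) auto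
    then show "z \<in> D" using z \<rho>' by (auto simp: \<rho>_def)
  qed
  have "compact K" unfolding K_def by (intro compact_Times compact_cball)
  have contF: "continuous_on D F"
    using derF by (auto intro!: has_derivative_continuous continuous_at_imp_continuous_on)
  obtain M where M: "M > 0" "\<And>z. z \<in> K \<Longrightarrow> norm (F z) \<le> M"
    using compact_imp_bounded[OF compact_continuous_image[OF continuous_on_subset[OF contF KD] \<open>compact K\<close>]]
    by (auto simp: bounded_pos)
  obtain L where L: "L > 0" "\<And>z. z \<in> K \<Longrightarrow> norm (F' z) \<le> L"
    using compact_imp_bounded[OF compact_continuous_image[OF continuous_on_subset[OF contF' KD] \<open>compact K\<close>]]
    by (auto simp: bounded_pos)
  \<comment> \<open>The bound \<open>M r \<le> \<rho>\<close> keeps the iterates in the box \<open>K\<close>; the bound \<open>L r \<le> 1/8\<close> makes \<open>T\<close> contract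
    and bounds the factor \<open>2 L r\<close> of the defect by \<open>1/4\<close>.\<close>
  define r where "r = min \<rho> (min (\<rho> / M) (1 / (8 * L)))"
  have r: "r > 0" "r \<le> \<rho>" "M * r \<le> \<rho>" "L * r \<le> 1/8"
  proof -
    have "M * r \<le> M * (\<rho> / M)" "L * r \<le> L * (1 / (8 * L))"
      using M(1) L(1) by (intro mult_left_mono; simp add: r_def)+
    then show "r > 0" "r \<le> \<rho>" "M * r \<le> \<rho>" "L * r \<le> 1/8"
      using M(1) L(1) \<rho> by (auto simp: r_def)
  qed
  have lip: "norm (F (x, a) - F (x, b)) \<le> L * norm (a - b)"
    if "x \<in> cball 0 \<rho>" "a \<in> cball u0 \<rho>" "b \<in> cball u0 \<rho>" for x a b
  proof -
    have "norm (F (x, a) - F (x, b)) \<le> L * norm ((x, a) - (x, b))"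
    proof (rule differentiable_bound[where S=K])
      show "convex K" unfolding K_def by (intro convex_Times convex_cball)
      show "\<And>z. z \<in> K \<Longrightarrow> (F has_derivative F' z) (at z within K)"
        using derF KD by (blast intro: has_derivative_at_withinI)
      show "\<And>z. z \<in> K \<Longrightarrow> onorm (F' z) \<le> L" using L(2) by (simp add: norm_blinfun.rep_eq)
    qed (use that in \<open>auto simp: K_def\<close>)
    then show ?thesis by (simp add: norm_Pair)
  qed
  define T where "T = (\<lambda>u x. u0 + integral {0..1} (\<lambda>s::real. F (s *\<^sub>R x, u (s *\<^sub>R x)) x))"
  define B where "B = ball (0::'a) r"
  have B\<rho>: "x \<in> cball 0 \<rho>" if "x \<in> B" for x using that r by (auto simp: B_def)
  have sB: "s *\<^sub>R x \<in> B" if "x \<in> B" "s \<in> {0..1}" for s x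
  proof -
    have "\<bar>s\<bar> * norm x \<le> 1 * norm x" using that by (intro mult_right_mono) auto
    then show ?thesis using that by (auto simp: B_def)
  qed
  define ok where "ok = (\<lambda>u. continuous_on B u \<and> (\<forall>x\<in>B. u x \<in> cball u0 \<rho>))"
  have integ: "(\<lambda>s. F (s *\<^sub>R x, u (s *\<^sub>R x)) x) integrable_on {0..1}" if "ok u" "x \<in> B" for u x
  proof (intro integrable_continuous_interval continuous_intros)
    have "(s *\<^sub>R x, u (s *\<^sub>R x)) \<in> D" if "s \<in> {0..1}" for s
      using \<open>ok u\<close> sB[OF \<open>x \<in> B\<close> that] B\<rho>[OF sB[OF \<open>x \<in> B\<close> that]]
      by (intro subsetD[OF KD]) (auto simp: ok_def K_def)
    moreover have "continuous_on {0..1} (\<lambda>s. u (s *\<^sub>R x))"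
      by (rule continuous_on_compose2[where g=u and t=B])
         (use \<open>ok u\<close> sB[OF \<open>x \<in> B\<close>] in \<open>auto simp: ok_def intro!: continuous_intros\<close>)
    ultimately show "continuous_on {0..1} (\<lambda>s. F (s *\<^sub>R x, u (s *\<^sub>R x)))"
      by (intro continuous_on_compose2[OF contF] continuous_on_Pair) (auto intro!: continuous_intros)
  qed
  have T_in: "T u x \<in> cball u0 \<rho>" if "ok u" "x \<in> B" for u x
  proof -
    have "norm (integral {0..1} (\<lambda>s. F (s *\<^sub>R x, u (s *\<^sub>R x)) x)) \<le> M * r * Henstock_Kurzweil_Integration.content {0..1::real}"
    proof (rule has_integral_bound_real[OF _ finite.emptyI integrable_integral[OF integ[OF that]]])
      show "0 \<le> M * r" using M r by simp
      fix s :: real assume "s \<in> {0..1} - {}"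
      then have "(s *\<^sub>R x, u (s *\<^sub>R x)) \<in> K"
        using \<open>ok u\<close> sB[OF \<open>x \<in> B\<close>] B\<rho>[OF sB[OF \<open>x \<in> B\<close>]] by (auto simp: ok_def K_def)
      then have "norm (F (s *\<^sub>R x, u (s *\<^sub>R x))) * norm x \<le> M * r"
        using M \<open>x \<in> B\<close> by (intro mult_mono) (auto simp: B_def)
      then show "norm (F (s *\<^sub>R x, u (s *\<^sub>R x)) x) \<le> M * r"
        using norm_blinfun order_trans by blast
    qed
    then show ?thesis using r by (simp add: T_def dist_norm)
  qed
  have T_lip: "norm (T u x - T v x) \<le> d / 8"
    if "ok u" "ok v" "x \<in> B" and d: "\<And>y. y \<in> B \<Longrightarrow> norm (u y - v y) \<le> d" for u v x d
  proof -
    have d0: "d \<ge> 0" using order_trans[OF norm_ge_zero d[OF \<open>x \<in> B\<close>]] .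
    have "norm (integral {0..1} (\<lambda>s. F (s *\<^sub>R x, u (s *\<^sub>R x)) x - F (s *\<^sub>R x, v (s *\<^sub>R x)) x))
      \<le> d / 8 * Henstock_Kurzweil_Integration.content {0..1::real}"
    proof (rule has_integral_bound_real[OF _ finite.emptyI integrable_integral])
      show "(\<lambda>s. F (s *\<^sub>R x, u (s *\<^sub>R x)) x - F (s *\<^sub>R x, v (s *\<^sub>R x)) x) integrable_on {0..1}"
        by (intro integrable_diff integ that)
      show "0 \<le> d / 8" using d0 by simp
      fix s :: real assume "s \<in> {0..1} - {}"
      then have s: "s \<in> {0..1}" by simp
      define y where "y = s *\<^sub>R x"
      have y: "y \<in> B" using sB[OF \<open>x \<in> B\<close> s] by (simp add: y_def)
      have "norm (F (y, u y) x - F (y, v y) x) \<le> norm (F (y, u y) - F (y, v y)) * norm x"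
        unfolding blinfun.diff_left[symmetric] by (rule norm_blinfun)
      also have "\<dots> \<le> (L * norm (u y - v y)) * norm x"
        using that y by (intro mult_right_mono lip B\<rho>) (auto simp: ok_def)
      also have "\<dots> \<le> (L * d) * r"
        using L d[OF y] d0 \<open>x \<in> B\<close> by (intro mult_mono mult_left_mono) (auto simp: B_def)
      also have "\<dots> \<le> d / 8" using mult_right_mono[OF r(4) d0] by (simp add: mult_ac)
      finally show "norm (F (s *\<^sub>R x, u (s *\<^sub>R x)) x - F (s *\<^sub>R x, v (s *\<^sub>R x)) x) \<le> d / 8"
        by (simp add: y_def)
    qed
    then show ?thesis
      by (simp add: T_def integral_diff[OF integ[OF that(1,3)] integ[OF that(2,3)]])
  qed
  define uk where "uk = (\<lambda>k. (T ^^ k) (\<lambda>_. u0))"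
  have uk_Suc: "uk (Suc k) = T (uk k)" for k by (simp add: uk_def)
  \<comment> \<open>The summand \<open>M\<close> bounds the defect of the constant initial iterate; since \<open>L \<rho> \<le> A / 4\<close>, the recursion
    \<open>A / 4 + L \<rho> \<le> A / 2\<close> halves the bound in every step.\<close>
  define A where "A = M + 4 * L * \<rho>"
  have ukB: "ok (uk k) \<and> (\<forall>x\<in>B. norm (uk (Suc k) x - uk k x) \<le> \<rho> / 8 ^ k) \<and>
     (\<exists>u'. continuous_on B u' \<and> (\<forall>x\<in>B. (uk k has_derivative blinfun_apply (u' x)) (at x) \<and>
        norm (u' x - F (x, uk k x)) \<le> A / 2 ^ k))" for k
  proof (induction k)
    case 0
    have ok0: "ok (uk 0)" using \<rho> by (simp add: ok_def uk_def)
    moreover have "norm (uk 1 x - uk 0 x) \<le> \<rho>" if "x \<in> B" for x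
      using T_in[OF ok0 that] by (simp add: uk_def dist_norm norm_minus_commute)
    moreover have "\<exists>u'. continuous_on B u' \<and> (\<forall>x\<in>B. (uk 0 has_derivative blinfun_apply (u' x)) (at x) \<and>
        norm (u' x - F (x, uk 0 x)) \<le> A)"
    proof (intro exI[of _ "\<lambda>_. 0"] conjI ballI)
      fix x assume x: "x \<in> B"
      show "(uk 0 has_derivative blinfun_apply 0) (at x)"
        by (simp add: uk_def zero_blinfun.rep_eq)
      have "norm (F (x, uk 0 x)) \<le> M" using M(2) B\<rho>[OF x] \<rho> by (auto simp: K_def uk_def)
      then show "norm (0 - F (x, uk 0 x)) \<le> A" using L \<rho> by (simp add: A_def add_increasing2)
    qed auto
    ultimately show ?case by simp
  next
    case (Suc k)
    then obtain u' where ok: "ok (uk k)" and d: "\<And>x. x \<in> B \<Longrightarrow> norm (uk (Suc k) x - uk k x) \<le> \<rho> / 8 ^ k"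
      and u': "continuous_on B u'" "\<And>x. x \<in> B \<Longrightarrow> (uk k has_derivative blinfun_apply (u' x)) (at x)"
        "\<And>x. x \<in> B \<Longrightarrow> norm (u' x - F (x, uk k x)) \<le> A / 2 ^ k" by blast
    have "\<exists>v'. continuous_on (ball 0 r) v' \<and>
     (\<forall>x\<in>ball 0 r. (T (uk k) has_derivative blinfun_apply (v' x)) (at x) \<and>
        norm (v' x - F (x, uk k x)) \<le> 2 * L * r * (A / 2 ^ k))"
      unfolding T_def
    proof (rule picard_step_derivative[where D=K and F'=F' and u'=u'])
      show "\<And>z. z \<in> K \<Longrightarrow> (F has_derivative F' z) (at z)" using derF KD by blast
      show "continuous_on K F'" by (rule continuous_on_subset[OF contF' KD])
      show "\<And>z v w. z \<in> K \<Longrightarrow> F' z (v, F z v) w = F' z (w, F z w) v" using compat KD by blast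
      show "\<And>x. x \<in> ball 0 r \<Longrightarrow> (x, uk k x) \<in> K" using ok B\<rho> by (auto simp: ok_def K_def B_def)
    qed (use L u' in \<open>auto simp: B_def\<close>)
    then obtain v' where v': "continuous_on B v'"
      "\<And>x. x \<in> B \<Longrightarrow> (uk (Suc k) has_derivative blinfun_apply (v' x)) (at x)"
      "\<And>x. x \<in> B \<Longrightarrow> norm (v' x - F (x, uk k x)) \<le> 2 * L * r * (A / 2 ^ k)"
      unfolding B_def[symmetric] uk_Suc by blast
    have ok': "ok (uk (Suc k))"
      unfolding ok_def
    proof
      show "continuous_on B (uk (Suc k))"
        using v'(2) by (auto intro!: has_derivative_continuous continuous_at_imp_continuous_on)
    qed (auto simp: uk_Suc simp del: mem_cball intro!: T_in ok)
    moreover have "norm (uk (Suc (Suc k)) x - uk (Suc k) x) \<le> \<rho> / 8 ^ Suc k" if "x \<in> B" for x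
      using T_lip[OF ok' ok that d] by (simp add: uk_Suc)
    moreover have "norm (v' x - F (x, uk (Suc k) x)) \<le> A / 2 ^ Suc k" if x: "x \<in> B" for x
    proof -
      have A0: "A \<ge> 0" using M L \<rho> by (simp add: A_def)
      have "norm (v' x - F (x, uk (Suc k) x)) \<le>
          norm (v' x - F (x, uk k x)) + norm (F (x, uk (Suc k) x) - F (x, uk k x))"
        using norm_triangle_ineq4[of "v' x - F (x, uk k x)" "F (x, uk (Suc k) x) - F (x, uk k x)"] by simp
      also have "\<dots> \<le> 2 * L * r * (A / 2 ^ k) + L * norm (uk (Suc k) x - uk k x)"
        using ok ok' x by (intro add_mono v' lip B\<rho>) (auto simp: ok_def)
      also have "\<dots> \<le> 2 * (1/8) * (A / 2 ^ k) + L * (\<rho> / 2 ^ k)"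
      proof (intro add_mono mult_left_mono)
        have "\<rho> / 8 ^ k \<le> \<rho> / 2 ^ k" using \<rho> by (intro divide_left_mono power_mono) auto
        then show "norm (uk (Suc k) x - uk k x) \<le> \<rho> / 2 ^ k" using d[OF x] by linarith
        show "2 * L * r * (A / 2 ^ k) \<le> 2 * (1/8) * (A / 2 ^ k)"
          using r(4) A0 by (intro mult_right_mono) auto
      qed (use L in auto)
      also have "\<dots> = (A / 4 + L * \<rho>) / 2 ^ k" by (simp add: add_divide_distrib)
      also have "\<dots> \<le> (A / 2) / 2 ^ k"
        using M L \<rho> by (intro divide_right_mono) (auto simp: A_def)
      finally show ?thesis by simp
    qed
    ultimately show ?case using v' by blast
  qed
  then obtain U' where U': "\<And>k x. x \<in> B \<Longrightarrow> (uk k has_derivative blinfun_apply (U' k x)) (at x)"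
      "\<And>k x. x \<in> B \<Longrightarrow> norm (U' k x - F (x, uk k x)) \<le> A / 2 ^ k"
    by metis
  have ok: "ok (uk k)" and d: "x \<in> B \<Longrightarrow> norm (uk (Suc k) x - uk k x) \<le> \<rho> / 8 ^ k" for k x
    using ukB by auto
  have tail: "norm (uk (k + j) x - uk k x) \<le> 2 * \<rho> / 8 ^ k - 2 * \<rho> / 8 ^ (k + j)" if "x \<in> B" for k j x
  proof (induction j)
    case (Suc j)
    have "norm (uk (k + Suc j) x - uk k x) \<le> norm (uk (Suc (k + j)) x - uk (k + j) x) + norm (uk (k + j) x - uk k x)"
      using norm_triangle_ineq[of "uk (Suc (k + j)) x - uk (k + j) x" "uk (k + j) x - uk k x"] by simp
    also have "\<dots> \<le> \<rho> / 8 ^ (k + j) + (2 * \<rho> / 8 ^ k - 2 * \<rho> / 8 ^ (k + j))"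
      by (intro add_mono d that Suc.IH)
    also have "\<dots> \<le> 2 * \<rho> / 8 ^ k - 2 * \<rho> / 8 ^ (k + Suc j)"
      using \<rho> by (simp add: field_simps)
    finally show ?case .
  qed auto
  have tail': "norm (uk m x - uk k x) \<le> 2 * \<rho> / 8 ^ k" if "x \<in> B" "m \<ge> k" for k m x
  proof -
    have "0 \<le> 2 * \<rho> / 8 ^ m" using \<rho> by simp
    then show ?thesis using tail[OF that(1), of k "m - k"] that(2) by simp
  qed
  have small: "(\<lambda>k. c / 8 ^ k) \<longlonglongrightarrow> 0" "(\<lambda>k. c / 2 ^ k) \<longlonglongrightarrow> 0" for c :: real
    using tendsto_mult_right_zero[OF LIMSEQ_realpow_zero[of "1/8::real"], of c]
      tendsto_mult_right_zero[OF LIMSEQ_realpow_zero[of "1/2::real"], of c]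
    by (simp_all add: power_one_over divide_simps)
  have "\<exists>l. (\<lambda>k. uk k x) \<longlonglongrightarrow> l" if x: "x \<in> B" for x
    unfolding convergent_eq_Cauchy
  proof (rule metric_CauchyI)
    fix e :: real assume "e > 0"
    with small(1)[of "2 * \<rho>"] have "eventually (\<lambda>k. 2 * \<rho> / 8 ^ k < e / 2) sequentially"
      by (intro order_tendstoD) auto
    then obtain k where k: "2 * \<rho> / 8 ^ k < e / 2" by (auto simp: eventually_sequentially)
    have "dist (uk m x) (uk n x) < e" if "m \<ge> k" "n \<ge> k" for m n
    proof -
      have "dist (uk m x) (uk k x) < e / 2" "dist (uk n x) (uk k x) < e / 2"
        using tail'[OF x that(1)] tail'[OF x that(2)] k by (auto simp: dist_norm)
      then show ?thesis by (rule dist_triangle_half_l)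
    qed
    then show "\<exists>M. \<forall>m\<ge>M. \<forall>n\<ge>M. dist (uk m x) (uk n x) < e" by blast
  qed
  then obtain u where u: "\<And>x. x \<in> B \<Longrightarrow> (\<lambda>k. uk k x) \<longlonglongrightarrow> u x" by metis
  have uu: "norm (uk k x - u x) \<le> 2 * \<rho> / 8 ^ k" if "x \<in> B" for x k
  proof -
    have "(\<lambda>m. norm (uk m x - uk k x)) \<longlonglongrightarrow> norm (u x - uk k x)"
      by (intro tendsto_intros u that)
    then have "norm (u x - uk k x) \<le> 2 * \<rho> / 8 ^ k"
      using tail'[OF that] by (intro Lim_bounded) auto
    then show ?thesis by (simp add: norm_minus_commute)
  qed
  have u_in: "u x \<in> cball u0 \<rho>" if "x \<in> B" for x
    using ok that by (intro closed_sequentially[OF closed_cball _ u[OF that]]) (auto simp: ok_def)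
  have "0 \<in> B" using r by (simp add: B_def)
  have "\<exists>g. \<forall>x\<in>B. (\<lambda>n. uk n x) \<longlonglongrightarrow> g x \<and> (g has_derivative blinfun_apply (F (x, u x))) (at x within B)"
  proof (rule has_derivative_sequence)
    show "convex B" by (simp add: B_def)
    show "\<And>n x. x \<in> B \<Longrightarrow> (uk n has_derivative blinfun_apply (U' n x)) (at x within B)"
      using U'(1) by (blast intro: has_derivative_at_withinI)
    fix e :: real assume "e > 0"
    have "(\<lambda>k. A / 2 ^ k + 2 * L * \<rho> / 8 ^ k) \<longlonglongrightarrow> 0"
      using tendsto_add[OF small(2)[of A] small(1)[of "2 * L * \<rho>"]] by simp
    then have "eventually (\<lambda>k. A / 2 ^ k + 2 * L * \<rho> / 8 ^ k < e) sequentially"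
      using \<open>e > 0\<close> by (intro order_tendstoD) auto
    then show "\<forall>\<^sub>F k in sequentially. \<forall>x\<in>B. \<forall>h. norm (U' k x h - F (x, u x) h) \<le> e * norm h"
    proof eventually_elim
      case (elim k)
      show ?case
      proof (intro ballI allI)
        fix x h assume x: "x \<in> B"
        have "norm (U' k x - F (x, u x)) \<le> norm (U' k x - F (x, uk k x)) + norm (F (x, uk k x) - F (x, u x))"
          using norm_triangle_ineq[of "U' k x - F (x, uk k x)" "F (x, uk k x) - F (x, u x)"] by simp
        also have "\<dots> \<le> A / 2 ^ k + L * norm (uk k x - u x)"
          using ok x u_in[OF x] by (intro add_mono U' lip B\<rho>) (auto simp: ok_def)
        also have "\<dots> \<le> A / 2 ^ k + L * (2 * \<rho> / 8 ^ k)"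
          using L by (intro add_left_mono mult_left_mono uu x) auto
        finally have "norm (U' k x - F (x, u x)) \<le> e" using elim by (simp add: mult_ac)
        then show "norm (U' k x h - F (x, u x) h) \<le> e * norm h"
          unfolding blinfun.diff_left[symmetric]
          by (meson norm_blinfun order_trans mult_right_mono norm_ge_zero)
      qed
    qed
  qed (use \<open>0 \<in> B\<close> u in auto)
  then obtain g where g: "\<And>x. x \<in> B \<Longrightarrow> (\<lambda>n. uk n x) \<longlonglongrightarrow> g x"
    "\<And>x. x \<in> B \<Longrightarrow> (g has_derivative blinfun_apply (F (x, u x))) (at x within B)" by blast
  have gu: "g x = u x" if "x \<in> B" for x using LIMSEQ_unique[OF g(1) u] that by blast
  have "uk k 0 = u0" for k by (cases k) (auto simp: uk_def T_def blinfun.zero_right)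
  then have "g 0 = u0" using g(1)[OF \<open>0 \<in> B\<close>] LIMSEQ_unique tendsto_const by fastforce
  moreover have "(x, g x) \<in> D" "(g has_derivative blinfun_apply (F (x, g x))) (at x)" if x: "x \<in> B" for x
  proof -
    show "(x, g x) \<in> D" using u_in[OF x] B\<rho>[OF x] by (intro subsetD[OF KD]) (auto simp: gu[OF x] K_def)
    show "(g has_derivative blinfun_apply (F (x, g x))) (at x)"
      using g(2)[OF x] x by (simp add: gu[OF x] B_def at_within_open[OF _ open_ball])
  qed
  ultimately show ?thesis using r(1) unfolding B_def by blast
qed

text \<open>The form in which the theorem is used: the right-hand side is a sum of products of a function of \<open>x\<close> and a
vector field in \<open>u\<close>, and the integrability condition is stated for the coordinate directions only. Since both
sides are bilinear in the two directions, these suffice.\<close>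

theorem frobenius_separated:
  fixes c :: "'p::finite \<Rightarrow> 'n::finite \<Rightarrow> real^'n \<Rightarrow> real"
    and Q :: "'p \<Rightarrow> 'b::euclidean_space \<Rightarrow> 'b" and Q' :: "'p \<Rightarrow> 'b \<Rightarrow> 'b \<Rightarrow>\<^sub>L 'b"
  assumes X: "open X" "x0 \<in> X"
    and c: "\<And>p i. smooth_on X (c p i)"
    and Q: "\<And>p u. (Q p has_derivative blinfun_apply (Q' p u)) (at u)"
    and Q': "\<And>p. continuous_on UNIV (Q' p)"
    and compat: "\<And>x u i j. x \<in> X \<Longrightarrow>
      (\<Sum>p\<in>UNIV. pd i (c p j) x *\<^sub>R Q p u + c p j x *\<^sub>R Q' p u (\<Sum>q\<in>UNIV. c q i x *\<^sub>R Q q u)) =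
      (\<Sum>p\<in>UNIV. pd j (c p i) x *\<^sub>R Q p u + c p i x *\<^sub>R Q' p u (\<Sum>q\<in>UNIV. c q j x *\<^sub>R Q q u))"
  shows "\<exists>r>0. \<exists>u. ball x0 r \<subseteq> X \<and> u x0 = u0 \<and>
     (\<forall>x\<in>ball x0 r. (u has_derivative
        (\<lambda>h. \<Sum>i\<in>UNIV. h $ i *\<^sub>R (\<Sum>p\<in>UNIV. c p i x *\<^sub>R Q p (u x)))) (at x))"
proof -
  define S where "S = (\<lambda>(i::'n) y::'b. blinfun_scaleR_left y o\<^sub>L Blinfun (\<lambda>h::real^'n. h $ i))"
  have S: "S i y h = h $ i *\<^sub>R y" for i y h
    by (simp add: S_def bounded_linear_Blinfun_apply[OF bounded_linear_vec_nth])
  have S_lin: "bounded_linear (S i)" for i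
    unfolding S_def
    by (intro bounded_linear_compose[OF bounded_bilinear.bounded_linear_left[OF bounded_bilinear_blinfun_compose]] bounded_linear_blinfun_scaleR_left)
  define F where "F = (\<lambda>(x, u). \<Sum>i\<in>UNIV. \<Sum>p\<in>UNIV. c p i (x0 + x) *\<^sub>R S i (Q p u))"
  define F' where "F' = (\<lambda>(x, u). Blinfun (\<lambda>h. \<Sum>i\<in>UNIV. \<Sum>p\<in>UNIV.
      (\<Sum>k\<in>UNIV. fst h $ k * pd k (c p i) (x0 + x)) *\<^sub>R S i (Q p u) + c p i (x0 + x) *\<^sub>R S i (Q' p u (snd h))))"
  have F'_apply: "F' (x, u) h = (\<Sum>i\<in>UNIV. \<Sum>p\<in>UNIV.
      (\<Sum>k\<in>UNIV. fst h $ k * pd k (c p i) (x0 + x)) *\<^sub>R S i (Q p u) + c p i (x0 + x) *\<^sub>R S i (Q' p u (snd h)))"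
    for x u h
  proof -
    have "bounded_linear (\<lambda>h. \<Sum>i\<in>UNIV. \<Sum>p\<in>UNIV.
      (\<Sum>k\<in>UNIV. fst h $ k * pd k (c p i) (x0 + x)) *\<^sub>R S i (Q p u) + c p i (x0 + x) *\<^sub>R S i (Q' p u (snd h)))"
      by (intro bounded_linear_sum bounded_linear_add
          bounded_linear_compose[OF bounded_linear_scaleR_left] bounded_linear_compose[OF bounded_linear_scaleR_right]
          bounded_linear_compose[OF S_lin] bounded_linear_compose[OF blinfun.bounded_linear_right]
          bounded_linear_snd bounded_linear_compose[OF bounded_linear_mult_left]
          bounded_linear_compose[OF bounded_linear_vec_nth] bounded_linear_fst)
    then show ?thesis by (simp add: F'_def bounded_linear_Blinfun_apply)
  qed
  define Y where "Y = (\<lambda>x. x0 + x) -` X"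
  have openY: "open Y" unfolding Y_def by (intro open_vimage X continuous_intros)
  have "\<exists>r>0. \<exists>u. u 0 = u0 \<and>
     (\<forall>x\<in>ball 0 r. (x, u x) \<in> Y \<times> UNIV \<and> (u has_derivative blinfun_apply (F (x, u x))) (at x))"
  proof (rule frobenius_at_origin)
    show "open (Y \<times> (UNIV::'b set))" using openY by (intro open_Times) auto
    show "(0, u0) \<in> Y \<times> UNIV" using X by (simp add: Y_def)
    show "(F has_derivative F' z) (at z)" if "z \<in> Y \<times> UNIV" for z
    proof -
      obtain x u where z: "z = (x, u)" by (cases z)
      with that have x: "x0 + x \<in> X" by (simp add: Y_def)
      have c': "((\<lambda>z. c p i (x0 + fst z)) has_derivative
          (\<lambda>h. \<Sum>k\<in>UNIV. fst h $ k * pd k (c p i) (x0 + x))) (at z)" for p i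
      proof (rule has_derivative_compose[where f="\<lambda>z. x0 + fst z" and f'="\<lambda>h. fst h"])
        show "((\<lambda>z. x0 + fst z) has_derivative fst) (at z)"
          by (auto intro!: derivative_eq_intros)
        show "(c p i has_derivative (\<lambda>h. \<Sum>k\<in>UNIV. h $ k * pd k (c p i) (x0 + x))) (at (x0 + fst z))"
          using has_derivative_pd[OF smooth_on_differentiable[OF c x]] by (simp add: z)
      qed
      have "((\<lambda>z. Q p (snd z)) has_derivative (\<lambda>h. Q' p u (snd h))) (at z)" for p
        using has_derivative_compose[OF has_derivative_snd[OF has_derivative_ident] Q[of p "snd z"]] by (simp add: z)
      then have S': "((\<lambda>z. S i (Q p (snd z))) has_derivative (\<lambda>h. S i (Q' p u (snd h)))) (at z)" for p i
        by (rule bounded_linear.has_derivative[OF S_lin])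
      have "((\<lambda>z. \<Sum>i\<in>UNIV. \<Sum>p\<in>UNIV. c p i (x0 + fst z) *\<^sub>R S i (Q p (snd z))) has_derivative
        (\<lambda>h. \<Sum>i\<in>UNIV. \<Sum>p\<in>UNIV. c p i (x0 + fst z) *\<^sub>R S i (Q' p u (snd h)) +
          (\<Sum>k\<in>UNIV. fst h $ k * pd k (c p i) (x0 + x)) *\<^sub>R S i (Q p (snd z)))) (at z)"
        by (intro has_derivative_sum has_derivative_scaleR c' S')
      then show ?thesis
        by (simp add: F_def z case_prod_unfold F'_apply[abs_def] add.commute)
    qed
    have cont: "continuous_on (Y \<times> UNIV) (\<lambda>z. g (x0 + fst z))" if "smooth_on X g" for g :: "real^'n \<Rightarrow> real"
      by (rule continuous_on_compose2[OF smooth_on_continuous_on[OF that]])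
         (auto simp: Y_def intro!: continuous_intros)
    have contQ: "continuous_on A (\<lambda>z. S i (Q p (snd z)))" for A :: "((real^'n) \<times> 'b) set" and i p
    proof -
      have "continuous_on UNIV (Q p)"
        using Q by (auto intro!: continuous_at_imp_continuous_on has_derivative_continuous)
      then have "continuous_on A (\<lambda>z. Q p (snd z))"
        by (rule continuous_on_compose2) (auto intro: continuous_intros)
      then show ?thesis by (rule bounded_linear.continuous_on[OF S_lin])
    qed
    have contQ': "continuous_on A (\<lambda>z. S i (Q' p (snd z) b))" for A :: "((real^'n) \<times> 'b) set" and i p b
    proof -
      have "continuous_on A (\<lambda>z. Q' p (snd z))"
        by (rule continuous_on_compose2[OF Q']) (auto intro: continuous_intros)
      then show ?thesis
        by (intro bounded_linear.continuous_on[OF S_lin] continuous_intros)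
    qed
    show "continuous_on (Y \<times> UNIV) F'"
    proof (rule continuous_on_blinfun_componentwise)
      fix h :: "(real^'n) \<times> 'b"
      have "F' z h = (\<Sum>i\<in>UNIV. \<Sum>p\<in>UNIV.
         (\<Sum>k\<in>UNIV. fst h $ k * pd k (c p i) (x0 + fst z)) *\<^sub>R S i (Q p (snd z)) +
         c p i (x0 + fst z) *\<^sub>R S i (Q' p (snd z) (snd h)))" for z
        using F'_apply[of "fst z" "snd z"] by simp
      then show "continuous_on (Y \<times> UNIV) (\<lambda>z. F' z h)"
        by (auto intro!: continuous_intros cont c smooth_on_pd contQ contQ'
            smooth_on_sum[OF X(1)] smooth_on_mult[OF X(1)] smooth_on_const)
    qed
    show "F' z (v, F z v) w = F' z (w, F z w) v" if "z \<in> Y \<times> UNIV" for z v w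
    proof -
      obtain x u where z: "z = (x, u)" by (cases z)
      with that have x: "x0 + x \<in> X" by (simp add: Y_def)
      define R where "R = (\<lambda>k. \<Sum>q\<in>UNIV. c q k (x0 + x) *\<^sub>R Q q u)"
      define T where "T = (\<lambda>k i. \<Sum>p\<in>UNIV. pd k (c p i) (x0 + x) *\<^sub>R Q p u +
         c p i (x0 + x) *\<^sub>R Q' p u (R k))"
      have Fv: "F z v = (\<Sum>k\<in>UNIV. v $ k *\<^sub>R R k)" for v
        by (simp add: F_def R_def z blinfun.sum_left blinfun.scaleR_left S scaleR_sum_right mult.commute)
      have *: "F' z (v, F z v) w = (\<Sum>i\<in>UNIV. \<Sum>k\<in>UNIV. (w $ i * v $ k) *\<^sub>R T k i)" for v w
      proof -
        have "F' z (v, F z v) w = (\<Sum>i\<in>UNIV. \<Sum>p\<in>UNIV. \<Sum>k\<in>UNIV. (w $ i * v $ k) *\<^sub>R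
            (pd k (c p i) (x0 + x) *\<^sub>R Q p u + c p i (x0 + x) *\<^sub>R Q' p u (R k)))"
          unfolding Fv by (simp add: z F'_apply blinfun.sum_left blinfun.add_left blinfun.scaleR_left S
              blinfun.sum_right blinfun.scaleR_right
              scaleR_sum_right scaleR_sum_left scaleR_add_right sum.distrib mult_ac)
        also have "\<dots> = (\<Sum>i\<in>UNIV. \<Sum>k\<in>UNIV. (w $ i * v $ k) *\<^sub>R T k i)"
          unfolding T_def scaleR_sum_right by (intro sum.cong[OF refl] sum.swap)
        finally show ?thesis .
      qed
      have "T k i = T i k" for k i unfolding T_def R_def by (rule compat[OF x])
      then show ?thesis unfolding * by (subst sum.swap) (simp add: mult.commute)
    qed
  qed
  then obtain r u where r: "r > 0" and u0: "u 0 = u0"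
    and u: "\<And>x. x \<in> ball 0 r \<Longrightarrow> x \<in> Y \<and> (u has_derivative blinfun_apply (F (x, u x))) (at x)" by auto
  show ?thesis
  proof (intro exI[of _ r] exI[of _ "\<lambda>x. u (x - x0)"] conjI ballI subsetI r)
    show "u (x0 - x0) = u0" using u0 by simp
    fix x assume "x \<in> ball x0 r"
    then have x: "x - x0 \<in> ball 0 r" by (simp add: dist_norm norm_minus_commute)
    show "x \<in> X" using u[OF x] by (simp add: Y_def)
    have "((\<lambda>x. u (x - x0)) has_derivative (\<lambda>h. F (x - x0, u (x - x0)) h)) (at x)"
      by (rule has_derivative_compose[where f="\<lambda>x. x - x0" and f'="\<lambda>h. h"])
         (use u[OF x] in \<open>auto intro!: derivative_eq_intros\<close>)
    moreover have "F (x - x0, u (x - x0)) h = (\<Sum>i\<in>UNIV. h $ i *\<^sub>R (\<Sum>p\<in>UNIV. c p i x *\<^sub>R Q p (u (x - x0))))" for h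
      by (simp add: F_def blinfun.sum_left blinfun.scaleR_left S scaleR_sum_right mult.commute)
    ultimately show "((\<lambda>x. u (x - x0)) has_derivative
        (\<lambda>h. \<Sum>i\<in>UNIV. h $ i *\<^sub>R (\<Sum>p\<in>UNIV. c p i x *\<^sub>R Q p (u (x - x0))))) (at x)" by simp
  qed
qed

section \<open>The quadratic vector fields of the flat system\<close>

text \<open>The state \<open>((p, q, r, s, u, v, z), (a, b, c))\<close> lists the frame components
\<open>S\<^sub>1\<^sub>1\<^sub>2, S\<^sub>1\<^sub>1\<^sub>3, S\<^sub>1\<^sub>2\<^sub>2, S\<^sub>2\<^sub>2\<^sub>3, S\<^sub>1\<^sub>3\<^sub>3, S\<^sub>2\<^sub>3\<^sub>3, S\<^sub>1\<^sub>2\<^sub>3\<close> of the tensor, from which trace-freeness determines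
\<open>S\<^sub>1\<^sub>1\<^sub>1, S\<^sub>2\<^sub>2\<^sub>2, S\<^sub>3\<^sub>3\<^sub>3\<close>, and the frame components \<open>t\<^sub>1, t\<^sub>2, t\<^sub>3\<close> of the differential. A tuple is used rather than a
vector indexed by a ten-element type because the identities below are then identities between polynomials in
named real variables.\<close>

type_synonym flat_state =
  "(real \<times> real \<times> real \<times> real \<times> real \<times> real \<times> real) \<times> (real \<times> real \<times> real)"

text \<open>The system for the metric \<open>diag(e\<^sub>1, e\<^sub>2, e\<^sub>3)\<close> with \<open>e\<^sub>a\<^sup>2 = 1\<close>, solved for the derivative of the state in the
direction \<open>l\<close>, is \<open>1/30\<close> of the following form on the diagonal; \<open>30\<close> is a common denominator of the
coefficients, so that only integers occur. Each product of components appears once, in an arbitrary order of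
its factors: the form is bilinear but not symmetric, and only its symmetrisation has a meaning. Bilinearity
gives smoothness and the derivative of the vector field at once. That these are the right coefficients is the
content of \<open>deriv_rhs_flat\<close> and \<open>hess_rhs_flat\<close>.\<close>

definition flat_form1 :: "(3 \<Rightarrow> real) \<Rightarrow> flat_state \<Rightarrow> flat_state \<Rightarrow> flat_state" where
  "flat_form1 e = (\<lambda>((p, q, r, s, u, v, z), (a, b, c)) ((p', q', r', s', u', v', z'), (a', b', c')). ((
      -30 * e 3 * p * u' + 10 * p * a' + 50 * e 3 * q * z' - 20 * e 1 * e 2 * e 3 * r * v' - 30
       * e 1 * e 2 * r * b' + 40 * e 1 * e 2 * e 3 * s * z' + 20 * e 1 * u * v' - 10 * e 1 * e 3
       * u * b' - 20 * e 1 * e 3 * z * c',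
      50 * e 2 * p * z' - 30 * e 2 * q * r' + 10 * q * a' + 20 * e 1 * r * s' - 10 * e 1 * e 2 *
       r * c' - 20 * e 1 * e 2 * e 3 * s * u' - 30 * e 1 * e 3 * u * c' + 40 * e 1 * e 2 * e 3 *
       v * z' - 20 * e 1 * e 2 * z * b',
      6 * e 1 * p * p' + 18 * e 3 * p * v' + 30 * p * b' - 24 * e 1 * e 2 * e 3 * q * q' - 2 * e
       3 * q * s' + 6 * e 2 * r * r' - 22 * e 3 * r * u' + 10 * r * a' + 16 * e 1 * e 2 * e 3 *
       s * s' - 10 * e 1 * e 3 * s * c' - 24 * e 2 * u * u' + 16 * e 1 * v * v' + 10 * e 1 * e 3
       * v * b' + 4 * e 3 * z * z',
      -10 * e 1 * p * z' + 10 * e 1 * q * r' + 10 * r * c' + 10 * e 3 * s * u' + 10 * s * a' -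
       10 * e 3 * v * z' + 20 * z * b',
      -24 * e 1 * e 2 * e 3 * p * p' - 2 * e 2 * p * v' + 6 * e 1 * q * q' + 18 * e 2 * q * s' +
       30 * q * c' - 24 * e 3 * r * r' - 22 * e 2 * r * u' + 16 * e 1 * s * s' + 10 * e 1 * e 2
       * s * c' + 6 * e 3 * u * u' + 10 * u * a' + 16 * e 1 * e 2 * e 3 * v * v' - 10 * e 1 * e
       2 * v * b' + 4 * e 2 * z * z',
      10 * e 1 * p * u' - 10 * e 1 * q * z' + 10 * e 2 * r * v' - 10 * e 2 * s * z' + 10 * u *
       b' + 10 * v * a' + 20 * z * c',
      20 * e 1 * p * q' - 10 * e 2 * p * s' + 10 * p * c' - 10 * e 3 * q * v' + 10 * q * b' + 30
       * e 2 * r * z' - 10 * e 1 * e 2 * s * b' + 30 * e 3 * u * z' - 10 * e 1 * e 3 * v * c' +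
       10 * z * a'), (
      14 * e 1 * e 2 * p * p' - 3 * e 2 * e 3 * p * v' + 14 * e 1 * e 3 * q * q' - 3 * e 2 * e 3
       * q * s' + 14 * r * r' + 17 * e 2 * e 3 * r * u' - 6 * e 1 * e 3 * s * s' + 14 * u * u' -
       6 * e 1 * e 2 * v * v' + 11 * e 2 * e 3 * z * z' + 5 * a * a' - 5 * e 1 * e 2 * b * b' -
       5 * e 1 * e 3 * c * c',
      -10 * e 1 * e 3 * p * u' + 20 * e 1 * e 3 * q * z' - 10 * e 2 * e 3 * r * v' + 20 * e 2 *
       e 3 * s * z' + 10 * u * v' + 10 * a * b',
      20 * e 1 * e 2 * p * z' - 10 * e 1 * e 2 * q * r' + 10 * r * s' - 10 * e 2 * e 3 * s * u'
       + 20 * e 2 * e 3 * v * z' + 10 * a * c')))"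

definition flat_form2 :: "(3 \<Rightarrow> real) \<Rightarrow> flat_state \<Rightarrow> flat_state \<Rightarrow> flat_state" where
  "flat_form2 e = (\<lambda>((p, q, r, s, u, v, z), (a, b, c)) ((p', q', r', s', u', v', z'), (a', b', c')). ((
      6 * e 1 * p * p' - 22 * e 3 * p * v' + 10 * p * b' + 16 * e 1 * e 2 * e 3 * q * q' - 2 * e
       3 * q * s' - 10 * e 2 * e 3 * q * c' + 6 * e 2 * r * r' + 18 * e 3 * r * u' + 30 * r * a'
       - 24 * e 1 * e 2 * e 3 * s * s' + 16 * e 2 * u * u' + 10 * e 2 * e 3 * u * a' - 24 * e 1
       * v * v' + 4 * e 3 * z * z',
      10 * e 2 * p * s' + 10 * p * c' + 10 * e 3 * q * v' + 10 * q * b' - 10 * e 2 * r * z' - 10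
       * e 3 * u * z' + 20 * z * a',
      -20 * e 1 * e 2 * e 3 * p * u' - 30 * e 1 * e 2 * p * a' + 40 * e 1 * e 2 * e 3 * q * z' -
       30 * e 3 * r * v' + 10 * r * b' + 50 * e 3 * s * z' + 20 * e 2 * u * v' - 10 * e 2 * e 3
       * v * a' - 20 * e 2 * e 3 * z * c',
      20 * e 2 * p * q' - 30 * e 1 * p * s' - 10 * e 1 * e 2 * p * c' - 20 * e 1 * e 2 * e 3 * q
       * v' + 50 * e 1 * r * z' + 10 * s * b' + 40 * e 1 * e 2 * e 3 * u * z' - 30 * e 2 * e 3 *
       v * c' - 20 * e 1 * e 2 * z * a',
      10 * e 1 * p * u' - 10 * e 1 * q * z' + 10 * e 2 * r * v' - 10 * e 2 * s * z' + 10 * u *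
       b' + 10 * v * a' + 20 * z * c',
      -24 * e 3 * p * p' - 22 * e 1 * p * v' + 16 * e 2 * q * q' + 18 * e 1 * q * s' + 10 * e 1
       * e 2 * q * c' - 24 * e 1 * e 2 * e 3 * r * r' - 2 * e 1 * r * u' + 6 * e 2 * s * s' + 30
       * s * c' + 16 * e 1 * e 2 * e 3 * u * u' - 10 * e 1 * e 2 * u * a' + 6 * e 3 * v * v' +
       10 * v * b' + 4 * e 1 * z * z',
      30 * e 1 * p * z' - 10 * e 1 * q * r' - 10 * e 1 * e 2 * q * a' + 20 * e 2 * r * s' + 10 *
       r * c' - 10 * e 3 * s * u' + 10 * s * a' - 10 * e 2 * e 3 * u * c' + 30 * e 3 * v * z' +
       10 * z * b'), (
      -10 * e 1 * e 3 * p * u' + 20 * e 1 * e 3 * q * z' - 10 * e 2 * e 3 * r * v' + 20 * e 2 *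
       e 3 * s * z' + 10 * u * v' + 10 * a * b',
      14 * p * p' + 17 * e 1 * e 3 * p * v' - 6 * e 2 * e 3 * q * q' - 3 * e 1 * e 3 * q * s' +
       14 * e 1 * e 2 * r * r' - 3 * e 1 * e 3 * r * u' + 14 * e 2 * e 3 * s * s' - 6 * e 1 * e
       2 * u * u' + 14 * v * v' + 11 * e 1 * e 3 * z * z' - 5 * e 1 * e 2 * a * a' + 5 * b * b'
       - 5 * e 2 * e 3 * c * c',
      10 * p * q' - 10 * e 1 * e 2 * p * s' - 10 * e 1 * e 3 * q * v' + 20 * e 1 * e 2 * r * z'
       + 20 * e 1 * e 3 * u * z' + 10 * b * c')))"

definition flat_form3 :: "(3 \<Rightarrow> real) \<Rightarrow> flat_state \<Rightarrow> flat_state \<Rightarrow> flat_state" where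
  "flat_form3 e = (\<lambda>((p, q, r, s, u, v, z), (a, b, c)) ((p', q', r', s', u', v', z'), (a', b', c')). ((
      10 * e 2 * p * s' + 10 * p * c' + 10 * e 3 * q * v' + 10 * q * b' - 10 * e 2 * r * z' - 10
       * e 3 * u * z' + 20 * z * a',
      16 * e 1 * e 2 * e 3 * p * p' - 2 * e 2 * p * v' - 10 * e 2 * e 3 * p * b' + 6 * e 1 * q *
       q' - 22 * e 2 * q * s' + 10 * q * c' + 16 * e 3 * r * r' + 18 * e 2 * r * u' + 10 * e 2 *
       e 3 * r * a' - 24 * e 1 * s * s' + 6 * e 3 * u * u' + 30 * u * a' - 24 * e 1 * e 2 * e 3
       * v * v' + 4 * e 2 * z * z',
      -10 * e 1 * p * z' + 10 * e 1 * q * r' + 10 * r * c' + 10 * e 3 * s * u' + 10 * s * a' -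
       10 * e 3 * v * z' + 20 * z * b',
      16 * e 3 * p * p' + 18 * e 1 * p * v' + 10 * e 1 * e 3 * p * b' - 24 * e 2 * q * q' - 22 *
       e 1 * q * s' + 16 * e 1 * e 2 * e 3 * r * r' - 2 * e 1 * r * u' - 10 * e 1 * e 3 * r * a'
       + 6 * e 2 * s * s' + 10 * s * c' - 24 * e 1 * e 2 * e 3 * u * u' + 6 * e 3 * v * v' + 30
       * v * b' + 4 * e 1 * z * z',
      40 * e 1 * e 2 * e 3 * p * z' - 20 * e 1 * e 2 * e 3 * q * r' - 30 * e 1 * e 3 * q * a' +
       20 * e 3 * r * s' - 30 * e 2 * s * u' - 10 * e 2 * e 3 * s * a' + 10 * u * c' + 50 * e 2
       * v * z' - 20 * e 2 * e 3 * z * b',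
      20 * e 3 * p * q' - 20 * e 1 * e 2 * e 3 * p * s' - 30 * e 1 * q * v' - 10 * e 1 * e 3 * q
       * b' + 40 * e 1 * e 2 * e 3 * r * z' - 30 * e 2 * e 3 * s * b' + 50 * e 1 * u * z' + 10 *
       v * c' - 20 * e 1 * e 3 * z * a',
      -10 * e 1 * p * u' - 10 * e 1 * e 3 * p * a' + 30 * e 1 * q * z' - 10 * e 2 * r * v' - 10
       * e 2 * e 3 * r * b' + 30 * e 2 * s * z' + 20 * e 3 * u * v' + 10 * u * b' + 10 * v * a'
       + 10 * z * c'), (
      20 * e 1 * e 2 * p * z' - 10 * e 1 * e 2 * q * r' + 10 * r * s' - 10 * e 2 * e 3 * s * u'
       + 20 * e 2 * e 3 * v * z' + 10 * a * c',
      10 * p * q' - 10 * e 1 * e 2 * p * s' - 10 * e 1 * e 3 * q * v' + 20 * e 1 * e 2 * r * z'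
       + 20 * e 1 * e 3 * u * z' + 10 * b * c',
      -6 * e 2 * e 3 * p * p' - 3 * e 1 * e 2 * p * v' + 14 * q * q' + 17 * e 1 * e 2 * q * s' -
       6 * e 1 * e 3 * r * r' - 3 * e 1 * e 2 * r * u' + 14 * s * s' + 14 * e 1 * e 3 * u * u' +
       14 * e 2 * e 3 * v * v' + 11 * e 1 * e 2 * z * z' - 5 * e 1 * e 3 * a * a' - 5 * e 2 * e
       3 * b * b' + 5 * c * c')))"

definition flat_form :: "(3 \<Rightarrow> real) \<Rightarrow> 3 \<Rightarrow> flat_state \<Rightarrow> flat_state \<Rightarrow> flat_state" where
  "flat_form e l = (if l = 1 then flat_form1 e else if l = 2 then flat_form2 e else flat_form3 e)"

lemma UNIV_3_cases: "P 1 \<Longrightarrow> P 2 \<Longrightarrow> P 3 \<Longrightarrow> P (i::3)"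
  by (metis exhaust_3)

lemma flat_form_simps [simp]:
  "flat_form e 1 = flat_form1 e" "flat_form e 2 = flat_form2 e" "flat_form e 3 = flat_form3 e"
  by (simp_all add: flat_form_def)

lemma flat_form_add_left: "flat_form e l (x + x') y = flat_form e l x y + flat_form e l x' y"
proof -
  obtain p0 q0 r0 s0 u0 v0 z0 a0 b0 c0 where 0: "x = ((p0, q0, r0, s0, u0, v0, z0), (a0, b0, c0))"
    by (metis prod.exhaust)
  obtain p1 q1 r1 s1 u1 v1 z1 a1 b1 c1 where 1: "x' = ((p1, q1, r1, s1, u1, v1, z1), (a1, b1, c1))"
    by (metis prod.exhaust)
  obtain p2 q2 r2 s2 u2 v2 z2 a2 b2 c2 where 2: "y = ((p2, q2, r2, s2, u2, v2, z2), (a2, b2, c2))"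
    by (metis prod.exhaust)
  show ?thesis
    unfolding 0 1 2
    by (induction l rule: UNIV_3_cases;
        simp only: flat_form_simps flat_form1_def flat_form2_def flat_form3_def prod.case
          plus_prod_def scaleR_prod_def real_scaleR_def fst_conv snd_conv prod.inject;
        intro conjI; algebra)
qed

lemma flat_form_add_right: "flat_form e l y (x + x') = flat_form e l y x + flat_form e l y x'"
proof -
  obtain p0 q0 r0 s0 u0 v0 z0 a0 b0 c0 where 0: "x = ((p0, q0, r0, s0, u0, v0, z0), (a0, b0, c0))"
    by (metis prod.exhaust)
  obtain p1 q1 r1 s1 u1 v1 z1 a1 b1 c1 where 1: "x' = ((p1, q1, r1, s1, u1, v1, z1), (a1, b1, c1))"
    by (metis prod.exhaust)
  obtain p2 q2 r2 s2 u2 v2 z2 a2 b2 c2 where 2: "y = ((p2, q2, r2, s2, u2, v2, z2), (a2, b2, c2))"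
    by (metis prod.exhaust)
  show ?thesis
    unfolding 0 1 2
    by (induction l rule: UNIV_3_cases;
        simp only: flat_form_simps flat_form1_def flat_form2_def flat_form3_def prod.case
          plus_prod_def scaleR_prod_def real_scaleR_def fst_conv snd_conv prod.inject;
        intro conjI; algebra)
qed

lemma flat_form_scaleR_left: "flat_form e l (k *\<^sub>R x) y = k *\<^sub>R flat_form e l x y"
proof -
  obtain p0 q0 r0 s0 u0 v0 z0 a0 b0 c0 where 0: "x = ((p0, q0, r0, s0, u0, v0, z0), (a0, b0, c0))"
    by (metis prod.exhaust)
  obtain p1 q1 r1 s1 u1 v1 z1 a1 b1 c1 where 1: "y = ((p1, q1, r1, s1, u1, v1, z1), (a1, b1, c1))"
    by (metis prod.exhaust)
  show ?thesis
    unfolding 0 1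
    by (induction l rule: UNIV_3_cases;
        simp only: flat_form_simps flat_form1_def flat_form2_def flat_form3_def prod.case
          plus_prod_def scaleR_prod_def real_scaleR_def fst_conv snd_conv prod.inject;
        intro conjI; algebra)
qed

lemma flat_form_scaleR_right: "flat_form e l x (k *\<^sub>R y) = k *\<^sub>R flat_form e l x y"
proof -
  obtain p0 q0 r0 s0 u0 v0 z0 a0 b0 c0 where 0: "x = ((p0, q0, r0, s0, u0, v0, z0), (a0, b0, c0))"
    by (metis prod.exhaust)
  obtain p1 q1 r1 s1 u1 v1 z1 a1 b1 c1 where 1: "y = ((p1, q1, r1, s1, u1, v1, z1), (a1, b1, c1))"
    by (metis prod.exhaust)
  show ?thesis
    unfolding 0 1
    by (induction l rule: UNIV_3_cases;
        simp only: flat_form_simps flat_form1_def flat_form2_def flat_form3_def prod.case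
          plus_prod_def scaleR_prod_def real_scaleR_def fst_conv snd_conv prod.inject;
        intro conjI; algebra)
qed


text \<open>The integrability of the flat system. The derivative of \<open>\<tau> \<mapsto> B(\<tau>, \<tau>)\<close> in the direction \<open>\<eta>\<close> is \<open>B(\<eta>, \<tau>) + B(\<tau>, \<eta>)\<close>,
hence the equations say that the vector fields commute. Each component is a polynomial identity of degree three
in the ten variables, modulo \<open>e\<^sub>a\<^sup>2 = 1\<close>.\<close>

lemma flat_form_commute12:
  assumes "e 1 * e 1 = 1" "e 2 * e 2 = 1" "e 3 * e 3 = 1"
  shows "flat_form1 e (flat_form2 e \<tau> \<tau>) \<tau> + flat_form1 e \<tau> (flat_form2 e \<tau> \<tau>) =
         flat_form2 e (flat_form1 e \<tau> \<tau>) \<tau> + flat_form2 e \<tau> (flat_form1 e \<tau> \<tau>)"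
proof -
  obtain p q r s u v z a b c where t: "\<tau> = ((p, q, r, s, u, v, z), (a, b, c))" by (metis prod.exhaust)
  show ?thesis
    unfolding t flat_form1_def flat_form2_def prod.case plus_prod_def fst_conv snd_conv prod.inject
    by (intro conjI; use assms in algebra)
qed

lemma flat_form_commute13:
  assumes "e 1 * e 1 = 1" "e 2 * e 2 = 1" "e 3 * e 3 = 1"
  shows "flat_form1 e (flat_form3 e \<tau> \<tau>) \<tau> + flat_form1 e \<tau> (flat_form3 e \<tau> \<tau>) =
         flat_form3 e (flat_form1 e \<tau> \<tau>) \<tau> + flat_form3 e \<tau> (flat_form1 e \<tau> \<tau>)"
proof -
  obtain p q r s u v z a b c where t: "\<tau> = ((p, q, r, s, u, v, z), (a, b, c))" by (metis prod.exhaust)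
  show ?thesis
    unfolding t flat_form1_def flat_form3_def prod.case plus_prod_def fst_conv snd_conv prod.inject
    by (intro conjI; use assms in algebra)
qed

lemma flat_form_commute23:
  assumes "e 1 * e 1 = 1" "e 2 * e 2 = 1" "e 3 * e 3 = 1"
  shows "flat_form2 e (flat_form3 e \<tau> \<tau>) \<tau> + flat_form2 e \<tau> (flat_form3 e \<tau> \<tau>) =
         flat_form3 e (flat_form2 e \<tau> \<tau>) \<tau> + flat_form3 e \<tau> (flat_form2 e \<tau> \<tau>)"
proof -
  obtain p q r s u v z a b c where t: "\<tau> = ((p, q, r, s, u, v, z), (a, b, c))" by (metis prod.exhaust)
  show ?thesis
    unfolding t flat_form2_def flat_form3_def prod.case plus_prod_def fst_conv snd_conv prod.inject
    by (intro conjI; use assms in algebra)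
qed

lemma flat_form_commute:
  assumes "\<And>i. e i * e i = 1"
  shows "flat_form e i (flat_form e j \<tau> \<tau>) \<tau> + flat_form e i \<tau> (flat_form e j \<tau> \<tau>) =
         flat_form e j (flat_form e i \<tau> \<tau>) \<tau> + flat_form e j \<tau> (flat_form e i \<tau> \<tau>)"
  using flat_form_commute12[OF assms assms assms, where \<tau>=\<tau>] flat_form_commute13[OF assms assms assms, where \<tau>=\<tau>]
    flat_form_commute23[OF assms assms assms, where \<tau>=\<tau>]
  by (induction i rule: UNIV_3_cases; induction j rule: UNIV_3_cases) simp_all

section \<open>The right-hand sides for a diagonal metric\<close>

definition diagm :: "('n \<Rightarrow> real) \<Rightarrow> real^'n^'n" where
  "diagm d = (\<chi> i j. if i = j then d i else 0)"

lemma diagm_nth [simp]: "diagm d $ i $ j = (if i = j then d i else 0)"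
  by (simp add: diagm_def)

lemma matrix_inv_unique:
  fixes A B :: "real^'n^'n"
  assumes "A ** B = mat 1"
  shows "matrix_inv A = B"
proof -
  have "B ** A = mat 1" using assms matrix_left_right_inverse by blast
  then have "A ** matrix_inv A = mat 1" unfolding matrix_inv_def
    using assms someI[of "\<lambda>A'. A ** A' = mat 1 \<and> A' ** A = mat 1" B] by blast
  then have "B ** (A ** matrix_inv A) = B" by simp
  then show ?thesis using \<open>B ** A = mat 1\<close> by (simp add: matrix_mul_assoc)
qed

lemma matrix_inv_diagm:
  assumes "\<And>i. d i \<noteq> 0"
  shows "matrix_inv (diagm d) = diagm (\<lambda>i. 1 / d i)"
proof (rule matrix_inv_unique)
  have "(\<Sum>k\<in>UNIV. diagm d $ i $ k * diagm (\<lambda>i. 1 / d i) $ k $ j) = (if i = j then 1 else 0)" for i j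
  proof -
    have "(\<Sum>k\<in>UNIV. diagm d $ i $ k * diagm (\<lambda>i. 1 / d i) $ k $ j) =
        (\<Sum>k\<in>UNIV. if k = i then d i * diagm (\<lambda>i. 1 / d i) $ i $ j else 0)"
      by (intro sum.cong) auto
    then show ?thesis using assms by simp
  qed
  then show "diagm d ** diagm (\<lambda>i. 1 / d i) = mat 1"
    by (simp add: vec_eq_iff matrix_matrix_mult_def mat_def)
qed

lemma diag_contractions:
  assumes "\<And>i. d i \<noteq> 0"
  shows trace2_diagm: "trace2 (diagm d) T = (\<Sum>a\<in>UNIV. T a a / d a)"
    and trace3_diagm: "trace3 (diagm d) S k = (\<Sum>a\<in>UNIV. S a a k / d a)"
    and SS2_diagm: "SS2 (diagm d) S i j = (\<Sum>a\<in>UNIV. \<Sum>b\<in>UNIV. S i a b * S j a b / (d a * d b))"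
    and SS4_diagm: "SS4 (diagm d) S i l j k = (\<Sum>a\<in>UNIV. S i l a * S j k a / d a)"
    and St_diagm: "St (diagm d) S w j k = (\<Sum>a\<in>UNIV. S j k a * w a / d a)"
proof -
  have delta: "(\<Sum>b\<in>UNIV. (if a = b then c else 0) * f b) = c * f a" for a :: 'a and c :: real and f
    by (simp add: if_distrib if_distribR cong: if_cong)
  show "trace2 (diagm d) T = (\<Sum>a\<in>UNIV. T a a / d a)"
    "trace3 (diagm d) S k = (\<Sum>a\<in>UNIV. S a a k / d a)"
    by (simp_all add: trace2_def trace3_def matrix_inv_diagm[OF assms] delta)
  show "SS4 (diagm d) S i l j k = (\<Sum>a\<in>UNIV. S i l a * S j k a / d a)"
    "St (diagm d) S w j k = (\<Sum>a\<in>UNIV. S j k a * w a / d a)"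
    by (simp_all add: SS4_def St_def matrix_inv_diagm[OF assms] delta mult.assoc)
  have "SS2 (diagm d) S i j = (\<Sum>a\<in>UNIV. \<Sum>b\<in>UNIV. \<Sum>c\<in>UNIV. (if a = c then 1 / d a else 0) *
      (\<Sum>d'\<in>UNIV. (if b = d' then 1 / d b else 0) * (S i c d' * S j a b)))"
    by (simp add: SS2_def matrix_inv_diagm[OF assms] sum_distrib_left mult.assoc)
  also have "\<dots> = (\<Sum>a\<in>UNIV. \<Sum>b\<in>UNIV. 1 / d a * (1 / d b * (S i a b * S j a b)))"
    by (simp only: delta)
  finally show "SS2 (diagm d) S i j = (\<Sum>a\<in>UNIV. \<Sum>b\<in>UNIV. S i a b * S j a b / (d a * d b))"
    by simp
qed

text \<open>The right-hand sides of the system for \<open>n = 3\<close> at one point. In \<open>hess_rhs\<close>, which prescribes \<open>\<nabla>\<^sub>i t\<^sub>j\<close>, the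
divergence has been replaced by its value from the second equation and the Ricci tensor is a parameter, so
that it can be set to zero in the flat case.\<close>

definition hess_rhs :: "real^3^3 \<Rightarrow> (3 \<Rightarrow> 3 \<Rightarrow> real) \<Rightarrow> (3 \<Rightarrow> 3 \<Rightarrow> 3 \<Rightarrow> real) \<Rightarrow> (3 \<Rightarrow> real) \<Rightarrow> 3 \<Rightarrow> 3 \<Rightarrow> real" where
  "hess_rhs G Ric S w i j =
     tracefree2 G (\<lambda>p q. 3 * Ric p q + 1/3 * SS2 G S p q + 1/3 * w p * w q) i j
     + 1/3 * G $ i $ j * (3/4 * trace2 G Ric + 11/60 * trace2 G (SS2 G S) - 1/6 * norm2 G w)"

definition deriv_rhs :: "real^3^3 \<Rightarrow> (3 \<Rightarrow> 3 \<Rightarrow> 3 \<Rightarrow> real) \<Rightarrow> (3 \<Rightarrow> real) \<Rightarrow> 3 \<Rightarrow> 3 \<Rightarrow> 3 \<Rightarrow> 3 \<Rightarrow> real" where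
  "deriv_rhs G S w l i j k = 1/18 * Pi3 G (\<lambda>i j k l. SS4 G S i l j k + 3 * S i j l * w k + S i j k * w l
     + (4 * SS2 G S j k - 3 * St G S w j k) * G $ i $ l) i j k l"

definition linear_part :: "flat_state \<Rightarrow> 3 \<Rightarrow> real" where
  "linear_part \<tau> i = (case snd \<tau> of (a, b, c) \<Rightarrow> if i = 1 then a else if i = 2 then b else c)"

text \<open>The component \<open>S\<^sub>i\<^sub>i\<^sub>j\<close> for \<open>i \<noteq> j\<close>.\<close>

definition repeated :: "flat_state \<Rightarrow> 3 \<Rightarrow> 3 \<Rightarrow> real" where
  "repeated \<tau> i j = (case fst \<tau> of (p, q, r, s, u, v, z) \<Rightarrow>
     if i = 1 then (if j = 2 then p else q)
     else if i = 2 then (if j = 1 then r else s)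
     else (if j = 1 then u else v))"

text \<open>The tensor encoded by a state. The entries \<open>S\<^sub>i\<^sub>i\<^sub>i\<close> are chosen so that all traces with respect to
\<open>diag(e\<^sub>1, e\<^sub>2, e\<^sub>3)\<close> vanish, which uses \<open>1 / e\<^sub>i = e\<^sub>i\<close>.\<close>

definition cubic_part :: "(3 \<Rightarrow> real) \<Rightarrow> flat_state \<Rightarrow> 3 \<Rightarrow> 3 \<Rightarrow> 3 \<Rightarrow> real" where
  "cubic_part e \<tau> i j k =
     (if i = j then if j = k then - e i * (\<Sum>m\<in>UNIV - {i}. e m * repeated \<tau> m i) else repeated \<tau> i k
      else if i = k then repeated \<tau> i j
      else if j = k then repeated \<tau> j i
      else (case fst \<tau> of (p, q, r, s, u, v, z) \<Rightarrow> z))"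

lemma totally_symmetric_cubic_part: "totally_symmetric (cubic_part e \<tau>)"
proof -
  have eqs: "cubic_part e \<tau> i i k = repeated \<tau> i k" "cubic_part e \<tau> i k i = repeated \<tau> i k"
    "cubic_part e \<tau> k i i = repeated \<tau> i k" if "i \<noteq> k" for i k
    using that that[symmetric] by (simp_all only: cubic_part_def if_False if_True refl)
  have neq: "cubic_part e \<tau> i j k = (case fst \<tau> of (p, q, r, s, u, v, z) \<Rightarrow> z)"
    if "i \<noteq> j" "i \<noteq> k" "j \<noteq> k" for i j k
    using that by (simp only: cubic_part_def if_False)
  show ?thesis
    unfolding totally_symmetric_def
  proof (intro allI)
    fix i j k :: 3
    consider "i = j" "j = k" | "i = j" "j \<noteq> k" | "i = k" "i \<noteq> j" | "j = k" "i \<noteq> j" | "i \<noteq> j" "i \<noteq> k" "j \<noteq> k"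
      by blast
    then show "cubic_part e \<tau> i j k = cubic_part e \<tau> j i k \<and> cubic_part e \<tau> i j k = cubic_part e \<tau> i k j"
      by cases (simp_all only: eqs neq refl simp_thms not_sym)
  qed
qed

lemma sign_divide:
  fixes x :: real
  assumes "x * x = 1"
  shows "x \<noteq> 0" "y / x = x * y"
proof -
  show x: "x \<noteq> 0" using assms by auto
  have "y = y * (x * x)" by (simp only: assms mult_1_right)
  then show "y / x = x * y" using x by (simp add: divide_eq_eq mult_ac)
qed

lemma trace3_sign:
  fixes e :: "'n::finite \<Rightarrow> real"
  assumes "\<And>i. e i * e i = 1"
  shows "trace3 (diagm e) S k = (\<Sum>a\<in>UNIV. e a * S a a k)"
  by (simp add: trace3_diagm sign_divide[OF assms])

lemma sym_tracefree_cubic_part: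
  assumes "\<And>i. e i * e i = 1"
  shows "sym_tracefree (diagm e) (cubic_part e \<tau>)"
proof -
  have "(\<Sum>a\<in>UNIV. e a * cubic_part e \<tau> a a k) = 0" for k
  proof -
    have "(\<Sum>a\<in>UNIV - {k}. e a * cubic_part e \<tau> a a k) = (\<Sum>a\<in>UNIV - {k}. e a * repeated \<tau> a k)"
      by (intro sum.cong) (auto simp: cubic_part_def)
    moreover have "(\<Sum>a\<in>UNIV. e a * cubic_part e \<tau> a a k) =
        e k * cubic_part e \<tau> k k k + (\<Sum>a\<in>UNIV - {k}. e a * cubic_part e \<tau> a a k)"
      by (rule sum.remove) auto
    moreover have "e k * cubic_part e \<tau> k k k = - (e k * e k) * (\<Sum>a\<in>UNIV - {k}. e a * repeated \<tau> a k)"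
      by (simp add: cubic_part_def)
    ultimately show ?thesis by (simp add: assms)
  qed
  then show ?thesis
    by (simp add: sym_tracefree_def totally_symmetric_cubic_part trace3_sign[OF assms])
qed

text \<open>Symmetry leaves ten components, and the three trace conditions express \<open>S\<^sub>1\<^sub>1\<^sub>1, S\<^sub>2\<^sub>2\<^sub>2, S\<^sub>3\<^sub>3\<^sub>3\<close> by the other seven.
This reduces the verification of the flat system to seven components and shows that every symmetric
trace-free tensor is encoded by a state.\<close>

lemma sym_tracefree_eqI:
  fixes e :: "3 \<Rightarrow> real"
  assumes e: "\<And>i. e i * e i = 1"
    and A: "sym_tracefree (diagm e) A" and B: "sym_tracefree (diagm e) B"
    and eq: "A 1 1 2 = B 1 1 2" "A 1 1 3 = B 1 1 3" "A 1 2 2 = B 1 2 2" "A 2 2 3 = B 2 2 3"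
      "A 1 3 3 = B 1 3 3" "A 2 3 3 = B 2 3 3" "A 1 2 3 = B 1 2 3"
  shows "A i j k = B i j k"
proof -
  define D where "D = (\<lambda>i j k. A i j k - B i j k)"
  have sym: "D i j k = D j i k" "D i j k = D i k j" for i j k
  proof -
    have "A i j k = A j i k" "A i j k = A i k j" "B i j k = B j i k" "B i j k = B i k j"
      using A B unfolding sym_tracefree_def totally_symmetric_def by blast+
    then show "D i j k = D j i k" "D i j k = D i k j" by (simp_all add: D_def)
  qed
  have z: "D 1 1 2 = 0" "D 1 1 3 = 0" "D 1 2 2 = 0" "D 2 2 3 = 0" "D 1 3 3 = 0" "D 2 3 3 = 0" "D 1 2 3 = 0"
    using eq by (simp_all add: D_def)
  have z': "D 2 1 1 = 0" "D 1 2 1 = 0" "D 3 1 1 = 0" "D 1 3 1 = 0" "D 2 1 2 = 0" "D 2 2 1 = 0"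
    "D 3 2 2 = 0" "D 2 3 2 = 0" "D 3 1 3 = 0" "D 3 3 1 = 0" "D 3 2 3 = 0" "D 3 3 2 = 0"
    "D 1 3 2 = 0" "D 2 1 3 = 0" "D 2 3 1 = 0" "D 3 1 2 = 0" "D 3 2 1 = 0"
    by (simp_all only: z sym(1)[of 2 1] sym(1)[of 3 1] sym(1)[of 3 2] sym(2)[of _ 2 1] sym(2)[of _ 3 1] sym(2)[of _ 3 2])
  have "(\<Sum>a\<in>UNIV. e a * D a a k) = 0" for k
    using A B by (simp add: sym_tracefree_def trace3_sign[OF e] D_def right_diff_distrib sum_subtractf)
  from this[of 1] this[of 2] this[of 3] have "D 1 1 1 = 0" "D 2 2 2 = 0" "D 3 3 3 = 0"
    by (simp_all add: sum_3 z z' sign_divide(1)[OF e])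
  then have "D i j k = 0"
    by (induction i rule: UNIV_3_cases; induction j rule: UNIV_3_cases; induction k rule: UNIV_3_cases)
       (simp_all add: z z')
  then show ?thesis by (simp add: D_def)
qed

lemma ex_cubic_part:
  assumes "\<And>i. e i * e i = 1" "sym_tracefree (diagm e) S"
  shows "\<exists>\<tau>. \<forall>i j k. cubic_part e \<tau> i j k = S i j k"
proof (intro exI allI)
  fix i j k
  show "cubic_part e ((S 1 1 2, S 1 1 3, S 1 2 2, S 2 2 3, S 1 3 3, S 2 3 3, S 1 2 3), (0, 0, 0)) i j k = S i j k"
    by (rule sym_tracefree_eqI[OF assms(1) sym_tracefree_cubic_part[OF assms(1)] assms(2)])
       (simp_all add: cubic_part_def repeated_def)
qed

text \<open>The pure-trace correction \<open>g\<^sub>i\<^sub>j v\<^sub>k + g\<^sub>i\<^sub>k v\<^sub>j + g\<^sub>j\<^sub>k v\<^sub>i\<close> has trace \<open>(n + 2) v\<close>, so that \<open>c = 1 / (n + 2)\<close> removes the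
trace exactly.\<close>

lemma sym_tracefree_tracefree3:
  assumes "\<And>i. d i \<noteq> 0" and "totally_symmetric Y"
  shows "sym_tracefree (diagm d) (tracefree3 (diagm d) (Y :: 'n::finite \<Rightarrow> 'n \<Rightarrow> 'n \<Rightarrow> real))"
proof -
  have sym: "Y i j k = Y j i k" "Y i j k = Y i k j" for i j k
    using assms(2) unfolding totally_symmetric_def by auto
  have "totally_symmetric (tracefree3 (diagm d) Y)"
    unfolding totally_symmetric_def
  proof (intro allI conjI)
    fix i j k
    show "tracefree3 (diagm d) Y i j k = tracefree3 (diagm d) Y j i k"
      using sym(1)[of i j k] by (simp add: tracefree3_def algebra_simps)
    show "tracefree3 (diagm d) Y i j k = tracefree3 (diagm d) Y i k j"
      using sym(2)[of i j k] by (simp add: tracefree3_def algebra_simps)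
  qed
  moreover have "trace3 (diagm d) (tracefree3 (diagm d) Y) k = 0" for k
  proof -
    define t where "t = trace3 (diagm d) Y"
    define c where "c = 1 / (real CARD('n) + 2)"
    have "trace3 (diagm d) (tracefree3 (diagm d) Y) k =
       (\<Sum>a\<in>UNIV. Y a a k / d a - c * t k - (if a = k then 2 * c * t k else 0))"
      unfolding trace3_diagm[OF assms(1)] tracefree3_def t_def[symmetric] c_def[symmetric]
    proof (intro sum.cong refl)
      fix a
      show "(Y a a k - c * (diagm d $ a $ a * t k + diagm d $ a $ k * t a + diagm d $ a $ k * t a)) / d a =
          Y a a k / d a - c * t k - (if a = k then 2 * c * t k else 0)"
        using assms(1)[of a] by (cases "a = k") (simp_all add: field_simps)
    qed
    also have "\<dots> = t k - (real CARD('n) + 2) * c * t k"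
      by (simp add: sum_subtractf t_def trace3_diagm[OF assms(1)]) (simp add: algebra_simps)
    also have "\<dots> = 0" by (simp add: c_def add_eq_0_iff)
    finally show ?thesis .
  qed
  ultimately show ?thesis by (simp add: sym_tracefree_def)
qed

lemma totally_symmetric_sym3: "totally_symmetric (sym3 X)"
  by (simp add: totally_symmetric_def sym3_def)

lemma sym_tracefree_scale: "sym_tracefree G S \<Longrightarrow> sym_tracefree G (\<lambda>i j k. c * S i j k)"
proof -
  have "trace3 G (\<lambda>i j k. c * S i j k) k = c * trace3 G S k" for k
    by (simp add: trace3_def sum_distrib_left mult.left_commute)
  then show "sym_tracefree G S \<Longrightarrow> ?thesis"
    by (auto simp: sym_tracefree_def totally_symmetric_def)
qed

lemma distinct_3: "(1::3) \<noteq> 2" "(1::3) \<noteq> 3" "(2::3) \<noteq> 1" "(2::3) \<noteq> 3" "(3::3) \<noteq> 1" "(3::3) \<noteq> 2"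
  by simp_all

lemma sum_UNIV_3_remove: "(\<Sum>m\<in>UNIV - {i}. f m) = f 1 + f 2 + f 3 - (f i :: real)" for i :: 3
  using sum.remove[of UNIV i f] by (simp add: sum_3)

text \<open>The case distinctions are resolved once for all index triples, so that the contractions below become polynomials.\<close>

lemma cubic_part_components:
  "cubic_part e ((p, q, r, s, u, v, z), w) 1 1 1 = - e 1 * (e 2 * r + e 3 * u)"
  "cubic_part e ((p, q, r, s, u, v, z), w) 1 1 2 = p"
  "cubic_part e ((p, q, r, s, u, v, z), w) 1 1 3 = q"
  "cubic_part e ((p, q, r, s, u, v, z), w) 1 2 1 = p"
  "cubic_part e ((p, q, r, s, u, v, z), w) 1 2 2 = r"
  "cubic_part e ((p, q, r, s, u, v, z), w) 1 2 3 = z"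
  "cubic_part e ((p, q, r, s, u, v, z), w) 1 3 1 = q"
  "cubic_part e ((p, q, r, s, u, v, z), w) 1 3 2 = z"
  "cubic_part e ((p, q, r, s, u, v, z), w) 1 3 3 = u"
  "cubic_part e ((p, q, r, s, u, v, z), w) 2 1 1 = p"
  "cubic_part e ((p, q, r, s, u, v, z), w) 2 1 2 = r"
  "cubic_part e ((p, q, r, s, u, v, z), w) 2 1 3 = z"
  "cubic_part e ((p, q, r, s, u, v, z), w) 2 2 1 = r"
  "cubic_part e ((p, q, r, s, u, v, z), w) 2 2 2 = - e 2 * (e 1 * p + e 3 * v)"
  "cubic_part e ((p, q, r, s, u, v, z), w) 2 2 3 = s"
  "cubic_part e ((p, q, r, s, u, v, z), w) 2 3 1 = z"
  "cubic_part e ((p, q, r, s, u, v, z), w) 2 3 2 = s"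
  "cubic_part e ((p, q, r, s, u, v, z), w) 2 3 3 = v"
  "cubic_part e ((p, q, r, s, u, v, z), w) 3 1 1 = q"
  "cubic_part e ((p, q, r, s, u, v, z), w) 3 1 2 = z"
  "cubic_part e ((p, q, r, s, u, v, z), w) 3 1 3 = u"
  "cubic_part e ((p, q, r, s, u, v, z), w) 3 2 1 = z"
  "cubic_part e ((p, q, r, s, u, v, z), w) 3 2 2 = s"
  "cubic_part e ((p, q, r, s, u, v, z), w) 3 2 3 = v"
  "cubic_part e ((p, q, r, s, u, v, z), w) 3 3 1 = u"
  "cubic_part e ((p, q, r, s, u, v, z), w) 3 3 2 = v"
  "cubic_part e ((p, q, r, s, u, v, z), w) 3 3 3 = - e 3 * (e 1 * q + e 2 * s)"
  by (simp_all only: cubic_part_def repeated_def sum_UNIV_3_remove distinct_3 simp_thms if_True if_False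
      prod.case fst_conv) algebra+

lemma linear_part_components:
  "linear_part (x, (a, b, c)) 1 = a" "linear_part (x, (a, b, c)) 2 = b" "linear_part (x, (a, b, c)) 3 = c"
  by (simp_all only: linear_part_def distinct_3 simp_thms if_True if_False prod.case snd_conv)

lemma diagm_components:
  fixes d :: "3 \<Rightarrow> real"
  shows "diagm d $ 1 $ 1 = d 1" "diagm d $ 2 $ 2 = d 2" "diagm d $ 3 $ 3 = d 3"
    "diagm d $ 1 $ 2 = 0" "diagm d $ 1 $ 3 = 0" "diagm d $ 2 $ 1 = 0"
    "diagm d $ 2 $ 3 = 0" "diagm d $ 3 $ 1 = 0" "diagm d $ 3 $ 2 = 0"
  by (simp_all only: diagm_nth distinct_3 simp_thms if_True if_False)


lemma card_3: "real CARD(3) = 3" by simp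

context
  fixes e :: "3 \<Rightarrow> real"
  assumes e: "\<And>i. e i * e i = 1"
begin

lemma sign_nz: "e i \<noteq> 0" using sign_divide(1)[OF e] .

lemma divide_signs: "x / (e i * e j) = e i * e j * x"
  by (simp add: divide_divide_eq_left[symmetric] sign_divide(2)[OF e])

lemmas expand_rhs = deriv_rhs_def hess_rhs_def Pi3_def tracefree2_def tracefree3_def norm2_def card_3 trace2_diagm[OF sign_nz]
  trace3_diagm[OF sign_nz] sym3_def SS4_diagm[OF sign_nz]
  SS2_diagm[OF sign_nz] St_diagm[OF sign_nz] sum_3 sign_divide(2)[OF e] divide_signs diagm_components
  cubic_part_components linear_part_components flat_form_simps flat_form1_def flat_form2_def flat_form3_def
  prod.case scaleR_prod_def fst_conv snd_conv real_scaleR_def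

lemma deriv_rhs_flat_components:
  shows "deriv_rhs (diagm e) (cubic_part e \<tau>) (linear_part \<tau>) l 1 1 2 =
        cubic_part e ((1/30) *\<^sub>R flat_form e l \<tau> \<tau>) 1 1 2"
    and "deriv_rhs (diagm e) (cubic_part e \<tau>) (linear_part \<tau>) l 1 1 3 =
        cubic_part e ((1/30) *\<^sub>R flat_form e l \<tau> \<tau>) 1 1 3"
    and "deriv_rhs (diagm e) (cubic_part e \<tau>) (linear_part \<tau>) l 1 2 2 =
        cubic_part e ((1/30) *\<^sub>R flat_form e l \<tau> \<tau>) 1 2 2"
    and "deriv_rhs (diagm e) (cubic_part e \<tau>) (linear_part \<tau>) l 2 2 3 =
        cubic_part e ((1/30) *\<^sub>R flat_form e l \<tau> \<tau>) 2 2 3"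
    and "deriv_rhs (diagm e) (cubic_part e \<tau>) (linear_part \<tau>) l 1 3 3 =
        cubic_part e ((1/30) *\<^sub>R flat_form e l \<tau> \<tau>) 1 3 3"
    and "deriv_rhs (diagm e) (cubic_part e \<tau>) (linear_part \<tau>) l 2 3 3 =
        cubic_part e ((1/30) *\<^sub>R flat_form e l \<tau> \<tau>) 2 3 3"
    and "deriv_rhs (diagm e) (cubic_part e \<tau>) (linear_part \<tau>) l 1 2 3 =
        cubic_part e ((1/30) *\<^sub>R flat_form e l \<tau> \<tau>) 1 2 3"
proof -
  obtain p q r s u v z a b c where t: "\<tau> = ((p, q, r, s, u, v, z), (a, b, c))" by (metis prod.exhaust)
  show "deriv_rhs (diagm e) (cubic_part e \<tau>) (linear_part \<tau>) l 1 1 2 =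
      cubic_part e ((1/30) *\<^sub>R flat_form e l \<tau> \<tau>) 1 1 2"
    by (induction l rule: UNIV_3_cases; simp only: t expand_rhs; use e[of 1] e[of 2] e[of 3] in algebra)
  show "deriv_rhs (diagm e) (cubic_part e \<tau>) (linear_part \<tau>) l 1 1 3 =
      cubic_part e ((1/30) *\<^sub>R flat_form e l \<tau> \<tau>) 1 1 3"
    by (induction l rule: UNIV_3_cases; simp only: t expand_rhs; use e[of 1] e[of 2] e[of 3] in algebra)
  show "deriv_rhs (diagm e) (cubic_part e \<tau>) (linear_part \<tau>) l 1 2 2 =
      cubic_part e ((1/30) *\<^sub>R flat_form e l \<tau> \<tau>) 1 2 2"
    by (induction l rule: UNIV_3_cases; simp only: t expand_rhs; use e[of 1] e[of 2] e[of 3] in algebra)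
  show "deriv_rhs (diagm e) (cubic_part e \<tau>) (linear_part \<tau>) l 2 2 3 =
      cubic_part e ((1/30) *\<^sub>R flat_form e l \<tau> \<tau>) 2 2 3"
    by (induction l rule: UNIV_3_cases; simp only: t expand_rhs; use e[of 1] e[of 2] e[of 3] in algebra)
  show "deriv_rhs (diagm e) (cubic_part e \<tau>) (linear_part \<tau>) l 1 3 3 =
      cubic_part e ((1/30) *\<^sub>R flat_form e l \<tau> \<tau>) 1 3 3"
    by (induction l rule: UNIV_3_cases; simp only: t expand_rhs; use e[of 1] e[of 2] e[of 3] in algebra)
  show "deriv_rhs (diagm e) (cubic_part e \<tau>) (linear_part \<tau>) l 2 3 3 =
      cubic_part e ((1/30) *\<^sub>R flat_form e l \<tau> \<tau>) 2 3 3"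
    by (induction l rule: UNIV_3_cases; simp only: t expand_rhs; use e[of 1] e[of 2] e[of 3] in algebra)
  show "deriv_rhs (diagm e) (cubic_part e \<tau>) (linear_part \<tau>) l 1 2 3 =
      cubic_part e ((1/30) *\<^sub>R flat_form e l \<tau> \<tau>) 1 2 3"
    by (induction l rule: UNIV_3_cases; simp only: t expand_rhs; use e[of 1] e[of 2] e[of 3] in algebra)
qed

text \<open>Both sides are symmetric and trace-free in \<open>i, j, k\<close>, so that the seven components above suffice.\<close>

lemma deriv_rhs_flat:
  "deriv_rhs (diagm e) (cubic_part e \<tau>) (linear_part \<tau>) l i j k =
    cubic_part e ((1/30) *\<^sub>R flat_form e l \<tau> \<tau>) i j k"
proof (rule sym_tracefree_eqI[OF e])
  show "sym_tracefree (diagm e) (deriv_rhs (diagm e) (cubic_part e \<tau>) (linear_part \<tau>) l)"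
    unfolding deriv_rhs_def[abs_def] Pi3_def
    by (intro sym_tracefree_scale sym_tracefree_tracefree3 sign_nz totally_symmetric_sym3)
  show "sym_tracefree (diagm e) (cubic_part e ((1/30) *\<^sub>R flat_form e l \<tau> \<tau>))"
    by (rule sym_tracefree_cubic_part[OF e])
qed (rule deriv_rhs_flat_components)+

lemma hess_rhs_flat:
  "hess_rhs (diagm e) (\<lambda>_ _. 0) (cubic_part e \<tau>) (linear_part \<tau>) i j =
    linear_part ((1/30) *\<^sub>R flat_form e i \<tau> \<tau>) j"
proof -
  obtain p q r s u v z a b c where t: "\<tau> = ((p, q, r, s, u, v, z), (a, b, c))" by (metis prod.exhaust)
  show ?thesis
    by (induction i rule: UNIV_3_cases; induction j rule: UNIV_3_cases; simp only: t expand_rhs;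
        use e[of 1] e[of 2] e[of 3] in algebra)
qed

end

section \<open>Behaviour of the right-hand sides under conformal rescaling\<close>

text \<open>For \<open>g = e\<^sup>2\<^sup>\<sigma> h\<close> the Levi-Civita connections differ by
\<open>\<delta>\<^sup>c\<^sub>a \<sigma>\<^sub>b + \<delta>\<^sup>c\<^sub>b \<sigma>\<^sub>a - h\<^sub>a\<^sub>b h\<^sup>c\<^sup>d \<sigma>\<^sub>d\<close>. Here \<open>s\<close> stands for \<open>d\<sigma>\<close> and \<open>h\<close> is \<open>diag(e\<^sub>1, e\<^sub>2, e\<^sub>3)\<close>.\<close>

definition conformal_connection :: "('n \<Rightarrow> real) \<Rightarrow> ('n \<Rightarrow> real) \<Rightarrow> 'n \<Rightarrow> 'n \<Rightarrow> 'n \<Rightarrow> real" where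
  "conformal_connection e s c a b =
     (if c = a then s b else 0) + (if c = b then s a else 0) - (if a = b then e a * e c * s c else 0)"

text \<open>The Ricci tensor of \<open>e\<^sup>2\<^sup>\<sigma> h\<close> for flat \<open>h\<close> in dimension three, where \<open>s\<close> stands for \<open>d\<sigma>\<close> and \<open>s2\<close> for its
covariant derivative with respect to \<open>h\<close>.\<close>

definition conformal_ricci :: "(3 \<Rightarrow> real) \<Rightarrow> (3 \<Rightarrow> real) \<Rightarrow> (3 \<Rightarrow> 3 \<Rightarrow> real) \<Rightarrow> 3 \<Rightarrow> 3 \<Rightarrow> real" where
  "conformal_ricci e s s2 a b = - (s2 a b - s a * s b)
     - (if a = b then e a else 0) * (\<Sum>c\<in>UNIV. e c * (s2 c c + s c * s c))"

context
  fixes e :: "3 \<Rightarrow> real" and L :: real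
  assumes e: "\<And>i. e i * e i = 1" and L: "L \<noteq> 0"
begin

lemma unscaled_nz: "e i \<noteq> 0" using sign_divide(1)[OF e] .

lemma scaled_nz: "L * e i \<noteq> 0" using unscaled_nz L by simp

lemma SS2_scale: "SS2 (diagm (\<lambda>i. L * e i)) (\<lambda>i j k. L * S i j k) = SS2 (diagm e) S"
  using L by (simp add: fun_eq_iff SS2_diagm[OF scaled_nz] SS2_diagm[OF unscaled_nz])

lemma SS4_scale: "SS4 (diagm (\<lambda>i. L * e i)) (\<lambda>i j k. L * S i j k) i l j k = L * SS4 (diagm e) S i l j k"
  using L by (simp add: SS4_diagm[OF scaled_nz] SS4_diagm[OF unscaled_nz] sum_distrib_left mult_ac)

lemma St_scale: "St (diagm (\<lambda>i. L * e i)) (\<lambda>i j k. L * S i j k) w = St (diagm e) S w"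
  using L by (simp add: fun_eq_iff St_diagm[OF scaled_nz] St_diagm[OF unscaled_nz])

text \<open>The Hessian equation is covariant under \<open>h \<mapsto> L h\<close>, \<open>S \<mapsto> L S\<close>, \<open>t \<mapsto> t - 3 \<sigma>\<close>, where \<open>L = e\<^sup>2\<^sup>\<sigma>\<close>. The terms
quadratic in \<open>S\<close> have weight zero. The term \<open>- 3 s2\<close> is the second derivative of \<open>- 3 \<sigma>\<close> and comes from the Ricci
tensor; the sum is the correction of the covariant derivative of the 1-form \<open>w - 3 s\<close>.\<close>

lemma hess_rhs_conformal:
  "hess_rhs (diagm (\<lambda>i. L * e i)) (conformal_ricci e s s2) (\<lambda>i j k. L * S i j k) (\<lambda>i. w i - 3 * s i) a b =
     hess_rhs (diagm e) (\<lambda>_ _. 0) S w a b - 3 * s2 a b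
     - (\<Sum>c\<in>UNIV. conformal_connection e s c a b * (w c - 3 * s c))"
proof -
  \<comment> \<open>With \<open>M\<close> in place of division the claim becomes a polynomial identity modulo \<open>e\<^sub>i\<^sup>2 = 1\<close> and \<open>L M = 1\<close>.\<close>
  define M where "M = 1 / L"
  have M: "L * M = 1" using L by (simp add: M_def)
  have div: "x / (L * e i) = M * (e i * x)" for x i
    by (simp add: M_def sign_divide(2)[OF e, symmetric])
  define Z where "Z = SS2 (diagm e) S"
  show ?thesis
    unfolding SS2_scale hess_rhs_def Z_def[symmetric]
    by (induction a rule: UNIV_3_cases; induction b rule: UNIV_3_cases;
        simp only: tracefree2_def norm2_def card_3 trace2_diagm[OF unscaled_nz] trace2_diagm[OF scaled_nz] div
          sign_divide(2)[OF e] diagm_components conformal_connection_def conformal_ricci_def sum_3 distinct_3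
          simp_thms if_True if_False mult_zero_left mult_zero_right add_0_left add_0_right diff_0_right;
        (algebra | use e[of 1] e[of 2] e[of 3] M in algebra))
qed

lemma Pi3_scale: "Pi3 (diagm (\<lambda>i. L * e i)) (\<lambda>i j k l. L * X i j k l) i j k l = L * Pi3 (diagm e) X i j k l"
proof -
  have sy: "sym3 (\<lambda>p q r. L * X p q r l) = (\<lambda>i j k. L * sym3 (\<lambda>p q r. X p q r l) i j k)"
    by (simp add: fun_eq_iff sym3_def algebra_simps)
  have "trace3 (diagm (\<lambda>i. L * e i)) (\<lambda>i j k. L * Y i j k) k = trace3 (diagm e) Y k" for Y k
    using L by (simp add: trace3_diagm[OF scaled_nz] trace3_diagm[OF unscaled_nz])
  then show ?thesis
    unfolding Pi3_def tracefree3_def sy by (simp add: algebra_simps)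
qed

lemma Pi3_add: "Pi3 G (\<lambda>i j k l. X i j k l + Y i j k l) i j k l = Pi3 G X i j k l + Pi3 G Y i j k l"
proof -
  have sy: "sym3 (\<lambda>p q r. X p q r l + Y p q r l) = (\<lambda>i j k. sym3 (\<lambda>p q r. X p q r l) i j k + sym3 (\<lambda>p q r. Y p q r l) i j k)"
    by (simp add: fun_eq_iff sym3_def algebra_simps)
  have "trace3 G (\<lambda>i j k. A i j k + B i j k) k = trace3 G A k + trace3 G B k" for A B k
    by (simp add: trace3_def sum.distrib distrib_left)
  then show ?thesis
    unfolding Pi3_def tracefree3_def sy by (simp add: algebra_simps)
qed

text \<open>The equation for the derivative of the tensor is covariant as well. Every term of the right-hand side scales
by \<open>L\<close>, and the replacement of \<open>w\<close> by \<open>w - 3 s\<close> adds \<open>Y\<close>, which is linear in \<open>S\<close>. The symmetrisation \<open>Z\<close> of \<open>Y\<close> is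
already trace-free, because \<open>S\<close> is and because the traces of \<open>- 18 S\<^sub>i\<^sub>j\<^sub>l s\<^sub>k\<close> and \<open>18 T\<^sub>j\<^sub>k g\<^sub>i\<^sub>l\<close> cancel, where
\<open>T\<^sub>j\<^sub>k = S\<^sub>j\<^sub>k\<^sub>a s\<^sup>a\<close>. What remains is \<open>2 s\<^sub>l S\<^sub>i\<^sub>j\<^sub>k\<close>, the derivative of the factor \<open>e\<^sup>2\<^sup>\<sigma>\<close> in \<open>S = e\<^sup>2\<^sup>\<sigma> S'\<close>, together with
the three connection terms of \<open>\<nabla>\<^sub>l S\<^sub>i\<^sub>j\<^sub>k\<close>.\<close>

lemma deriv_rhs_conformal:
  assumes S: "sym_tracefree (diagm e) S"
  shows "deriv_rhs (diagm (\<lambda>i. L * e i)) (\<lambda>i j k. L * S i j k) (\<lambda>i. w i - 3 * s i) l i j k =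
     L * (2 * s l * S i j k + deriv_rhs (diagm e) S w l i j k
     - (\<Sum>c\<in>UNIV. conformal_connection e s c l i * S c j k + conformal_connection e s c l j * S i c k
          + conformal_connection e s c l k * S i j c))"
proof -
  have sym: "S j i k = S i j k" "S i k j = S i j k" for i j k
    using S by (simp_all add: sym_tracefree_def totally_symmetric_def)
  have tr: "(\<Sum>a\<in>UNIV. e a * S a a k) = 0" for k
    using S by (simp add: sym_tracefree_def trace3_diagm[OF unscaled_nz] sign_divide(2)[OF e])
  define T where "T = St (diagm e) S s"
  have T: "T j k = (\<Sum>a\<in>UNIV. e a * s a * S j k a)" for j k
    by (simp add: T_def St_diagm[OF unscaled_nz] sign_divide(2)[OF e] mult_ac)
  have T_sym: "T j k = T k j" for j k by (simp add: T sym)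
  have St_diff: "St (diagm e) S (\<lambda>i. w i - 3 * s i) j k = St (diagm e) S w j k - 3 * T j k" for j k
    by (simp add: T_def St_diagm[OF unscaled_nz] algebra_simps diff_divide_distrib sum_subtractf sum_distrib_left)
  define X where "X = (\<lambda>i j k l. SS4 (diagm e) S i l j k + 3 * S i j l * w k + S i j k * w l
     + (4 * SS2 (diagm e) S j k - 3 * St (diagm e) S w j k) * diagm e $ i $ l)"
  define Y where "Y = (\<lambda>i j k l. - 9 * S i j l * s k - 3 * S i j k * s l + 9 * T j k * diagm e $ i $ l)"
  have "deriv_rhs (diagm (\<lambda>i. L * e i)) (\<lambda>i j k. L * S i j k) (\<lambda>i. w i - 3 * s i) l i j k =
      1/18 * Pi3 (diagm (\<lambda>i. L * e i)) (\<lambda>i j k l. L * (X i j k l + Y i j k l)) i j k l"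
    unfolding deriv_rhs_def SS4_scale SS2_scale St_scale St_diff
    by (rule arg_cong[where f="\<lambda>F. 1/18 * Pi3 (diagm (\<lambda>i. L * e i)) F i j k l"])
       (simp add: fun_eq_iff X_def Y_def algebra_simps)
  also have "\<dots> = L * (deriv_rhs (diagm e) S w l i j k + 1/18 * Pi3 (diagm e) Y i j k l)"
    unfolding Pi3_scale Pi3_add deriv_rhs_def X_def by (simp only: algebra_simps)
  also have "1/18 * Pi3 (diagm e) Y i j k l = 2 * s l * S i j k
     - (\<Sum>c\<in>UNIV. conformal_connection e s c l i * S c j k + conformal_connection e s c l j * S i c k
          + conformal_connection e s c l k * S i j c)"
  proof -
    define g where "g = (\<lambda>i j. diagm e $ i $ j)"
    have g_sym: "g i j = g j i" for i j by (simp add: g_def)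
    have g_sum: "(\<Sum>a\<in>UNIV. e a * (f a * g a l)) = f l" for f :: "3 \<Rightarrow> real" and l
    proof -
      have "e a * (f a * g a l) = (if a = l then f a else 0)" for a
        by (simp add: g_def e mult.left_commute flip: mult.assoc)
      then show ?thesis by simp
    qed
    define Z where "Z = (\<lambda>i j k. - 18 * (S i j l * s k + S i k l * s j + S j k l * s i) - 18 * S i j k * s l
        + 18 * (T j k * g i l + T i k * g j l + T i j * g k l))"
    have symY: "sym3 (\<lambda>p q r. Y p q r l) = Z"
    proof (intro ext)
      fix i j k
      have r: "S j i l = S i j l" "S k i l = S i k l" "S k j l = S j k l" "S i k j = S i j k"
        "S j i k = S i j k" "S j k i = S i j k" "S k i j = S i j k" "S k j i = S i j k"
        using sym by metis+
      have t: "T k j = T j k" "T k i = T i k" "T j i = T i j" using T_sym by blast+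
      show "sym3 (\<lambda>p q r. Y p q r l) i j k = Z i j k"
        unfolding sym3_def Y_def Z_def g_def r t by algebra
    qed
    have T_tr: "(\<Sum>a\<in>UNIV. e a * T a a) = 0"
    proof -
      have "(\<Sum>a\<in>UNIV. e a * T a a) = (\<Sum>b\<in>UNIV. e b * s b * (\<Sum>a\<in>UNIV. e a * S a a b))"
        unfolding T sum_distrib_left by (subst sum.swap) (simp add: mult_ac)
      then show ?thesis by (simp add: tr)
    qed
    have trZ: "trace3 (diagm e) Z k = 0" for k
    proof -
      have "trace3 (diagm e) Z k = (\<Sum>a\<in>UNIV. e a * Z a a k)"
        by (rule trace3_sign[OF e])
      also have "\<dots> = -18 * s k * (\<Sum>a\<in>UNIV. e a * S a a l) - 36 * (\<Sum>a\<in>UNIV. e a * s a * S k l a)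
         - 18 * s l * (\<Sum>a\<in>UNIV. e a * S a a k) + 36 * (\<Sum>a\<in>UNIV. e a * (T a k * g a l))
         + 18 * g k l * (\<Sum>a\<in>UNIV. e a * T a a)"
        unfolding sum_distrib_left sum.distrib[symmetric] sum_subtractf[symmetric]
      proof (intro sum.cong refl)
        fix a
        have r: "S a k l = S k l a" using sym by metis
        show "e a * Z a a k = - 18 * s k * (e a * S a a l) - 36 * (e a * s a * S k l a) - 18 * s l * (e a * S a a k) +
           36 * (e a * (T a k * g a l)) + 18 * g k l * (e a * T a a)"
          unfolding Z_def r by algebra
      qed
      also have "\<dots> = 0" by (simp add: tr T_tr g_sum T[symmetric] T_sym[of l k])
      finally show ?thesis .
    qed
    have conn: "(\<Sum>c\<in>UNIV. conformal_connection e s c l i * f c) = s i * f l + s l * f i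
       - g i l * (\<Sum>c\<in>UNIV. e c * s c * f c)" for i and f :: "3 \<Rightarrow> real"
    proof -
      have "conformal_connection e s c l i * f c = (if c = l then s i * f c else 0) + (if c = i then s l * f c else 0)
         - g i l * (e c * s c * f c)" for c
        by (simp add: conformal_connection_def g_def algebra_simps)
      then show ?thesis by (simp add: sum.distrib sum_subtractf sum_distrib_left)
    qed
    have Ts: "(\<Sum>c\<in>UNIV. e c * s c * S c j k) = T j k" "(\<Sum>c\<in>UNIV. e c * s c * S i c k) = T i k"
      "(\<Sum>c\<in>UNIV. e c * s c * S i j c) = T i j"
    proof -
      have "S c j k = S j k c" "S i c k = S i k c" for c using sym by metis+
      then show "(\<Sum>c\<in>UNIV. e c * s c * S c j k) = T j k" "(\<Sum>c\<in>UNIV. e c * s c * S i c k) = T i k"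
        "(\<Sum>c\<in>UNIV. e c * s c * S i j c) = T i j" unfolding T by simp_all
    qed
    have "1/18 * Pi3 (diagm e) Y i j k l = 1/18 * Z i j k"
      by (simp add: Pi3_def symY tracefree3_def trZ)
    also have "\<dots> = 2 * s l * S i j k - ((s i * S l j k + s l * S i j k - g i l * T j k)
        + (s j * S i l k + s l * S i j k - g j l * T i k) + (s k * S i j l + s l * S i j k - g k l * T i j))"
    proof -
      have r: "S l j k = S j k l" "S i l k = S i k l" using sym by metis+
      show ?thesis unfolding Z_def r by algebra
    qed
    also have "\<dots> = 2 * s l * S i j k
     - (\<Sum>c\<in>UNIV. conformal_connection e s c l i * S c j k + conformal_connection e s c l j * S i c k
          + conformal_connection e s c l k * S i j c)"
      by (simp add: sum.distrib conn Ts)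
    finally show ?thesis .
  qed
  finally show ?thesis by (simp add: algebra_simps)
qed

end

section \<open>Parallel frames of flat metrics\<close>

lemma sum_UNIV_prod: "(\<Sum>p\<in>UNIV. F p) = (\<Sum>l\<in>UNIV. \<Sum>m\<in>UNIV. F (l, m))"
  by (simp add: sum.cartesian_product)

lemma smooth_on_prod:
  assumes "open U" "\<And>a. a \<in> I \<Longrightarrow> smooth_on U (F a)"
  shows "smooth_on U (\<lambda>x. \<Prod>a\<in>I. F a x)"
  using assms(2) by (induction I rule: infinite_finite_induct) (auto intro: smooth_on_mult[OF assms(1)])

lemma smooth_on_det:
  fixes A :: "real^'n \<Rightarrow> real^'m^'m"
  assumes "open U" "\<And>i j. smooth_on U (\<lambda>x. A x $ i $ j)"
  shows "smooth_on U (\<lambda>x. det (A x))"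
  unfolding det_def
  by (intro smooth_on_sum smooth_on_mult smooth_on_const smooth_on_prod assms)

lemma matrix_inv_mult:
  fixes A :: "real^'n^'n"
  assumes "det A \<noteq> 0"
  shows "A ** matrix_inv A = mat 1" "matrix_inv A ** A = mat 1"
proof -
  have "\<exists>B. A ** B = mat 1 \<and> B ** A = mat 1"
    using assms unfolding invertible_det_nz[symmetric] invertible_def .
  from someI_ex[OF this] show "A ** matrix_inv A = mat 1" "matrix_inv A ** A = mat 1"
    unfolding matrix_inv_def by auto
qed

text \<open>The inverse is a quotient of polynomials in the entries, hence smooth where the determinant is non-zero.\<close>

lemma matrix_inv_cramer:
  fixes A :: "real^'n^'n"
  assumes "det A \<noteq> 0"
  shows "matrix_inv A $ k $ j = det (\<chi> i l. if l = k then axis j 1 $ i else A $ i $ l) * inverse (det A)"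
proof -
  have "A *v (matrix_inv A *v axis j 1) = axis j 1"
    by (simp add: matrix_vector_mul_assoc matrix_inv_mult[OF assms])
  then have "matrix_inv A *v axis j 1 = (\<chi> k. det (\<chi> i l. if l = k then axis j 1 $ i else A $ i $ l) / det A)"
    using cramer[OF assms] by blast
  moreover have "(matrix_inv A *v axis j 1) $ k = matrix_inv A $ k $ j"
    by (simp add: matrix_vector_mult_basis column_def)
  ultimately show ?thesis by (simp add: divide_inverse)
qed

lemma smooth_on_matrix_inv:
  fixes A :: "real^'n \<Rightarrow> real^'m^'m"
  assumes U: "open U" and A: "\<And>i j. smooth_on U (\<lambda>x. A x $ i $ j)" and nz: "\<And>x. x \<in> U \<Longrightarrow> det (A x) \<noteq> 0"
  shows "smooth_on U (\<lambda>x. matrix_inv (A x) $ k $ j)"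
proof -
  have "smooth_on U (\<lambda>x. det (\<chi> i l. if l = k then axis j 1 $ i else A x $ i $ l) * inverse (det (A x)))"
  proof (intro smooth_on_mult smooth_on_inverse smooth_on_det U A nz)
    fix i l
    show "smooth_on U (\<lambda>x. (\<chi> i l. if l = k then axis j 1 $ i else A x $ i $ l) $ i $ l)"
      by (cases "l = k") (simp_all add: A)
  qed
  then show ?thesis
    by (subst smooth_on_cong[OF U]) (auto simp: matrix_inv_cramer[OF nz])
qed

lemma matrix_inv_entries:
  fixes A :: "real^'n^'n"
  assumes "det A \<noteq> 0"
  shows "(\<Sum>k\<in>UNIV. A $ i $ k * matrix_inv A $ k $ j) = (if i = j then 1 else 0)"
    "(\<Sum>k\<in>UNIV. matrix_inv A $ i $ k * A $ k $ j) = (if i = j then 1 else 0)"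
  using matrix_inv_mult[OF assms] by (auto simp: vec_eq_iff matrix_matrix_mult_def mat_def)

lemma smooth_on_christoffel:
  assumes U: "open U" and h: "\<And>i j. smooth_on U (\<lambda>x. h x $ i $ j)" and nz: "\<And>x. x \<in> U \<Longrightarrow> det (h x) \<noteq> 0"
  shows "smooth_on U (christoffel h k i j)"
  unfolding christoffel_def[abs_def]
  by (intro smooth_on_mult smooth_on_sum smooth_on_add smooth_on_diff smooth_on_const
      smooth_on_matrix_inv smooth_on_pd U h nz)

lemma christoffel_lower:
  assumes "det (h x) \<noteq> 0"
  shows "(\<Sum>k\<in>UNIV. h x $ m $ k * christoffel h k i j x) =
    1/2 * (pd i (\<lambda>y. h y $ j $ m) x + pd j (\<lambda>y. h y $ i $ m) x - pd m (\<lambda>y. h y $ i $ j) x)"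
proof -
  define K where "K = (\<lambda>l. pd i (\<lambda>y. h y $ j $ l) x + pd j (\<lambda>y. h y $ i $ l) x - pd l (\<lambda>y. h y $ i $ j) x)"
  have "(\<Sum>k\<in>UNIV. h x $ m $ k * christoffel h k i j x) =
      (\<Sum>k\<in>UNIV. \<Sum>l\<in>UNIV. 1/2 * (h x $ m $ k * matrix_inv (h x) $ k $ l * K l))"
    unfolding christoffel_def by (simp add: sum_distrib_left mult_ac K_def)
  also have "\<dots> = (\<Sum>l\<in>UNIV. 1/2 * (\<Sum>k\<in>UNIV. h x $ m $ k * matrix_inv (h x) $ k $ l) * K l)"
    by (subst sum.swap) (simp add: sum_distrib_left sum_distrib_right mult_ac)
  also have "\<dots> = (\<Sum>l\<in>UNIV. if m = l then 1/2 * K l else 0)"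
    unfolding matrix_inv_entries[OF assms] by (intro sum.cong) auto
  finally show ?thesis by (simp add: K_def)
qed

context
  fixes U :: "(real^'n::finite) set" and h :: "real^'n \<Rightarrow> real^'n^'n"
  assumes U: "open U" and h: "\<And>i j. smooth_on U (\<lambda>x. h x $ i $ j)"
    and sym: "\<And>x i j. x \<in> U \<Longrightarrow> h x $ i $ j = h x $ j $ i"
    and nz: "\<And>x. x \<in> U \<Longrightarrow> det (h x) \<noteq> 0"
begin

lemma pd_metric_sym: "x \<in> U \<Longrightarrow> pd k (\<lambda>y. h y $ i $ j) x = pd k (\<lambda>y. h y $ j $ i) x"
  by (rule pd_cong[OF U sym])

lemma christoffel_sym: "x \<in> U \<Longrightarrow> christoffel h k i j x = christoffel h k j i x"
  unfolding christoffel_def using pd_metric_sym[of x _ i j] by (simp add: algebra_simps)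

text \<open>\<open>\<nabla> h = 0\<close>, in coordinates.\<close>

lemma metric_compatible:
  assumes x: "x \<in> U"
  shows "pd k (\<lambda>y. h y $ i $ j) x =
    (\<Sum>l\<in>UNIV. h x $ l $ j * christoffel h l k i x) + (\<Sum>l\<in>UNIV. h x $ i $ l * christoffel h l k j x)"
  using christoffel_lower[where h=h and x=x and m=j and i=k and j=i, OF nz[OF x]]
    christoffel_lower[where h=h and x=x and m=i and i=k and j=j, OF nz[OF x]]
    pd_metric_sym[OF x, of _ k i] pd_metric_sym[OF x, of _ k j] pd_metric_sym[OF x, of _ i j]
  by (simp add: sym[OF x, of _ j] algebra_simps)

text \<open>The equations \<open>\<partial>\<^sub>i E\<^sup>k = - \<Gamma>\<^sup>k\<^sub>i\<^sub>j E\<^sup>j\<close> form a linear total differential system whose integrability condition is the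
vanishing of the Riemann tensor. The index \<open>p\<close> runs over pairs \<open>(k, j)\<close>: the vector field \<open>Q p\<close> is the elementary
matrix with entry 1 in position \<open>(k, j)\<close>, and the coefficient is \<open>- \<Gamma>\<^sup>k\<^sub>i\<^sub>j\<close>.\<close>

lemma parallel_vector_field:
  assumes flat: "\<And>x l k i j. x \<in> U \<Longrightarrow> riemann h l k i j x = 0" and x0: "x0 \<in> U"
  shows "\<exists>r>0. \<exists>E :: real^'n \<Rightarrow> real^'n. ball x0 r \<subseteq> U \<and> E x0 = v \<and>
    (\<forall>x\<in>ball x0 r. \<forall>k. (\<lambda>y. E y $ k) differentiable at x \<and>
       (\<forall>i. pd i (\<lambda>y. E y $ k) x = - (\<Sum>j\<in>UNIV. christoffel h k i j x * E x $ j)))"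
proof -
  define c where "c = (\<lambda>(p::'n \<times> 'n) i x. - christoffel h (fst p) i (snd p) x)"
  define Q where "Q = (\<lambda>(p::'n \<times> 'n) (u::real^'n). u $ snd p *\<^sub>R axis (fst p) (1::real))"
  have linQ: "bounded_linear (Q p)" for p
    unfolding Q_def by (intro bounded_linear_compose[OF bounded_linear_scaleR_left] bounded_linear_vec_nth)
  have "\<exists>r>0. \<exists>E. ball x0 r \<subseteq> U \<and> E x0 = v \<and>
     (\<forall>x\<in>ball x0 r. (E has_derivative
        (\<lambda>h. \<Sum>i\<in>UNIV. h $ i *\<^sub>R (\<Sum>p\<in>UNIV. c p i x *\<^sub>R Q p (E x)))) (at x))"
  proof (rule frobenius_separated[OF U x0])
    show "smooth_on U (c p i)" for p i
      unfolding c_def by (intro smooth_on_uminus smooth_on_christoffel U h nz)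
    show "(Q p has_derivative blinfun_apply (Blinfun (Q p))) (at u)" for p u
      by (simp add: bounded_linear_Blinfun_apply[OF linQ] bounded_linear_imp_has_derivative[OF linQ])
    show "continuous_on UNIV (\<lambda>_::real^'n. Blinfun (Q p))" for p by simp
    fix x u i j assume x: "x \<in> U"
    have pdc: "pd i (c p j) x = - pd i (christoffel h (fst p) j (snd p)) x" for p i j
      using pd_mult[OF _ smooth_on_differentiable[OF smooth_on_christoffel[OF U h nz] x], of "\<lambda>_. -1"]
      by (simp add: c_def)
    have sum_axis: "(\<Sum>p\<in>UNIV. f p *\<^sub>R axis (fst p) (1::real)) $ k = (\<Sum>m\<in>UNIV. f (k, m))"
      for f :: "'n \<times> 'n \<Rightarrow> real" and k
    proof -
      have "(\<Sum>p\<in>UNIV. f p *\<^sub>R axis (fst p) (1::real)) $ k = (\<Sum>l\<in>UNIV. \<Sum>m\<in>UNIV. if l = k then f (k, m) else 0)"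
        by (auto simp: sum_UNIV_prod axis_def intro!: sum.cong)
      also have "\<dots> = (\<Sum>m\<in>UNIV. f (k, m))" by (subst sum.swap) simp
      finally show ?thesis .
    qed
    define W where "W = (\<lambda>i. (\<Sum>q\<in>UNIV. c q i x *\<^sub>R Q q u))"
    have W: "W i $ k = - (\<Sum>m\<in>UNIV. christoffel h k i m x * u $ m)" for i k
      using sum_axis[of "\<lambda>q. c q i x * u $ snd q" k]
      by (simp add: W_def Q_def c_def sum_negf)
    have side: "(\<Sum>p\<in>UNIV. pd i (c p j) x *\<^sub>R Q p u + c p j x *\<^sub>R Q p (W i)) $ k =
      - (\<Sum>m\<in>UNIV. (pd i (christoffel h k j m) x - (\<Sum>l\<in>UNIV. christoffel h k j l x * christoffel h l i m x)) * u $ m)"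
      for i j k
    proof -
      have "(\<Sum>p\<in>UNIV. pd i (c p j) x *\<^sub>R Q p u + c p j x *\<^sub>R Q p (W i)) =
        (\<Sum>p\<in>UNIV. (pd i (c p j) x * u $ snd p + c p j x * W i $ snd p) *\<^sub>R axis (fst p) 1)"
        by (simp add: Q_def scaleR_add_left)
      then have "(\<Sum>p\<in>UNIV. pd i (c p j) x *\<^sub>R Q p u + c p j x *\<^sub>R Q p (W i)) $ k =
         (\<Sum>m\<in>UNIV. pd i (c (k, m) j) x * u $ m + c (k, m) j x * W i $ m)"
        using sum_axis[of "\<lambda>p. pd i (c p j) x * u $ snd p + c p j x * W i $ snd p" k] by simp
      also have "\<dots> = (\<Sum>m\<in>UNIV. - pd i (christoffel h k j m) x * u $ m) +
         (\<Sum>l\<in>UNIV. christoffel h k j l x * (\<Sum>m\<in>UNIV. christoffel h l i m x * u $ m))"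
        unfolding pdc W sum.distrib by (simp add: c_def)
      also have "(\<Sum>l\<in>UNIV. christoffel h k j l x * (\<Sum>m\<in>UNIV. christoffel h l i m x * u $ m)) =
         (\<Sum>m\<in>UNIV. (\<Sum>l\<in>UNIV. christoffel h k j l x * christoffel h l i m x) * u $ m)"
        unfolding sum_distrib_left sum_distrib_right by (subst sum.swap) (simp add: mult_ac)
      finally show ?thesis by (simp add: sum_negf left_diff_distrib sum_subtractf)
    qed
    have "(\<Sum>p\<in>UNIV. pd i (c p j) x *\<^sub>R Q p u + c p j x *\<^sub>R Q p (W i)) =
        (\<Sum>p\<in>UNIV. pd j (c p i) x *\<^sub>R Q p u + c p i x *\<^sub>R Q p (W j))"
    proof (rule vec_eq_iff[THEN iffD2], rule allI)
      fix k
      have "(\<Sum>m\<in>UNIV. riemann h k m i j x * u $ m) = 0" using flat[OF x] by simp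
      then show "(\<Sum>p\<in>UNIV. pd i (c p j) x *\<^sub>R Q p u + c p j x *\<^sub>R Q p (W i)) $ k =
        (\<Sum>p\<in>UNIV. pd j (c p i) x *\<^sub>R Q p u + c p i x *\<^sub>R Q p (W j)) $ k"
        unfolding side riemann_def by (simp add: sum_subtractf sum.distrib algebra_simps)
    qed
    then show "(\<Sum>p\<in>UNIV. pd i (c p j) x *\<^sub>R Q p u +
         c p j x *\<^sub>R blinfun_apply (Blinfun (Q p)) (\<Sum>q\<in>UNIV. c q i x *\<^sub>R Q q u)) =
       (\<Sum>p\<in>UNIV. pd j (c p i) x *\<^sub>R Q p u +
         c p i x *\<^sub>R blinfun_apply (Blinfun (Q p)) (\<Sum>q\<in>UNIV. c q j x *\<^sub>R Q q u))"
      by (simp add: bounded_linear_Blinfun_apply[OF linQ] W_def)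
  qed
  then obtain r E where r: "r > 0" "ball x0 r \<subseteq> U" and E0: "E x0 = v"
    and E: "\<And>x. x \<in> ball x0 r \<Longrightarrow> (E has_derivative
        (\<lambda>h. \<Sum>i\<in>UNIV. h $ i *\<^sub>R (\<Sum>p\<in>UNIV. c p i x *\<^sub>R Q p (E x)))) (at x)" by blast
  have "((\<lambda>y. E y $ k) has_derivative (\<lambda>\<eta>. \<Sum>i\<in>UNIV. \<eta> $ i * - (\<Sum>j\<in>UNIV. christoffel h k i j x * E x $ j))) (at x)"
    if x: "x \<in> ball x0 r" for x k
  proof -
    have "(\<Sum>p\<in>UNIV. c p i x *\<^sub>R Q p (E x)) $ k = - (\<Sum>j\<in>UNIV. christoffel h k i j x * E x $ j)" for i
    proof -
      have "(\<Sum>p\<in>UNIV. c p i x *\<^sub>R Q p (E x)) $ k =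
         (\<Sum>l\<in>UNIV. \<Sum>m\<in>UNIV. if l = k then - christoffel h k i m x * E x $ m else 0)"
        by (auto simp: sum_UNIV_prod axis_def c_def Q_def intro!: sum.cong)
      also have "\<dots> = - (\<Sum>j\<in>UNIV. christoffel h k i j x * E x $ j)" by (subst sum.swap) (simp add: sum_negf)
      finally show ?thesis .
    qed
    then show ?thesis
      using bounded_linear.has_derivative[OF bounded_linear_vec_nth E[OF x], of k] by simp
  qed
  note * = this
  have "(\<lambda>y. E y $ k) differentiable at x \<and>
       (\<forall>i. pd i (\<lambda>y. E y $ k) x = - (\<Sum>j\<in>UNIV. christoffel h k i j x * E x $ j))"
    if "x \<in> ball x0 r" for x k
    using *[OF that, of k] pd_eq[OF *[OF that, of k]]
    by (auto simp: differentiable_def axis_def if_distribR if_distrib cong: if_cong)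
  then show ?thesis using r E0 by blast
qed

end

text \<open>For functions whose partial derivatives are smooth expressions in the functions themselves, differentiability
of class \<open>k\<close> implies class \<open>k + 1\<close>.\<close>

lemma smooth_on_bootstrap:
  assumes "open U" "\<And>p x. x \<in> U \<Longrightarrow> f p differentiable at x"
    and step: "\<And>k p i. (\<And>p. Ck_on k U (f p)) \<Longrightarrow> Ck_on k U (pd i (f p))"
  shows "smooth_on U (f p)"
proof -
  have "\<forall>p. Ck_on k U (f p)" for k
  proof (induction k)
    case 0
    then show ?case
      using assms(2) by (auto intro!: continuous_at_imp_continuous_on differentiable_imp_continuous_within)
  qed (use assms step in auto)
  then show ?thesis by (simp add: smooth_on_def)
qed

lemma cross_perp_both:
  fixes a b y :: "real^3"
  assumes "y \<bullet> a = 0" "y \<bullet> b = 0"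
  shows "(cross3 a b \<bullet> cross3 a b) *\<^sub>R y = (cross3 a b \<bullet> y) *\<^sub>R cross3 a b"
  using assms
  by (simp add: vec_eq_iff forall_3 inner_vec_def sum_3 cross3_def) algebra

text \<open>Sylvester's diagonalisation for a non-degenerate symmetric bilinear form \<open>q\<close> on \<open>\<real>\<^sup>3\<close>, with explicit complements.
By polarisation a form that vanishes on all \<open>(v, v)\<close> of a subspace vanishes on the subspace, which yields
non-isotropic vectors: \<open>v1\<close> in the whole space and \<open>v2\<close> in the complement of \<open>v1\<close>. The complement of \<open>v1\<close> and \<open>v2\<close>
is spanned by \<open>v3 = (A v1) \<times> (A v2)\<close>.\<close>

lemma ex_diagonal_basis:
  fixes A :: "real^3^3"
  assumes sym: "transpose A = A" and nz: "det A \<noteq> 0"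
  shows "\<exists>(v :: 3 \<Rightarrow> real^3) e. (\<forall>a. e a * e a = 1) \<and> (\<forall>a b. v a \<bullet> (A *v v b) = (if a = b then e a else 0))"
proof -
  define q where "q = (\<lambda>u w. u \<bullet> (A *v w))"
  have q_sym: "q u w = q w u" for u w
    using dot_lmul_matrix[of u A w] sym by (simp add: q_def inner_commute flip: transpose_matrix_vector)
  have q_add: "q (u + w) x = q u x + q w x" "q x (u + w) = q x u + q x w" for u w x
    by (simp_all add: q_def inner_left_distrib inner_right_distrib matrix_vector_right_distrib)
  have q_scale: "q (c *\<^sub>R u) x = c * q u x" "q x (c *\<^sub>R u) = c * q x u" for c u x
    by (simp_all add: q_def matrix_vector_mult_scaleR)
  have inj: "A *v x = 0 \<Longrightarrow> x = 0" for x
    using nz invertible_det_nz[of A] matrix_left_invertible_ker[of A] invertible_left_inverse[of A] by blast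
  have nondeg: "x = 0" if "\<And>y. q y x = 0" for x
    using that[of "A *v x"] inj by (simp add: q_def)
  have polar: "q u w = 0" if "\<And>x. x \<in> W \<Longrightarrow> q x x = 0" "u \<in> W" "w \<in> W" "u + w \<in> W" for u w W
    using that(1)[OF that(2)] that(1)[OF that(3)] that(1)[OF that(4)] q_sym[of u w] by (simp add: q_add)
  have "\<exists>v. q v v \<noteq> 0"
  proof (rule ccontr)
    assume "\<not> ?thesis"
    then have "q u w = 0" for u w using polar[of UNIV] by blast
    then have "(axis 1 1 :: real^3) = 0" using nondeg by blast
    then show False by (simp add: axis_eq_0_iff)
  qed
  then obtain v1 where v1: "q v1 v1 \<noteq> 0" by blast
  have "\<exists>v. q v v1 = 0 \<and> q v v \<noteq> 0"
  proof (rule ccontr)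
    assume neg: "\<not> ?thesis"
    have Av1: "A *v v1 \<noteq> 0" using v1 by (auto simp: q_def)
    \<comment> \<open>A non-zero vector \<open>q\<close>-orthogonal to \<open>v1\<close>: one of the first two axes is not parallel to \<open>A v1\<close>.\<close>
    define w where "w = cross3 (A *v v1) (if collinear {0, A *v v1, axis 1 1} then axis 2 1 else axis 1 1)"
    have w: "q w v1 = 0" by (simp add: w_def q_def dot_cross_self)
    have "w \<noteq> 0"
    proof
      assume "w = 0"
      then have c: "collinear {0, A *v v1, axis 1 (1::real)}" "collinear {0, A *v v1, axis 2 (1::real)}"
        using cross_eq_0 by (auto simp: w_def split: if_splits)
      then show False using Av1
        unfolding cross_eq_0[symmetric] by (auto simp: cross3_def vec_eq_iff forall_3 axis_def)
    qed
    have "q y w = 0" for y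
    proof -
      define y' where "y' = y - (q y v1 / q v1 v1) *\<^sub>R v1"
      have y: "y = y' + (q y v1 / q v1 v1) *\<^sub>R v1" by (simp add: y'_def)
      have "q y v1 = q y' v1 + q y v1" using v1 by (subst y) (simp add: q_add q_scale)
      then have "q y' v1 = 0" by simp
      then have "q y' w = 0"
        using polar[of "{v. q v v1 = 0}" y' w] neg w by (auto simp: q_add)
      then show "q y w = 0" using w q_sym by (subst y) (simp add: q_add q_scale)
    qed
    then show False using nondeg \<open>w \<noteq> 0\<close> by blast
  qed
  then obtain v2 where v2: "q v2 v1 = 0" "q v2 v2 \<noteq> 0" by blast
  define v3 where "v3 = cross3 (A *v v1) (A *v v2)"
  have v3: "q v3 v1 = 0" "q v3 v2 = 0" by (simp_all add: v3_def q_def dot_cross_self)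
  have "q v3 v3 \<noteq> 0"
  proof
    assume z: "q v3 v3 = 0"
    \<comment> \<open>\<open>A v3\<close> is perpendicular to \<open>v1\<close> and \<open>v2\<close>, hence parallel to \<open>n\<close>. If \<open>v3\<close> were isotropic, then \<open>A v3\<close> would
      also be perpendicular to \<open>v3\<close>; but \<open>v3 \<bullet> n = q(v1, v1) q(v2, v2) \<noteq> 0\<close>, so \<open>A v3\<close> would vanish.\<close>
    define n where "n = cross3 v1 v2"
    define y where "y = A *v v3"
    have "v3 \<bullet> n = q v1 v1 * q v2 v2"
      unfolding v3_def n_def dot_cross using v2 q_sym[of v1 v2] by (simp add: q_def inner_commute)
    then have vn: "v3 \<bullet> n \<noteq> 0" using v1 v2 by simp
    then have nn: "n \<bullet> n \<noteq> 0" by auto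
    have "y \<bullet> v1 = 0" "y \<bullet> v2 = 0" using v3 q_sym[of v3] by (auto simp: q_def y_def inner_commute)
    then have y: "(n \<bullet> n) *\<^sub>R y = (n \<bullet> y) *\<^sub>R n" unfolding n_def by (rule cross_perp_both)
    have "v3 \<bullet> y = 0" using z by (simp add: q_def y_def)
    then have "(n \<bullet> y) * (v3 \<bullet> n) = 0"
      using arg_cong[OF y, of "\<lambda>t. v3 \<bullet> t"] by simp
    then have "(n \<bullet> n) *\<^sub>R y = 0" using y vn by simp
    then have "v3 = 0" using nn inj by (simp add: y_def)
    then show False using vn by simp
  qed
  define V where "V = (\<lambda>a::3. if a = 1 then v1 else if a = 2 then v2 else v3)"
  have V_orth: "q (V a) (V b) = 0" if "a \<noteq> b" for a b
    using that v2 v3 q_sym[of v1 v2] q_sym[of v1 v3] q_sym[of v2 v3] exhaust_3[of a] exhaust_3[of b]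
    by (auto simp: V_def)
  have V_nz: "q (V a) (V a) \<noteq> 0" for a
    using v1 v2 \<open>q v3 v3 \<noteq> 0\<close> by (simp add: V_def)
  define s where "s = (\<lambda>a. 1 / sqrt \<bar>q (V a) (V a)\<bar>)"
  have ss: "s a * s a = 1 / \<bar>q (V a) (V a)\<bar>" for a by (simp add: s_def)
  show ?thesis
  proof (intro exI conjI allI)
    fix a b
    show "sgn (q (V a) (V a)) * sgn (q (V a) (V a)) = 1"
      using V_nz[of a] by (simp add: sgn_real_def)
    show "(s a *\<^sub>R V a) \<bullet> (A *v (s b *\<^sub>R V b)) = (if a = b then sgn (q (V a) (V a)) else 0)"
    proof -
      have "(s a *\<^sub>R V a) \<bullet> (A *v (s b *\<^sub>R V b)) = s a * s b * q (V a) (V b)"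
        using q_scale by (simp add: q_def)
      also have "\<dots> = (if a = b then sgn (q (V a) (V a)) else 0)"
        using V_orth V_nz[of a] by (auto simp: ss sgn_real_def)
      finally show ?thesis .
    qed
  qed
qed

lemma sum_mult_delta: "(\<Sum>m\<in>UNIV. f m * (if i = m then 1 else 0)) = f i"
  for f :: "'n::finite \<Rightarrow> real"
proof -
  have "f m * (if i = m then 1 else 0) = (if i = m then f m else 0)" for m by simp
  then show ?thesis by simp
qed

lemma pd_zero_constant:
  assumes "\<And>x. x \<in> ball x0 r \<Longrightarrow> f differentiable at x" "\<And>x i. x \<in> ball x0 r \<Longrightarrow> pd i f x = 0"
    and "x \<in> ball x0 r"
  shows "f x = f x0"
proof -
  have "(f has_derivative (\<lambda>h. 0)) (at y within ball x0 r)" if "y \<in> ball x0 r" for y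
    using has_derivative_pd[OF assms(1)[OF that]] assms(2)[OF that] by (auto intro: has_derivative_at_withinI)
  then have "\<exists>c. \<forall>y\<in>ball x0 r. f y = c" by (intro has_derivative_zero_constant) auto
  moreover have "x0 \<in> ball x0 r" using assms(3) by (metis ball_eq_empty centre_in_ball empty_iff not_le)
  ultimately show ?thesis using assms(3) by metis
qed

text \<open>Extend a \<open>q\<close>-orthonormal basis at \<open>x0\<close> to parallel fields \<open>E\<^sub>a\<close>. Their scalar products are constant because \<open>h\<close> is
parallel. The 1-forms \<open>low a = h(E\<^sub>a, \<cdot>)\<close> are parallel, hence closed by the symmetry of the Christoffel symbols, and
\<open>\<theta>\<^sup>a = e\<^sub>a low a\<close> is the dual coframe. With this coframe no flat coordinates have to be constructed.\<close>

theorem flat_metric_coframe: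
  fixes h :: "real^3 \<Rightarrow> real^3^3"
  assumes U: "open U" and h: "\<And>i j. smooth_on U (\<lambda>x. h x $ i $ j)"
    and sym: "\<And>x i j. x \<in> U \<Longrightarrow> h x $ i $ j = h x $ j $ i"
    and nz: "\<And>x. x \<in> U \<Longrightarrow> det (h x) \<noteq> 0"
    and flat: "\<And>x l k i j. x \<in> U \<Longrightarrow> riemann h l k i j x = 0" and x0: "x0 \<in> U"
  shows "\<exists>r>0. \<exists>e (\<theta> :: 3 \<Rightarrow> 3 \<Rightarrow> real^3 \<Rightarrow> real). ball x0 r \<subseteq> U \<and> (\<forall>a. e a * e a = 1) \<and>
    (\<forall>a i. smooth_on (ball x0 r) (\<theta> a i)) \<and>
    (\<forall>x\<in>ball x0 r. (\<forall>a i j. pd i (\<theta> a j) x = pd j (\<theta> a i) x) \<and>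
       (\<forall>i j. h x $ i $ j = (\<Sum>a\<in>UNIV. e a * \<theta> a i x * \<theta> a j x)))"
proof -
  have "transpose (h x0) = h x0" using sym[OF x0] by (simp add: transpose_def vec_eq_iff)
  from ex_diagonal_basis[OF this nz[OF x0]]
  obtain v :: "3 \<Rightarrow> real^3" and e :: "3 \<Rightarrow> real" where
    ve: "(\<forall>a. e a * e a = 1) \<and> (\<forall>a b. v a \<bullet> (h x0 *v v b) = (if a = b then e a else 0))"
    by (elim exE)
  have e: "e a * e a = 1" and v: "v a \<bullet> (h x0 *v v b) = (if a = b then e a else 0)" for a b
    using ve by simp_all
  define P where "P = (\<lambda>a r E. 0 < r \<and> ball x0 r \<subseteq> U \<and> E x0 = v a \<and>
    (\<forall>x\<in>ball x0 r. \<forall>k. (\<lambda>y. E y $ k) differentiable at x \<and>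
       (\<forall>i. pd i (\<lambda>y. E y $ k) x = - (\<Sum>j\<in>UNIV. christoffel h k i j x * E x $ j))))"
  have "\<exists>r E. P a r E" for a
    using parallel_vector_field[OF U h sym nz flat x0, where v="v a"] unfolding P_def by blast
  then obtain R E where RE: "\<And>a. P a (R a) (E a)" by metis
  have R: "R a > 0" "ball x0 (R a) \<subseteq> U" and E0: "E a x0 = v a"
    and E: "\<And>x k. x \<in> ball x0 (R a) \<Longrightarrow> (\<lambda>y. E a y $ k) differentiable at x"
      "\<And>x k i. x \<in> ball x0 (R a) \<Longrightarrow> pd i (\<lambda>y. E a y $ k) x = - (\<Sum>j\<in>UNIV. christoffel h k i j x * E a x $ j)"
    for a using RE[of a] unfolding P_def by blast+
  define r where "r = Min (range R)"
  have r: "r > 0" "\<And>a. r \<le> R a" using R(1) by (auto simp: r_def)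
  define B where "B = ball x0 r"
  have BR: "x \<in> ball x0 (R a)" if "x \<in> B" for x a
    using that r(2)[of a] by (simp add: B_def)
  have B: "open B" "B \<subseteq> U" "\<And>x a. x \<in> B \<Longrightarrow> x \<in> ball x0 (R a)"
  proof -
    show "open B" by (simp add: B_def)
    show "B \<subseteq> U" using BR R(2) by blast
  qed (rule BR)
  have hB: "smooth_on B (\<lambda>x. h x $ i $ j)" for i j using h B(2) smooth_on_subset by blast
  have \<Gamma>B: "smooth_on B (christoffel h k i j)" for k i j
    using smooth_on_christoffel[OF U h nz] B(2) smooth_on_subset by blast
  have EB: "smooth_on B (\<lambda>y. E a y $ k)" for a k
  proof (rule smooth_on_bootstrap[OF B(1), where f="\<lambda>k y. E a y $ k"])
    show "\<And>p x. x \<in> B \<Longrightarrow> (\<lambda>y. E a y $ p) differentiable at x" using E(1) B(3) by blast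
    fix n p i assume IH: "\<And>p. Ck_on n B (\<lambda>y. E a y $ p)"
    have "Ck_on n B (pd i (\<lambda>y. E a y $ p)) \<longleftrightarrow> Ck_on n B (\<lambda>x. - (\<Sum>j\<in>UNIV. christoffel h p i j x * E a x $ j))"
      by (intro Ck_on_cong B E(2) B(3))
    then show "Ck_on n B (pd i (\<lambda>y. E a y $ p))"
      using \<Gamma>B IH by (auto simp: smooth_on_def intro!: Ck_on_uminus Ck_on_sum Ck_on_mult B)
  qed
  have mc: "pd k (\<lambda>y. h y $ i $ j) x =
    (\<Sum>l\<in>UNIV. h x $ l $ j * christoffel h l k i x) + (\<Sum>l\<in>UNIV. h x $ i $ l * christoffel h l k j x)"
    if "x \<in> B" for x k i j using that B(2) by (intro metric_compatible[OF U h sym nz]) auto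
  define low where "low = (\<lambda>a i x. \<Sum>j\<in>UNIV. h x $ i $ j * E a x $ j)"
  have lowB: "smooth_on B (low a i)" for a i
    unfolding low_def by (intro smooth_on_sum smooth_on_mult B hB EB)
  have dlow: "pd k (low a i) x = (\<Sum>l\<in>UNIV. christoffel h l k i x * low a l x)" if x: "x \<in> B" for k a i x
  proof -
    have "pd k (low a i) x = (\<Sum>j\<in>UNIV. pd k (\<lambda>y. h y $ i $ j) x * E a x $ j + h x $ i $ j * pd k (\<lambda>y. E a y $ j) x)"
      unfolding low_def
      by (subst pd_sum) (auto intro!: sum.cong pd_mult differentiable_mult smooth_on_differentiable[OF hB x] E(1) B(3) x)
    also have "\<dots> = (\<Sum>j\<in>UNIV. (\<Sum>l\<in>UNIV. h x $ l $ j * christoffel h l k i x) * E a x $ j)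
       + ((\<Sum>j\<in>UNIV. (\<Sum>l\<in>UNIV. h x $ i $ l * christoffel h l k j x) * E a x $ j)
       - (\<Sum>j\<in>UNIV. h x $ i $ j * (\<Sum>m\<in>UNIV. christoffel h j k m x * E a x $ m)))"
      using x by (simp add: mc E(2)[OF B(3)] distrib_right sum.distrib sum_negf sum_subtractf)
    also have "(\<Sum>j\<in>UNIV. (\<Sum>l\<in>UNIV. h x $ i $ l * christoffel h l k j x) * E a x $ j) =
        (\<Sum>j\<in>UNIV. h x $ i $ j * (\<Sum>m\<in>UNIV. christoffel h j k m x * E a x $ m))"
      unfolding sum_distrib_left sum_distrib_right by (subst sum.swap) (simp add: mult_ac)
    also have "(\<Sum>j\<in>UNIV. (\<Sum>l\<in>UNIV. h x $ l $ j * christoffel h l k i x) * E a x $ j) =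
        (\<Sum>l\<in>UNIV. christoffel h l k i x * low a l x)"
      unfolding low_def sum_distrib_left sum_distrib_right by (subst sum.swap) (simp add: mult_ac)
    finally show ?thesis by simp
  qed
  have orth: "(\<Sum>i\<in>UNIV. E a x $ i * low b i x) = (if a = b then e a else 0)" if x: "x \<in> B" for a b x
  proof -
    have "(\<Sum>i\<in>UNIV. E a x $ i * low b i x) = (\<Sum>i\<in>UNIV. E a x0 $ i * low b i x0)"
    proof (rule pd_zero_constant[where r=r and f="\<lambda>x. \<Sum>i\<in>UNIV. E a x $ i * low b i x"])
      fix x i assume x: "x \<in> ball x0 r"
      then have x: "x \<in> B" by (simp add: B_def)
      have d: "(\<lambda>y. E a y $ j) differentiable at x" "low b j differentiable at x" for j
        using smooth_on_differentiable[OF EB x] smooth_on_differentiable[OF lowB x] by blast+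
      show "(\<lambda>x. \<Sum>i\<in>UNIV. E a x $ i * low b i x) differentiable at x"
        using d by (intro differentiable_sum differentiable_mult) auto
      have "pd i (\<lambda>x. \<Sum>j\<in>UNIV. E a x $ j * low b j x) x =
          (\<Sum>j\<in>UNIV. pd i (\<lambda>y. E a y $ j) x * low b j x + E a x $ j * pd i (low b j) x)"
        using d by (subst pd_sum) (auto intro!: sum.cong pd_mult differentiable_mult)
      also have "\<dots> = (\<Sum>j\<in>UNIV. E a x $ j * (\<Sum>l\<in>UNIV. christoffel h l i j x * low b l x))
          - (\<Sum>j\<in>UNIV. (\<Sum>m\<in>UNIV. christoffel h j i m x * E a x $ m) * low b j x)"
        using x by (simp add: dlow E(2)[OF B(3)] sum.distrib sum_negf sum_subtractf)
      also have "(\<Sum>j\<in>UNIV. (\<Sum>m\<in>UNIV. christoffel h j i m x * E a x $ m) * low b j x) =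
          (\<Sum>j\<in>UNIV. E a x $ j * (\<Sum>l\<in>UNIV. christoffel h l i j x * low b l x))"
        unfolding sum_distrib_left sum_distrib_right by (subst sum.swap) (simp add: mult_ac)
      finally show "pd i (\<lambda>x. \<Sum>j\<in>UNIV. E a x $ j * low b j x) x = 0" by simp
    qed (use x in \<open>simp add: B_def\<close>)
    also have "\<dots> = v a \<bullet> (h x0 *v v b)"
      by (simp add: E0 low_def inner_vec_def matrix_vector_mult_def)
    finally show ?thesis by (simp add: v)
  qed
  define \<theta> where "\<theta> = (\<lambda>a i x. e a * low a i x)"
  have metric: "h x $ i $ j = (\<Sum>a\<in>UNIV. e a * \<theta> a i x * \<theta> a j x)" if x: "x \<in> B" for x i j
  proof -
    define M where "M = (\<chi> a i. E a x $ i)"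
    define N where "N = (\<chi> i a. \<theta> a i x)"
    have "M ** N = mat 1"
      using orth[OF x] e by (simp add: vec_eq_iff matrix_matrix_mult_def mat_def M_def N_def \<theta>_def
          mult.left_commute[of _ "e _"] flip: sum_distrib_left)
    then have "N ** M = mat 1" using matrix_left_right_inverse by blast
    then have NM: "(\<Sum>a\<in>UNIV. \<theta> a m x * E a x $ i) = (if m = i then 1 else 0)" for m i
      by (auto simp: vec_eq_iff matrix_matrix_mult_def mat_def M_def N_def)
    have "(\<Sum>a\<in>UNIV. e a * \<theta> a i x * \<theta> a j x) = (\<Sum>a\<in>UNIV. \<theta> a i x * low a j x)"
    proof (intro sum.cong refl)
      fix a
      have "e a * \<theta> a j x = (e a * e a) * low a j x" by (simp add: \<theta>_def)
      then show "e a * \<theta> a i x * \<theta> a j x = \<theta> a i x * low a j x" by (simp add: e mult_ac)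
    qed
    also have "\<dots> = (\<Sum>m\<in>UNIV. h x $ j $ m * (\<Sum>a\<in>UNIV. \<theta> a i x * E a x $ m))"
      unfolding low_def sum_distrib_left by (subst sum.swap) (simp add: mult_ac)
    also have "\<dots> = h x $ j $ i" unfolding NM by (rule sum_mult_delta)
    finally show ?thesis using sym[of x i j] x B(2) by auto
  qed
  have "pd i (\<theta> a j) x = pd j (\<theta> a i) x" if x: "x \<in> B" for x a i j
  proof -
    have "pd i (\<theta> a j) x = e a * (\<Sum>l\<in>UNIV. christoffel h l i j x * low a l x)" for i j
      unfolding \<theta>_def by (subst pd_mult) (auto simp: dlow[OF x] intro: smooth_on_differentiable[OF lowB x])
    then show ?thesis using christoffel_sym[OF U h sym nz, of x _ i j] x B(2) by auto
  qed
  moreover have "smooth_on B (\<theta> a i)" for a i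
    unfolding \<theta>_def by (intro smooth_on_mult smooth_on_const lowB B)
  ultimately show ?thesis
    using r(1) B(2) e metric unfolding B_def by blast
qed

section \<open>Tensors in a coframe\<close>

text \<open>If \<open>X\<close> lists the components of a covector in a coframe with coefficients \<open>\<theta> a i\<close>, then \<open>pull \<theta> X\<close> lists its
coordinate components. For tensors of higher rank the map is iterated slot by slot, so that linearity and
the exchange of two slots (\<open>pull_swap\<close>) are all that is needed to move contractions through it.\<close>

definition pull :: "('n::finite \<Rightarrow> 'n \<Rightarrow> real) \<Rightarrow> ('n \<Rightarrow> real) \<Rightarrow> 'n \<Rightarrow> real" where
  "pull \<theta> X i = (\<Sum>a\<in>UNIV. X a * \<theta> a i)"

abbreviation pull2 :: "('n::finite \<Rightarrow> 'n \<Rightarrow> real) \<Rightarrow> ('n \<Rightarrow> 'n \<Rightarrow> real) \<Rightarrow> 'n \<Rightarrow> 'n \<Rightarrow> real" where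
  "pull2 \<theta> T i j \<equiv> pull \<theta> (\<lambda>a. pull \<theta> (T a) j) i"

abbreviation pull3 :: "('n::finite \<Rightarrow> 'n \<Rightarrow> real) \<Rightarrow> ('n \<Rightarrow> 'n \<Rightarrow> 'n \<Rightarrow> real) \<Rightarrow> 'n \<Rightarrow> 'n \<Rightarrow> 'n \<Rightarrow> real" where
  "pull3 \<theta> S i j k \<equiv> pull \<theta> (\<lambda>a. pull2 \<theta> (S a) j k) i"

abbreviation pull4 :: "('n::finite \<Rightarrow> 'n \<Rightarrow> real) \<Rightarrow> ('n \<Rightarrow> 'n \<Rightarrow> 'n \<Rightarrow> 'n \<Rightarrow> real) \<Rightarrow> 'n \<Rightarrow> 'n \<Rightarrow> 'n \<Rightarrow> 'n \<Rightarrow> real" where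
  "pull4 \<theta> X i j k l \<equiv> pull \<theta> (\<lambda>a. pull3 \<theta> (X a) j k l) i"

lemma pull_add: "pull \<theta> (\<lambda>a. X a + Y a) i = pull \<theta> X i + pull \<theta> Y i"
  by (simp add: pull_def sum.distrib distrib_right)

lemma pull_diff: "pull \<theta> (\<lambda>a. X a - Y a) i = pull \<theta> X i - pull \<theta> Y i"
  by (simp add: pull_def sum_subtractf left_diff_distrib)

lemma pull_mult_left: "pull \<theta> (\<lambda>a. c * X a) i = c * pull \<theta> X i"
  by (simp add: pull_def sum_distrib_left mult.assoc)

lemma pull_mult_right: "pull \<theta> (\<lambda>a. X a * c) i = pull \<theta> X i * c"
  by (simp add: pull_def sum_distrib_left mult_ac)

lemma pull_sum: "pull \<theta> (\<lambda>a. \<Sum>m\<in>M. X a m) i = (\<Sum>m\<in>M. pull \<theta> (\<lambda>a. X a m) i)"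
  unfolding pull_def sum_distrib_right by (rule sum.swap)

lemma pull_swap: "pull \<theta> (\<lambda>a. pull \<theta>' (\<lambda>b. T a b) j) i = pull \<theta>' (\<lambda>b. pull \<theta> (\<lambda>a. T a b) i) j"
  unfolding pull_def sum_distrib_right by (subst sum.swap) (simp add: mult_ac)

lemma trace2_pull_swap: "trace2 H (\<lambda>c d. pull \<theta> (\<lambda>a. T a c d) i) = pull \<theta> (\<lambda>a. trace2 H (T a)) i"
  unfolding trace2_def pull_sum pull_mult_left ..

lemma SS4_trace2: "SS4 G S i l j k = trace2 G (\<lambda>a b. S i l b * S j k a)"
  by (simp add: SS4_def trace2_def mult_ac)

lemma St_trace2: "St G S w j k = trace2 G (\<lambda>a b. S j k a * w b)"
  by (simp add: St_def trace2_def mult_ac)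

lemma SS2_trace2: "SS2 G S i j = trace2 G (\<lambda>a c. trace2 G (\<lambda>b d. S i c d * S j a b))"
proof -
  have "SS2 G S i j = (\<Sum>a\<in>UNIV. \<Sum>c\<in>UNIV. \<Sum>b\<in>UNIV. \<Sum>d\<in>UNIV.
     matrix_inv G $ a $ c * (matrix_inv G $ b $ d * (S i c d * S j a b)))"
    unfolding SS2_def by (rule sum.cong[OF refl], subst sum.swap) (simp add: mult_ac)
  then show ?thesis by (simp add: trace2_def sum_distrib_left)
qed

lemma trace3_trace2: "trace3 G S k = trace2 G (\<lambda>a b. S a b k)"
  by (simp add: trace3_def trace2_def)

context
  fixes \<theta> :: "'n::finite \<Rightarrow> 'n \<Rightarrow> real" and G H :: "real^'n^'n"
  assumes G: "\<And>i j. G $ i $ j = pull2 \<theta> (\<lambda>a b. H $ a $ b) i j" and nz: "det G \<noteq> 0"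
begin

lemma det_coframe: "det (\<chi> a i. \<theta> a i) \<noteq> 0" and pull_metric_matrix: "G = transpose (\<chi> a i. \<theta> a i) ** H ** (\<chi> a i. \<theta> a i)"
  and det_frame_metric: "det H \<noteq> 0"
proof -
  show *: "G = transpose (\<chi> a i. \<theta> a i) ** H ** (\<chi> a i. \<theta> a i)"
  proof (intro vec_eq_iff[THEN iffD2] allI)
    fix i j
    show "G $ i $ j = (transpose (\<chi> a i. \<theta> a i) ** H ** (\<chi> a i. \<theta> a i)) $ i $ j"
      by (simp add: matrix_matrix_mult_def transpose_def G pull_def sum_distrib_right)
         (subst sum.swap, simp add: mult_ac)
  qed
  show "det (\<chi> a i. \<theta> a i) \<noteq> 0" "det H \<noteq> 0" using nz unfolding * det_mul by auto
qed

text \<open>Contraction does not depend on the frame: \<open>G = \<theta>\<^sup>T H \<theta>\<close> implies \<open>\<theta> G\<^sup>-\<^sup>1 \<theta>\<^sup>T = H\<^sup>-\<^sup>1\<close>. All other contractions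
reduce to this one.\<close>

lemma trace2_pull2: "trace2 G (pull2 \<theta> T) = trace2 H T"
proof -
  define M where "M = (\<chi> a i. \<theta> a i)"
  have M: "det M \<noteq> 0" using det_coframe by (simp add: M_def)
  define N where "N = matrix_inv M"
  have MN: "M ** N = mat 1" "N ** M = mat 1" using matrix_inv_mult[OF M] by (simp_all add: N_def)
  have "matrix_inv G = N ** matrix_inv H ** transpose N"
  proof (rule matrix_inv_unique)
    have "transpose M ** H ** M ** (N ** matrix_inv H ** transpose N) =
        transpose M ** (H ** ((M ** N) ** (matrix_inv H ** transpose N)))"
      by (simp add: matrix_mul_assoc)
    also have "\<dots> = transpose M ** ((H ** matrix_inv H) ** transpose N)"
      by (simp add: MN matrix_mul_assoc)
    also have "\<dots> = transpose (N ** M)"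
      by (simp add: matrix_inv_mult[OF det_frame_metric] matrix_transpose_mul)
    finally show "G ** (N ** matrix_inv H ** transpose N) = mat 1"
      by (simp add: pull_metric_matrix M_def[symmetric] MN transpose_mat)
  qed
  then have "M ** matrix_inv G ** transpose M = (M ** N) ** matrix_inv H ** transpose (M ** N)"
    by (simp add: matrix_mul_assoc matrix_transpose_mul)
  then have key: "M ** matrix_inv G ** transpose M = matrix_inv H"
    by (simp add: MN transpose_mat)
  have ctr: "(\<Sum>i\<in>UNIV. \<Sum>j\<in>UNIV. matrix_inv G $ i $ j * (\<theta> a i * \<theta> b j)) = matrix_inv H $ a $ b" for a b
  proof -
    have "matrix_inv H $ a $ b = (\<Sum>j\<in>UNIV. \<Sum>i\<in>UNIV. \<theta> a i * matrix_inv G $ i $ j * \<theta> b j)"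
      by (simp add: key[symmetric] matrix_matrix_mult_def transpose_def M_def sum_distrib_right)
    then show ?thesis by (subst sum.swap) (simp add: mult_ac)
  qed
  have "trace2 G (pull2 \<theta> T) = (\<Sum>i\<in>UNIV. \<Sum>j\<in>UNIV. \<Sum>a\<in>UNIV. \<Sum>b\<in>UNIV. T a b * (matrix_inv G $ i $ j * (\<theta> a i * \<theta> b j)))"
    by (simp add: trace2_def pull_def sum_distrib_left sum_distrib_right mult_ac)
  also have "\<dots> = (\<Sum>i\<in>UNIV. \<Sum>a\<in>UNIV. \<Sum>b\<in>UNIV. \<Sum>j\<in>UNIV. T a b * (matrix_inv G $ i $ j * (\<theta> a i * \<theta> b j)))"
    by (rule sum.cong[OF refl], subst sum.swap, rule sum.cong[OF refl], rule sum.swap)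
  also have "\<dots> = (\<Sum>a\<in>UNIV. \<Sum>b\<in>UNIV. \<Sum>i\<in>UNIV. \<Sum>j\<in>UNIV. T a b * (matrix_inv G $ i $ j * (\<theta> a i * \<theta> b j)))"
    by (subst sum.swap, rule sum.cong[OF refl], rule sum.swap)
  also have "\<dots> = trace2 H T"
    by (simp add: trace2_def ctr mult.commute flip: sum_distrib_left)
  finally show ?thesis .
qed

lemma trace2_pull_mult: "trace2 G (\<lambda>i j. pull \<theta> X i * pull \<theta> Y j) = trace2 H (\<lambda>a b. X a * Y b)"
proof -
  have "trace2 G (pull2 \<theta> (\<lambda>a b. X a * Y b)) = trace2 H (\<lambda>a b. X a * Y b)" by (rule trace2_pull2)
  then show ?thesis by (simp add: pull_mult_left pull_mult_right)
qed

lemma trace2_pull_mult': "trace2 G (\<lambda>i j. pull \<theta> X j * pull \<theta> Y i) = trace2 H (\<lambda>a b. X b * Y a)"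
  using trace2_pull_mult[of Y X] by (simp add: mult.commute)

lemma norm2_pull: "norm2 G (pull \<theta> w) = norm2 H w"
  unfolding norm2_def by (rule trace2_pull_mult)

lemma pull3_third: "pull3 \<theta> S i j k = pull \<theta> (\<lambda>c. pull2 \<theta> (\<lambda>a b. S a b c) i j) k"
proof -
  have "pull \<theta> (\<lambda>b. pull \<theta> (S a b) k) j = pull \<theta> (\<lambda>c. pull \<theta> (\<lambda>b. S a b c) j) k" for a
    by (rule pull_swap)
  then have "pull3 \<theta> S i j k = pull \<theta> (\<lambda>a. pull \<theta> (\<lambda>c. pull \<theta> (\<lambda>b. S a b c) j) k) i" by simp
  then show ?thesis by (simp only: pull_swap[where i=i and j=k])
qed

lemma trace3_pull: "trace3 G (pull3 \<theta> S) k = pull \<theta> (trace3 H S) k"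
proof -
  have "trace3 G (pull3 \<theta> S) k = trace2 G (pull2 \<theta> (\<lambda>a b. pull \<theta> (S a b) k))"
    by (simp add: trace3_trace2)
  also have "\<dots> = trace2 H (\<lambda>a b. pull \<theta> (S a b) k)" by (rule trace2_pull2)
  also have "\<dots> = pull \<theta> (trace3 H S) k"
    by (simp add: trace2_pull_swap trace3_trace2[abs_def])
  finally show ?thesis .
qed

lemma St_pull: "St G (pull3 \<theta> S) (pull \<theta> w) j k = pull2 \<theta> (St H S w) j k"
proof -
  have "St G (pull3 \<theta> S) (pull \<theta> w) j k =
      trace2 G (\<lambda>a b. pull \<theta> (\<lambda>c. pull2 \<theta> (\<lambda>a b. S a b c) j k) a * pull \<theta> w b)"
    by (simp only: St_trace2 pull3_third[where S=S and i=j and j=k])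
  also have "\<dots> = trace2 H (\<lambda>a b. pull2 \<theta> (\<lambda>p q. S p q a * w b) j k)"
    by (simp only: trace2_pull_mult pull_mult_right)
  also have "\<dots> = pull2 \<theta> (St H S w) j k"
    by (simp only: trace2_pull_swap St_trace2[symmetric])
  finally show ?thesis .
qed

lemma SS4_pull: "SS4 G (pull3 \<theta> S) i l j k = pull4 \<theta> (SS4 H S) i l j k"
proof -
  have "SS4 G (pull3 \<theta> S) i l j k = trace2 G (\<lambda>a b. pull \<theta> (\<lambda>c. pull2 \<theta> (\<lambda>a b. S a b c) i l) b
      * pull \<theta> (\<lambda>c. pull2 \<theta> (\<lambda>a b. S a b c) j k) a)"
    by (simp only: SS4_trace2 pull3_third[where S=S and i=i and j=l] pull3_third[where S=S and i=j and j=k])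
  also have "\<dots> = trace2 H (\<lambda>a b. pull2 \<theta> (\<lambda>p q. pull2 \<theta> (\<lambda>r s. S p q b * S r s a) j k) i l)"
    by (simp only: trace2_pull_mult' pull_mult_left pull_mult_right)
  also have "\<dots> = pull4 \<theta> (SS4 H S) i l j k"
    by (simp only: trace2_pull_swap SS4_trace2[symmetric])
  finally show ?thesis .
qed

lemma SS2_pull: "SS2 G (pull3 \<theta> S) i j = pull2 \<theta> (SS2 H S) i j"
proof -
  have *: "SS2 G' S' i j = trace2 G' (\<lambda>a c. SS4 G' S' i c j a)" for G' :: "real^'n^'n" and S' i j
    by (simp only: SS2_trace2 SS4_trace2)
  have swap: "pull4 \<theta> (SS4 H S) i c j a = pull2 \<theta> (\<lambda>p r. pull2 \<theta> (\<lambda>s q. SS4 H S p q r s) a c) i j" for a c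
  proof -
    have "pull \<theta> (\<lambda>q. pull \<theta> (\<lambda>r. pull \<theta> (SS4 H S p q r) a) j) c =
        pull \<theta> (\<lambda>r. pull2 \<theta> (\<lambda>s q. SS4 H S p q r s) a c) j" for p
    proof -
      have "pull \<theta> (\<lambda>q. pull \<theta> (\<lambda>r. pull \<theta> (SS4 H S p q r) a) j) c =
          pull \<theta> (\<lambda>r. pull \<theta> (\<lambda>q. pull \<theta> (SS4 H S p q r) a) c) j"
        by (rule pull_swap)
      moreover have "pull \<theta> (\<lambda>q. pull \<theta> (SS4 H S p q r) a) c = pull2 \<theta> (\<lambda>s q. SS4 H S p q r s) a c" for r
        by (rule pull_swap)
      ultimately show ?thesis by (simp only:)
    qed
    then show ?thesis by (simp only:)
  qed
  have "SS2 G (pull3 \<theta> S) i j = trace2 G (\<lambda>a c. pull2 \<theta> (\<lambda>p r. pull2 \<theta> (\<lambda>s q. SS4 H S p q r s) a c) i j)"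
    by (simp only: * SS4_pull swap)
  also have "\<dots> = pull2 \<theta> (\<lambda>p r. trace2 G (pull2 \<theta> (\<lambda>s q. SS4 H S p q r s))) i j"
    by (simp only: trace2_pull_swap)
  also have "\<dots> = pull2 \<theta> (SS2 H S) i j"
    by (simp only: trace2_pull2 *[symmetric])
  finally show ?thesis .
qed

end

lemma pull3_swap12: "pull3 \<theta> Y j i k = pull3 \<theta> (\<lambda>a b c. Y b a c) i j k"
  by (rule pull_swap)

lemma pull3_swap23: "pull3 \<theta> Y i k j = pull3 \<theta> (\<lambda>a b c. Y a c b) i j k"
proof -
  have "pull \<theta> (\<lambda>b. pull \<theta> (Y a b) j) k = pull \<theta> (\<lambda>c. pull \<theta> (\<lambda>b. Y a b c) k) j" for a
    by (rule pull_swap)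
  then show ?thesis by (simp only:)
qed

lemma sym3_pull3: "sym3 (pull3 \<theta> Y) i j k = pull3 \<theta> (sym3 Y) i j k"
proof -
  have p: "pull3 \<theta> Y i k j = pull3 \<theta> (\<lambda>a b c. Y a c b) i j k"
    "pull3 \<theta> Y j i k = pull3 \<theta> (\<lambda>a b c. Y b a c) i j k"
    "pull3 \<theta> Y j k i = pull3 \<theta> (\<lambda>a b c. Y b c a) i j k"
    "pull3 \<theta> Y k i j = pull3 \<theta> (\<lambda>a b c. Y c a b) i j k"
    "pull3 \<theta> Y k j i = pull3 \<theta> (\<lambda>a b c. Y c b a) i j k"
    subgoal by (rule pull3_swap23)
    subgoal by (rule pull3_swap12)
    subgoal by (rule trans[OF pull3_swap23 pull3_swap12])
    subgoal by (rule trans[OF pull3_swap12 pull3_swap23])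
    subgoal by (rule trans[OF pull3_swap12 trans[OF pull3_swap23 pull3_swap12]])
    done
  have "sym3 Y a = (\<lambda>b c. Y a b c + Y a c b + Y b a c + Y b c a + Y c a b + Y c b a)" for a
    by (simp add: fun_eq_iff sym3_def)
  then show ?thesis
    unfolding sym3_def[of "pull3 \<theta> Y"] p by (simp only: pull_add)
qed

context
  fixes \<theta> :: "'n::finite \<Rightarrow> 'n \<Rightarrow> real" and G H :: "real^'n^'n"
  assumes G: "\<And>i j. G $ i $ j = pull2 \<theta> (\<lambda>a b. H $ a $ b) i j" and nz: "det G \<noteq> 0"
begin

lemma tracefree2_pull: "tracefree2 G (pull2 \<theta> T) i j = pull2 \<theta> (tracefree2 H T) i j"
proof -
  have "tracefree2 H T a = (\<lambda>b. T a b - 1 / real CARD('n) * H $ a $ b * trace2 H T)" for a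
    by (simp add: fun_eq_iff tracefree2_def)
  then show ?thesis
    unfolding tracefree2_def[of G] trace2_pull2[OF G nz]
    by (simp only: G pull_diff pull_mult_left pull_mult_right)
qed

lemma tracefree3_pull: "tracefree3 G (pull3 \<theta> Y) i j k = pull3 \<theta> (tracefree3 H Y) i j k"
proof -
  define t where "t = trace3 H Y"
  have 1: "G $ i $ j * pull \<theta> t k = pull3 \<theta> (\<lambda>a b c. H $ a $ b * t c) i j k" for i j k
    by (simp only: G pull_mult_left pull_mult_right)
  have 2: "G $ i $ k * pull \<theta> t j = pull3 \<theta> (\<lambda>a b c. H $ a $ c * t b) i j k"
    unfolding 1 by (rule pull3_swap23)
  have 3: "G $ j $ k * pull \<theta> t i = pull3 \<theta> (\<lambda>a b c. H $ b $ c * t a) i j k"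
    unfolding 1 by (rule trans[OF pull3_swap23 pull3_swap12])
  have "tracefree3 H Y a = (\<lambda>b c. Y a b c - 1 / (real CARD('n) + 2) * (H $ a $ b * t c + H $ a $ c * t b + H $ b $ c * t a))" for a
    by (simp add: fun_eq_iff tracefree3_def t_def)
  then show ?thesis
    unfolding tracefree3_def[of G] trace3_pull[OF G nz] t_def[symmetric] 1[of i j k] 2 3
    by (simp only: pull_diff pull_add pull_mult_left)
qed

lemma Pi3_pull: "Pi3 G (pull4 \<theta> X) i j k l = pull4 \<theta> (Pi3 H X) i j k l"
proof -
  define Y where "Y = (\<lambda>a b c. pull \<theta> (X a b c) l)"
  have sy: "sym3 Y = (\<lambda>a b c. pull \<theta> (\<lambda>d. sym3 (\<lambda>p q r. X p q r d) a b c) l)"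
    by (simp add: fun_eq_iff sym3_def Y_def pull_add)
  have tr: "trace3 H (\<lambda>a b c. pull \<theta> (\<lambda>d. Z d a b c) l) k = pull \<theta> (\<lambda>d. trace3 H (Z d) k) l" for Z k
    by (simp only: trace3_trace2 trace2_pull_swap)
  have "Pi3 G (pull4 \<theta> X) i j k l = tracefree3 G (sym3 (pull3 \<theta> Y)) i j k"
    by (simp only: Pi3_def Y_def)
  also have "sym3 (pull3 \<theta> Y) = pull3 \<theta> (sym3 Y)"
    by (intro ext sym3_pull3)
  also have "tracefree3 G \<dots> i j k = pull3 \<theta> (tracefree3 H (sym3 Y)) i j k"
    by (rule tracefree3_pull)
  also have "tracefree3 H (sym3 Y) = (\<lambda>a b c. pull \<theta> (\<lambda>d. Pi3 H X a b c d) l)"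
    unfolding sy tracefree3_def[abs_def] Pi3_def tr
    by (simp only: pull_diff pull_add pull_mult_left)
  finally show ?thesis by (simp only:)
qed

end

text \<open>The right-hand sides are built from tensor operations, so they commute with the passage from frame components
to coordinate components. In \<open>deriv_rhs_pull\<close> the slots are permuted, because the derivative index \<open>l\<close> comes first
in \<open>deriv_rhs\<close> and last in \<open>Pi3\<close>.\<close>

lemma hess_rhs_pull:
  fixes \<theta> :: "3 \<Rightarrow> 3 \<Rightarrow> real"
  assumes G: "\<And>i j. G $ i $ j = pull2 \<theta> (\<lambda>a b. H $ a $ b) i j" and nz: "det G \<noteq> 0"
  shows "hess_rhs G (pull2 \<theta> Ric) (pull3 \<theta> S) (pull \<theta> w) i j = pull2 \<theta> (hess_rhs H Ric S w) i j"
proof -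
  define T where "T = (\<lambda>a b. 3 * Ric a b + 1/3 * SS2 H S a b + 1/3 * w a * w b)"
  have S2: "SS2 G (pull3 \<theta> S) = pull2 \<theta> (SS2 H S)"
    by (intro ext SS2_pull[OF G nz])
  have T: "(\<lambda>i j. 3 * pull2 \<theta> Ric i j + 1/3 * pull2 \<theta> (SS2 H S) i j + 1/3 * pull \<theta> w i * pull \<theta> w j) = pull2 \<theta> T"
    unfolding T_def by (simp only: pull_add pull_mult_left pull_mult_right)
  have h: "hess_rhs H Ric S w a = (\<lambda>b. tracefree2 H T a b
     + 1/3 * H $ a $ b * (3/4 * trace2 H Ric + 11/60 * trace2 H (SS2 H S) - 1/6 * norm2 H w))" for a
    by (simp add: fun_eq_iff hess_rhs_def T_def)
  show ?thesis
    unfolding hess_rhs_def[of G] S2 T tracefree2_pull[OF G nz] trace2_pull2[OF G nz] norm2_pull[OF G nz] h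
    by (simp only: G pull_add pull_mult_left pull_mult_right)
qed

lemma deriv_rhs_pull:
  fixes \<theta> :: "3 \<Rightarrow> 3 \<Rightarrow> real"
  assumes G: "\<And>i j. G $ i $ j = pull2 \<theta> (\<lambda>a b. H $ a $ b) i j" and nz: "det G \<noteq> 0"
  shows "deriv_rhs G (pull3 \<theta> S) (pull \<theta> w) l i j k = pull4 \<theta> (\<lambda>a b c d. deriv_rhs H S w d a b c) i j k l"
proof -
  define X where "X = (\<lambda>a b c d. SS4 H S a d b c + 3 * S a b d * w c + S a b c * w d
     + (4 * SS2 H S b c - 3 * St H S w b c) * H $ a $ d)"
  have 1: "SS4 G (pull3 \<theta> S) i l j k = pull4 \<theta> (\<lambda>a b c d. SS4 H S a d b c) i j k l" for i j k l
  proof -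
    have "pull3 \<theta> (SS4 H S a) l j k = pull3 \<theta> (\<lambda>b c d. SS4 H S a d b c) j k l" for a
      by (rule trans[OF pull3_swap12 pull3_swap23])
    then show ?thesis unfolding SS4_pull[OF G nz] by (simp only:)
  qed
  have "(\<lambda>i j k l. SS4 G (pull3 \<theta> S) i l j k + 3 * pull3 \<theta> S i j l * pull \<theta> w k + pull3 \<theta> S i j k * pull \<theta> w l
     + (4 * SS2 G (pull3 \<theta> S) j k - 3 * St G (pull3 \<theta> S) (pull \<theta> w) j k) * G $ i $ l) = pull4 \<theta> X"
    unfolding 1 SS2_pull[OF G nz] St_pull[OF G nz] X_def G
    by (simp only: pull_add pull_diff pull_mult_left pull_mult_right left_diff_distrib)
  then have "deriv_rhs G (pull3 \<theta> S) (pull \<theta> w) l i j k = 1/18 * pull4 \<theta> (Pi3 H X) i j k l"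
    unfolding deriv_rhs_def by (simp only: Pi3_pull[OF G nz])
  also have "\<dots> = pull4 \<theta> (\<lambda>a b c d. deriv_rhs H S w d a b c) i j k l"
    unfolding deriv_rhs_def X_def by (simp only: pull_mult_left)
  finally show ?thesis .
qed

section \<open>Levi-Civita connection and curvature in a closed conformal coframe\<close>

text \<open>A metric \<open>g = e\<^sup>2\<^sup>\<sigma> \<Sum>\<^sub>a e\<^sub>a \<theta>\<^sup>a \<theta>\<^sup>a\<close> with closed 1-forms \<open>\<theta>\<^sup>a\<close> and signs \<open>e\<^sub>a\<close>, which is how a conformally flat metric
looks near a point.\<close>

locale conformal_coframe =
  fixes U :: "(real^3) set" and g :: "real^3 \<Rightarrow> real^3^3" and \<theta> :: "3 \<Rightarrow> 3 \<Rightarrow> real^3 \<Rightarrow> real"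
    and e :: "3 \<Rightarrow> real" and \<sigma> :: "real^3 \<Rightarrow> real"
  assumes U: "open U" and \<theta>: "\<And>a i. smooth_on U (\<theta> a i)"
    and closed: "\<And>x a i j. x \<in> U \<Longrightarrow> pd i (\<theta> a j) x = pd j (\<theta> a i) x"
    and e: "\<And>a. e a * e a = 1" and \<sigma>: "smooth_on U \<sigma>"
    and metric: "\<And>x i j. x \<in> U \<Longrightarrow> g x $ i $ j = exp (2 * \<sigma> x) * (\<Sum>a\<in>UNIV. e a * \<theta> a i x * \<theta> a j x)"
    and nz: "\<And>x. x \<in> U \<Longrightarrow> det (g x) \<noteq> 0"
begin

abbreviation fr :: "real^3 \<Rightarrow> 3 \<Rightarrow> 3 \<Rightarrow> real" where "fr x \<equiv> (\<lambda>a i. \<theta> a i x)"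

definition frame_metric :: "real^3 \<Rightarrow> real^3^3" where
  "frame_metric x = diagm (\<lambda>a. exp (2 * \<sigma> x) * e a)"

lemma pull_diag: "pull2 \<theta>' (\<lambda>a b. diagm d $ a $ b) i j = (\<Sum>a\<in>UNIV. d a * \<theta>' a i * \<theta>' a j)"
  for \<theta>' :: "3 \<Rightarrow> 3 \<Rightarrow> real"
proof -
  have "pull \<theta>' (\<lambda>b. diagm d $ a $ b) j = d a * \<theta>' a j" for a
  proof -
    have "diagm d $ a $ b * \<theta>' b j = (if b = a then d a * \<theta>' a j else 0)" for b by simp
    then show ?thesis by (simp add: pull_def)
  qed
  then show ?thesis by (simp add: pull_def mult_ac)
qed

lemma metric_pull: "x \<in> U \<Longrightarrow> g x $ i $ j = pull2 (fr x) (\<lambda>a b. frame_metric x $ a $ b) i j"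
  unfolding frame_metric_def pull_diag metric by (simp add: sum_distrib_left mult_ac)

text \<open>The columns of this matrix are the coordinates of the vector fields dual to the coframe.\<close>

definition dual :: "real^3 \<Rightarrow> real^3^3" where
  "dual x = matrix_inv (\<chi> a i. \<theta> a i x)"

lemma det_coframe_nz: "x \<in> U \<Longrightarrow> det (\<chi> a i. \<theta> a i x) \<noteq> 0"
  using det_coframe[OF metric_pull nz] .

lemma dual_left: "x \<in> U \<Longrightarrow> (\<Sum>i\<in>UNIV. \<theta> a i x * dual x $ i $ b) = (if a = b then 1 else 0)"
  using matrix_inv_entries(1)[OF det_coframe_nz, of x a b] by (simp add: dual_def)

lemma dual_right: "x \<in> U \<Longrightarrow> (\<Sum>a\<in>UNIV. dual x $ i $ a * \<theta> a j x) = (if i = j then 1 else 0)"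
  using matrix_inv_entries(2)[OF det_coframe_nz, of x i j] by (simp add: dual_def)

lemma smooth_dual: "smooth_on U (\<lambda>x. dual x $ i $ a)"
  unfolding dual_def by (rule smooth_on_matrix_inv[OF U]) (simp_all add: \<theta> det_coframe_nz)

lemma unpull:
  assumes x: "x \<in> U" shows "(\<Sum>i\<in>UNIV. dual x $ i $ c * pull (fr x) X i) = X c"
proof -
  have "(\<Sum>i\<in>UNIV. dual x $ i $ c * pull (fr x) X i) = (\<Sum>a\<in>UNIV. X a * (\<Sum>i\<in>UNIV. \<theta> a i x * dual x $ i $ c))"
    unfolding pull_def sum_distrib_left by (subst sum.swap) (simp add: mult_ac)
  also have "\<dots> = (\<Sum>a\<in>UNIV. X a * (if c = a then 1 else 0))" by (simp add: dual_left[OF x] eq_commute)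
  finally show ?thesis by (simp only: sum_mult_delta)
qed

lemma pull_inject:
  assumes "x \<in> U" "\<And>i. pull (fr x) X i = pull (fr x) Y i" shows "X a = Y a"
  using unpull[OF assms(1), of a X] unpull[OF assms(1), of a Y] assms(2) by simp

text \<open>The derivative along the \<open>a\<close>-th vector field of the dual frame.\<close>

definition D :: "3 \<Rightarrow> (real^3 \<Rightarrow> real) \<Rightarrow> real^3 \<Rightarrow> real" where
  "D a f x = (\<Sum>i\<in>UNIV. dual x $ i $ a * pd i f x)"

lemma pd_frame: "x \<in> U \<Longrightarrow> pd i f x = pull (fr x) (\<lambda>a. D a f x) i"
proof -
  assume x: "x \<in> U"
  have "pull (fr x) (\<lambda>a. D a f x) i = (\<Sum>m\<in>UNIV. pd m f x * (\<Sum>a\<in>UNIV. dual x $ m $ a * \<theta> a i x))"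
    unfolding pull_def D_def sum_distrib_left sum_distrib_right by (subst sum.swap) (simp add: mult_ac)
  also have "\<dots> = (\<Sum>m\<in>UNIV. pd m f x * (if i = m then 1 else 0))" by (simp add: dual_right[OF x] eq_commute)
  finally show ?thesis by (simp only: sum_mult_delta)
qed

lemma D_eqI: "x \<in> U \<Longrightarrow> (\<And>i. pd i f x = pull (fr x) X i) \<Longrightarrow> D a f x = X a"
  using pull_inject[of x "\<lambda>a. D a f x" X a] pd_frame by simp

lemma smooth_D: "smooth_on U f \<Longrightarrow> smooth_on U (D a f)"
  unfolding D_def[abs_def] by (intro smooth_on_sum smooth_on_mult smooth_dual smooth_on_pd U)

text \<open>Second partial derivatives are symmetric and the \<open>\<theta>\<^sup>a\<close> are closed, hence the dual vector fields commute. This is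
what makes the frame as good as coordinates.\<close>

lemma D_commute:
  assumes x: "x \<in> U" and f: "smooth_on U f"
  shows "D a (D b f) x = D b (D a f) x"
proof -
  have second: "pd i (pd j f) x = pull2 (fr x) (\<lambda>a b. D a (D b f) x) i j
      + (\<Sum>b\<in>UNIV. D b f x * pd i (\<theta> b j) x)" for i j
  proof -
    have "pd i (pd j f) x = pd i (\<lambda>y. \<Sum>b\<in>UNIV. D b f y * \<theta> b j y) x"
      by (rule pd_cong[OF U _ x]) (simp add: pd_frame[of _ j f] pull_def)
    also have "\<dots> = (\<Sum>b\<in>UNIV. pd i (D b f) x * \<theta> b j x + D b f x * pd i (\<theta> b j) x)"
      by (subst pd_sum) (auto intro!: sum.cong pd_mult differentiable_mult
          smooth_on_differentiable[OF smooth_D[OF f] x] smooth_on_differentiable[OF \<theta> x])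
    also have "(\<Sum>b\<in>UNIV. pd i (D b f) x * \<theta> b j x + D b f x * pd i (\<theta> b j) x) =
        pull (fr x) (\<lambda>b. pull (fr x) (\<lambda>a. D a (D b f) x) i) j + (\<Sum>b\<in>UNIV. D b f x * pd i (\<theta> b j) x)"
      by (simp add: pd_frame[OF x, of i "D _ f"] pull_def[where i=j] sum.distrib)
    finally show ?thesis by (simp only: pull_swap[where i=j and j=i])
  qed
  have "pull2 (fr x) (\<lambda>a b. D a (D b f) x) i j = pull2 (fr x) (\<lambda>a b. D b (D a f) x) i j" for i j
  proof -
    have "pull2 (fr x) (\<lambda>a b. D a (D b f) x) i j = pull2 (fr x) (\<lambda>a b. D a (D b f) x) j i"
      using second[of i j] second[of j i] pd_commute[OF U f x, of i j] closed[OF x, of i _ j] by simp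
    then show ?thesis by (simp only: pull_swap[where i=j and j=i])
  qed
  then have "pull (fr x) (\<lambda>b. D a (D b f) x) j = pull (fr x) (\<lambda>b. D b (D a f) x) j" for j
    by (rule pull_inject[OF x])
  then show ?thesis by (rule pull_inject[OF x])
qed

text \<open>The coefficients of the Levi-Civita connection of \<open>g\<close> in the frame; the connection of \<open>e\<^sup>-\<^sup>2\<^sup>\<sigma> g\<close> contributes nothing,
because its frame is parallel.\<close>

definition conn :: "3 \<Rightarrow> 3 \<Rightarrow> 3 \<Rightarrow> real^3 \<Rightarrow> real" where
  "conn c a b x = conformal_connection e (\<lambda>a. D a \<sigma> x) c a b"

lemma conn_pull:
  assumes x: "x \<in> U"
  shows "pull2 (fr x) (\<lambda>a b. conn c a b x) i j =
    \<theta> c i x * pd j \<sigma> x + pd i \<sigma> x * \<theta> c j x - e c * D c \<sigma> x * (\<Sum>a\<in>UNIV. e a * \<theta> a i x * \<theta> a j x)"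
proof -
  have d: "pull (fr x) (\<lambda>a. if c = a then k else 0) i = k * \<theta> c i x" for c k i
  proof -
    have "(if c = a then k else 0) * \<theta> a i x = (if c = a then k * \<theta> c i x else 0)" for a by simp
    then show ?thesis by (simp add: pull_def)
  qed
  have d': "pull (fr x) (\<lambda>b. if c = b then k else 0) j = k * \<theta> c j x" for c k by (rule d)
  have 1: "pull (fr x) (\<lambda>b. if c = a then D b \<sigma> x else 0) j = (if c = a then pd j \<sigma> x else 0)" for a
    by (simp add: pd_frame[OF x, of j]) (simp add: pull_def)
  have 2: "pull (fr x) (\<lambda>b. if a = b then e a * e c * D c \<sigma> x else 0) j = e c * D c \<sigma> x * (e a * \<theta> a j x)" for a
    unfolding d' by simp
  have r: "e a * e c * D c \<sigma> x * t = e c * D c \<sigma> x * (e a * t)" for a t by simp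
  have "pull2 (fr x) (\<lambda>a b. conn c a b x) i j =
      pull (fr x) (\<lambda>a. (if c = a then pd j \<sigma> x else 0) + D a \<sigma> x * \<theta> c j x - e c * D c \<sigma> x * (e a * \<theta> a j x)) i"
    unfolding conn_def conformal_connection_def by (simp only: pull_add pull_diff d' 1 2 r)
  also have "\<dots> = pd j \<sigma> x * \<theta> c i x + pd i \<sigma> x * \<theta> c j x - e c * D c \<sigma> x * pull (fr x) (\<lambda>a. e a * \<theta> a j x) i"
    by (simp only: pull_add pull_diff d pull_mult_left pull_mult_right pd_frame[OF x, of i \<sigma>])
  finally show ?thesis by (simp add: pull_def mult_ac)
qed

text \<open>The transformation law of the connection. Lowering the index with \<open>g\<close> turns the left-hand side into the
Koszul formula, in which the derivatives of \<open>g\<close> are those of \<open>e\<^sup>2\<^sup>\<sigma>\<close> and of the \<open>\<theta>\<^sup>a\<close>; closedness of the \<open>\<theta>\<^sup>a\<close> lets all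
terms with derivatives of \<open>\<theta>\<^sup>a\<close> but one cancel.\<close>

lemma christoffel_coframe:
  assumes x: "x \<in> U"
  shows "(\<Sum>l\<in>UNIV. \<theta> c l x * christoffel g l i j x) =
    pd i (\<theta> c j) x + pull2 (fr x) (\<lambda>a b. conn c a b x) i j"
proof -
  define H where "H = (\<lambda>j k. \<Sum>a\<in>UNIV. e a * \<theta> a j x * \<theta> a k x)"
  define K where "K = (\<lambda>i j k. \<Sum>a\<in>UNIV. e a * pd i (\<theta> a j) x * \<theta> a k x)"
  define s where "s = (\<lambda>i. pd i \<sigma> x)"
  define L where "L = exp (2 * \<sigma> x)"
  have H_sym: "H j k = H k j" for j k by (simp add: H_def mult_ac)
  have K_sym: "K i j k = K j i k" for i j k by (simp add: K_def closed[OF x, of i _ j])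
  have d\<theta>: "\<theta> a i differentiable at x" for a i by (rule smooth_on_differentiable[OF \<theta> x])
  have d\<sigma>: "\<sigma> differentiable at x" by (rule smooth_on_differentiable[OF \<sigma> x])
  have dg: "pd i (\<lambda>y. g y $ j $ k) x = L * (2 * s i * H j k + K i j k + K i k j)" for i j k
  proof -
    have "pd i (\<lambda>y. g y $ j $ k) x = pd i (\<lambda>y. exp (2 * \<sigma> y) * (\<Sum>a\<in>UNIV. e a * (\<theta> a j y * \<theta> a k y))) x"
      by (rule pd_cong[OF U _ x]) (simp add: metric mult.assoc)
    also have "\<dots> = pd i (\<lambda>y. exp (2 * \<sigma> y)) x * H j k + L * pd i (\<lambda>y. \<Sum>a\<in>UNIV. e a * (\<theta> a j y * \<theta> a k y)) x"
    proof -
      have 1: "(\<lambda>y. exp (2 * \<sigma> y)) differentiable at x"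
        by (rule smooth_on_differentiable[OF _ x]) (intro smooth_on_exp smooth_on_mult smooth_on_const \<sigma> U)
      have 2: "(\<lambda>y. \<Sum>a\<in>UNIV. e a * (\<theta> a j y * \<theta> a k y)) differentiable at x"
        by (rule smooth_on_differentiable[OF _ x]) (intro smooth_on_sum smooth_on_mult smooth_on_const \<theta> U)
      show ?thesis by (subst pd_mult[OF 1 2]) (simp add: H_def L_def mult.assoc)
    qed
    also have "pd i (\<lambda>y. exp (2 * \<sigma> y)) x = L * (2 * s i)"
      using d\<sigma> by (subst pd_exp) (auto simp: L_def s_def pd_mult intro!: differentiable_mult)
    also have "pd i (\<lambda>y. \<Sum>a\<in>UNIV. e a * (\<theta> a j y * \<theta> a k y)) x = K i j k + K i k j"
    proof -
      have "pd i (\<lambda>y. e a * (\<theta> a j y * \<theta> a k y)) x = e a * pd i (\<theta> a j) x * \<theta> a k x + e a * pd i (\<theta> a k) x * \<theta> a j x" for a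
        using d\<theta> by (subst pd_mult) (auto simp: pd_mult distrib_left mult_ac intro!: differentiable_mult)
      then show ?thesis
        using d\<theta> by (subst pd_sum) (auto simp: K_def sum.distrib intro!: differentiable_mult)
    qed
    finally show ?thesis by (simp add: algebra_simps)
  qed
  define A where "A = (\<lambda>c. pd i (\<theta> c j) x + pull2 (fr x) (\<lambda>a b. conn c a b x) i j)"
  have low: "(\<Sum>l\<in>UNIV. g x $ k $ l * christoffel g l i j x) = L * (\<Sum>c\<in>UNIV. e c * \<theta> c k x * A c)" for k
  proof -
    have "(\<Sum>l\<in>UNIV. g x $ k $ l * christoffel g l i j x) = L * (s i * H j k + s j * H i k - s k * H i j + K i j k)"
      unfolding christoffel_lower[where h=g and x=x and m=k and i=i and j=j, OF nz[OF x]] dg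
      using K_sym[of i k j] K_sym[of j k i] K_sym[of i j k] by (simp add: algebra_simps)
    also have "s i * H j k + s j * H i k - s k * H i j + K i j k = (\<Sum>c\<in>UNIV. e c * \<theta> c k x * A c)"
    proof -
      have A: "A c = pd i (\<theta> c j) x + (\<theta> c i x * s j + s i * \<theta> c j x - e c * D c \<sigma> x * H i j)" for c
        by (simp only: A_def conn_pull[OF x] s_def H_def)
      have sk: "s k = (\<Sum>c\<in>UNIV. (e c * e c) * D c \<sigma> x * \<theta> c k x)"
        by (simp add: s_def pd_frame[OF x, of k] pull_def e)
      have "(\<Sum>c\<in>UNIV. e c * \<theta> c k x * A c) = (\<Sum>c\<in>UNIV. e c * pd i (\<theta> c j) x * \<theta> c k x
          + e c * \<theta> c i x * \<theta> c k x * s j + s i * (e c * \<theta> c j x * \<theta> c k x)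
          - (e c * e c) * D c \<sigma> x * \<theta> c k x * H i j)"
        unfolding A by (intro sum.cong refl) (simp only: algebra_simps)
      also have "\<dots> = K i j k + H i k * s j + s i * H j k - s k * H i j"
        by (simp only: sum_subtractf sum.distrib sum_distrib_left sum_distrib_right K_def H_def sk)
             (subst sum.swap, rule refl)
      finally show ?thesis by simp
    qed
    finally show ?thesis .
  qed
  \<comment> \<open>Both sides have the same image under \<open>pull\<close>, that is, after lowering the index.\<close>
  have "L * e a * (\<Sum>l\<in>UNIV. \<theta> a l x * christoffel g l i j x) = L * e a * A a" for a
  proof (rule pull_inject[OF x])
    fix k
    have "pull (fr x) (\<lambda>c. L * e c * (\<Sum>l\<in>UNIV. \<theta> c l x * christoffel g l i j x)) k =
        (\<Sum>l\<in>UNIV. g x $ k $ l * christoffel g l i j x)"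
      unfolding pull_def metric[OF x] L_def[symmetric] sum_distrib_left sum_distrib_right
      by (subst sum.swap) (simp add: mult_ac)
    also have "\<dots> = pull (fr x) (\<lambda>c. L * e c * A c) k"
      unfolding low pull_def sum_distrib_left by (simp add: mult_ac)
    finally show "pull (fr x) (\<lambda>c. L * e c * (\<Sum>l\<in>UNIV. \<theta> c l x * christoffel g l i j x)) k =
        pull (fr x) (\<lambda>c. L * e c * A c) k" .
  qed
  then show ?thesis using sign_divide(1)[OF e] by (simp add: A_def L_def)
qed

end

text \<open>The contracted curvature of the conformal connection, as a polynomial identity in the first and second
derivatives of \<open>\<sigma>\<close>. The second derivatives enter through \<open>C (s2 c)\<close>, because the connection coefficients are linear
in \<open>d\<sigma>\<close> with constant coefficients.\<close>

lemma conformal_ricci_contraction: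
  assumes e: "e 1 * e 1 = 1" "e 2 * e 2 = 1" "e 3 * e 3 = 1"
    and sym: "s2 2 1 = s2 1 2" "s2 3 1 = s2 1 3" "s2 3 2 = s2 2 3"
  defines "C \<equiv> conformal_connection e"
  shows "(\<Sum>c\<in>UNIV. C (s2 c) c b d - C (s2 b) c c d
       + (\<Sum>m\<in>UNIV. C s c c m * C s m b d - C s c b m * C s m c d)) = conformal_ricci e s s2 d b"
  unfolding C_def
  by (induction d rule: UNIV_3_cases; induction b rule: UNIV_3_cases;
      simp only: sum_3 conformal_connection_def conformal_ricci_def distinct_3 simp_thms if_True if_False
        mult_zero_left mult_zero_right add_0_left add_0_right diff_0_right sym mult_1_left;
      (use e in algebra | algebra))

context conformal_coframe
begin

lemma smooth_conn: "smooth_on U (conn c a b)"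
proof -
  have eq: "conn c a b = (\<lambda>x. (if c = a then 1 else 0) * D b \<sigma> x + (if c = b then 1 else 0) * D a \<sigma> x
      - (if a = b then e a * e c else 0) * D c \<sigma> x)"
    by (auto simp: fun_eq_iff conn_def conformal_connection_def)
  show ?thesis
    unfolding eq by (intro smooth_on_diff smooth_on_add smooth_on_mult smooth_on_const U smooth_D[OF \<sigma>])
qed

lemma smooth_pull: "(\<And>a. smooth_on U (X a)) \<Longrightarrow> smooth_on U (\<lambda>y. pull (fr y) (\<lambda>a. X a y) i)"
  unfolding pull_def by (intro smooth_on_sum smooth_on_mult U \<theta>)

lemma pd_pull:
  assumes x: "x \<in> U" and X: "\<And>a. smooth_on U (X a)"
  shows "pd l (\<lambda>y. pull (fr y) (\<lambda>a. X a y) i) x =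
    pull (fr x) (\<lambda>a. pd l (X a) x) i + (\<Sum>a\<in>UNIV. X a x * pd l (\<theta> a i) x)"
proof -
  have "pd l (\<lambda>y. pull (fr y) (\<lambda>a. X a y) i) x = (\<Sum>a\<in>UNIV. pd l (X a) x * \<theta> a i x + X a x * pd l (\<theta> a i) x)"
    unfolding pull_def
    by (subst pd_sum) (auto intro!: sum.cong pd_mult differentiable_mult
        smooth_on_differentiable[OF X x] smooth_on_differentiable[OF \<theta> x])
  then show ?thesis by (simp add: pull_def sum.distrib)
qed

text \<open>The first sum cancels the derivatives of the coframe in every covariant derivative, so that only frame
derivatives and the connection coefficients \<open>conn\<close> remain.\<close>

lemma christoffel_pull:
  assumes x: "x \<in> U"
  shows "(\<Sum>m\<in>UNIV. christoffel g m l i x * pull (fr x) X m) =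
    (\<Sum>a\<in>UNIV. X a * pd l (\<theta> a i) x) + (\<Sum>a\<in>UNIV. pull2 (fr x) (\<lambda>d b. conn a d b x) l i * X a)"
proof -
  have "(\<Sum>m\<in>UNIV. christoffel g m l i x * pull (fr x) X m) =
      (\<Sum>a\<in>UNIV. X a * (\<Sum>m\<in>UNIV. \<theta> a m x * christoffel g m l i x))"
    unfolding pull_def sum_distrib_left by (subst sum.swap) (simp add: mult_ac)
  then show ?thesis by (simp only: christoffel_coframe[OF x] distrib_left sum.distrib mult.commute[of "pull2 _ _ _ _"])
qed

lemma cov1_coframe:
  assumes x: "x \<in> U" and w: "\<And>b. smooth_on U (w b)"
    and \<omega>: "\<And>y j. y \<in> U \<Longrightarrow> \<omega> y j = pull (fr y) (\<lambda>b. w b y) j"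
  shows "cov1 g \<omega> i j x = pull2 (fr x) (\<lambda>a b. D a (w b) x - (\<Sum>c\<in>UNIV. conn c a b x * w c x)) i j"
proof -
  have "pd i (\<lambda>y. \<omega> y j) x = pd i (\<lambda>y. pull (fr y) (\<lambda>b. w b y) j) x"
    by (rule pd_cong[OF U \<omega> x])
  also have "\<dots> = pull2 (fr x) (\<lambda>a b. D a (w b) x) i j + (\<Sum>a\<in>UNIV. w a x * pd i (\<theta> a j) x)"
    by (simp only: pd_pull[OF x w] pd_frame[OF x, where i=i and f="w _"] pull_swap[where i=j and j=i])
  finally show ?thesis
    unfolding cov1_def \<omega>[OF x] christoffel_pull[OF x]
    by (simp only: pull_diff pull_sum pull_mult_left pull_mult_right add_diff_cancel_right add_diff_cancel_left')
qed

text \<open>Moves the derivative slot, which is the innermost one after differentiation, to the front.\<close>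

lemma pull_rotate: "pull3 \<theta>' (\<lambda>a b c. pull \<theta>' (\<lambda>d. X d a b c) l) i j k = pull4 \<theta>' X l i j k"
proof -
  have "pull \<theta>' (\<lambda>c. pull \<theta>' (\<lambda>d. X d a b c) l) k = pull \<theta>' (\<lambda>d. pull \<theta>' (X d a b) k) l" for a b
    by (rule pull_swap)
  moreover have "pull \<theta>' (\<lambda>b. pull \<theta>' (\<lambda>d. pull \<theta>' (X d a b) k) l) j = pull \<theta>' (\<lambda>d. pull \<theta>' (\<lambda>b. pull \<theta>' (X d a b) k) j) l" for a
    by (rule pull_swap)
  moreover have "pull \<theta>' (\<lambda>a. pull \<theta>' (\<lambda>d. pull \<theta>' (\<lambda>b. pull \<theta>' (X d a b) k) j) l) i = pull4 \<theta>' X l i j k"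
    by (rule pull_swap)
  ultimately show ?thesis by (simp only:)
qed

lemma cov3_coframe:
  assumes x: "x \<in> U" and s: "\<And>a b c. smooth_on U (s a b c)"
    and S: "\<And>y i j k. y \<in> U \<Longrightarrow> S y i j k = pull3 (fr y) (\<lambda>a b c. s a b c y) i j k"
  shows "cov3 g S l i j k x = pull4 (fr x) (\<lambda>d a b c. D d (s a b c) x
     - (\<Sum>f\<in>UNIV. conn f d a x * s f b c x + conn f d b x * s a f c x + conn f d c x * s a b f x)) l i j k"
proof -
  define F where "F = fr x"
  define C where "C = (\<lambda>f i. pull2 F (\<lambda>d b. conn f d b x) l i)"
  have "pd l (\<lambda>y. S y i j k) x = pd l (\<lambda>y. pull3 (fr y) (\<lambda>a b c. s a b c y) i j k) x"
    by (rule pd_cong[OF U S x])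
  also have "\<dots> = pull3 F (\<lambda>a b c. pd l (s a b c) x) i j k
      + pull2 F (\<lambda>a b. \<Sum>c\<in>UNIV. s a b c x * pd l (\<theta> c k) x) i j
      + pull F (\<lambda>a. \<Sum>b\<in>UNIV. pull F (\<lambda>c. s a b c x) k * pd l (\<theta> b j) x) i
      + (\<Sum>a\<in>UNIV. pull2 F (\<lambda>b c. s a b c x) j k * pd l (\<theta> a i) x)"
    by (simp only: pd_pull[OF x] smooth_pull s pull_add F_def)
  finally have 1: "pd l (\<lambda>y. S y i j k) x = pull3 F (\<lambda>a b c. pd l (s a b c) x) i j k
      + pull2 F (\<lambda>a b. \<Sum>c\<in>UNIV. s a b c x * pd l (\<theta> c k) x) i j
      + pull F (\<lambda>a. \<Sum>b\<in>UNIV. pull F (\<lambda>c. s a b c x) k * pd l (\<theta> b j) x) i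
      + (\<Sum>a\<in>UNIV. pull2 F (\<lambda>b c. s a b c x) j k * pd l (\<theta> a i) x)" .
  have 2: "(\<Sum>m\<in>UNIV. christoffel g m l i x * S x m j k) =
      (\<Sum>a\<in>UNIV. pull2 F (\<lambda>b c. s a b c x) j k * pd l (\<theta> a i) x) + (\<Sum>a\<in>UNIV. C a i * pull2 F (\<lambda>b c. s a b c x) j k)"
    unfolding S[OF x] christoffel_pull[OF x] C_def F_def ..
  have 3: "(\<Sum>m\<in>UNIV. christoffel g m l j x * S x i m k) =
      pull F (\<lambda>a. \<Sum>b\<in>UNIV. pull F (\<lambda>c. s a b c x) k * pd l (\<theta> b j) x) i
      + pull F (\<lambda>a. \<Sum>b\<in>UNIV. C b j * pull F (\<lambda>c. s a b c x) k) i"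
  proof -
    have "(\<Sum>m\<in>UNIV. christoffel g m l j x * S x i m k) =
        pull F (\<lambda>a. \<Sum>m\<in>UNIV. christoffel g m l j x * pull F (\<lambda>b. pull F (\<lambda>c. s a b c x) k) m) i"
      unfolding S[OF x] pull_sum pull_mult_left F_def ..
    then show ?thesis unfolding F_def christoffel_pull[OF x] pull_add C_def .
  qed
  have 4: "(\<Sum>m\<in>UNIV. christoffel g m l k x * S x i j m) =
      pull2 F (\<lambda>a b. \<Sum>c\<in>UNIV. s a b c x * pd l (\<theta> c k) x) i j
      + pull2 F (\<lambda>a b. \<Sum>c\<in>UNIV. C c k * s a b c x) i j"
  proof -
    have "(\<Sum>m\<in>UNIV. christoffel g m l k x * S x i j m) =
        pull2 F (\<lambda>a b. \<Sum>m\<in>UNIV. christoffel g m l k x * pull F (\<lambda>c. s a b c x) m) i j"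
      unfolding S[OF x] pull_sum pull_mult_left F_def ..
    then show ?thesis unfolding F_def christoffel_pull[OF x] pull_add C_def .
  qed
  have 5: "pull3 F (\<lambda>a b c. pd l (s a b c) x) i j k = pull4 F (\<lambda>d a b c. D d (s a b c) x) l i j k"
  proof -
    have "pd l (s a b c) x = pull F (\<lambda>d. D d (s a b c) x) l" for a b c
      unfolding F_def by (rule pd_frame[OF x])
    then have "pull3 F (\<lambda>a b c. pd l (s a b c) x) i j k = pull3 F (\<lambda>a b c. pull F (\<lambda>d. D d (s a b c) x) l) i j k"
      by (simp only:)
    also have "\<dots> = pull4 F (\<lambda>d a b c. D d (s a b c) x) l i j k" by (rule pull_rotate)
    finally show ?thesis .
  qed
  have "cov3 g S l i j k x = pull4 F (\<lambda>d a b c. D d (s a b c) x) l i j k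
     - ((\<Sum>f\<in>UNIV. C f i * pull2 F (\<lambda>b c. s f b c x) j k)
      + pull F (\<lambda>a. \<Sum>f\<in>UNIV. C f j * pull F (\<lambda>c. s a f c x) k) i
      + pull2 F (\<lambda>a b. \<Sum>f\<in>UNIV. C f k * s a b f x) i j)"
    unfolding cov3_def sum.distrib 1 2 3 4 5 by simp
  also have "\<dots> = pull4 F (\<lambda>d a b c. D d (s a b c) x
     - (\<Sum>f\<in>UNIV. conn f d a x * s f b c x + conn f d b x * s a f c x + conn f d c x * s a b f x)) l i j k"
    unfolding C_def sum.distrib
    by (simp only: pull_add pull_diff pull_sum pull_mult_left pull_mult_right)
  finally show ?thesis unfolding F_def .
qed

lemma smooth_metric: "smooth_on U (\<lambda>x. g x $ i $ j)"
proof -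
  have "smooth_on U (\<lambda>x. exp (2 * \<sigma> x) * (\<Sum>a\<in>UNIV. e a * \<theta> a i x * \<theta> a j x))"
    by (intro smooth_on_mult smooth_on_exp smooth_on_sum smooth_on_const \<theta> \<sigma> U)
  then show ?thesis by (subst smooth_on_cong[OF U metric])
qed

lemma smooth_christoffel: "smooth_on U (christoffel g k i j)"
  by (rule smooth_on_christoffel[OF U smooth_metric nz])

text \<open>The connection 1-forms: \<open>c\<close> and \<open>b\<close> are frame indices, \<open>i\<close> is a coordinate index. With such mixed indices the
Christoffel symbols are a gauge transform of the connection by the coframe.\<close>

definition conn_form :: "3 \<Rightarrow> 3 \<Rightarrow> 3 \<Rightarrow> real^3 \<Rightarrow> real" where
  "conn_form c b i y = pull (fr y) (\<lambda>a. conn c a b y) i"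

lemma smooth_conn_form: "smooth_on U (conn_form c b i)"
  unfolding conn_form_def by (intro smooth_pull smooth_conn)

lemma christoffel_conn_form:
  assumes x: "x \<in> U"
  shows "(\<Sum>l\<in>UNIV. \<theta> c l x * christoffel g l j k x) = pd j (\<theta> c k) x + pull (fr x) (\<lambda>b. conn_form c b j x) k"
  unfolding christoffel_coframe[OF x] conn_form_def by (simp only: pull_swap[where i=j and j=k])

definition curvature_form :: "3 \<Rightarrow> 3 \<Rightarrow> 3 \<Rightarrow> 3 \<Rightarrow> real^3 \<Rightarrow> real" where
  "curvature_form c d i j x = pd i (conn_form c d j) x - pd j (conn_form c d i) x
     + (\<Sum>m\<in>UNIV. conn_form c m i x * conn_form m d j x - conn_form c m j x * conn_form m d i x)"

text \<open>Curvature transforms as a tensor under the gauge transformation by the coframe: the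
second derivatives of the coframe are symmetric in \<open>i, j\<close>, and so is the sum of the terms that contain one first
derivative, hence both drop out of the antisymmetric combination.\<close>

lemma riemann_coframe:
  assumes x: "x \<in> U"
  shows "(\<Sum>l\<in>UNIV. \<theta> c l x * riemann g l k i j x) = pull (fr x) (\<lambda>d. curvature_form c d i j x) k"
proof -
  define A where "A = (\<lambda>c j k y. \<Sum>l\<in>UNIV. \<theta> c l y * christoffel g l j k y)"
  define \<Gamma> where "\<Gamma> = (\<lambda>l j k. christoffel g l j k x)"
  define w where "w = (\<lambda>c b i. conn_form c b i x)"
  have A: "A c j k x = pd j (\<theta> c k) x + pull (fr x) (\<lambda>b. w c b j) k" for c j k
    unfolding A_def w_def by (rule christoffel_conn_form[OF x])
  have half: "(\<Sum>l\<in>UNIV. \<theta> c l x * (pd i (christoffel g l j k) x + (\<Sum>m\<in>UNIV. \<Gamma> l i m * \<Gamma> m j k))) =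
      pd i (pd j (\<theta> c k)) x + pull (fr x) (\<lambda>d. pd i (conn_form c d j) x) k
      + (\<Sum>b\<in>UNIV. w c b j * pd i (\<theta> b k) x + w c b i * pd j (\<theta> b k) x)
      + pull (fr x) (\<lambda>d. \<Sum>m\<in>UNIV. w c m i * w m d j) k" for i j
  proof -
    have "pd i (A c j k) x = (\<Sum>l\<in>UNIV. pd i (\<theta> c l) x * \<Gamma> l j k + \<theta> c l x * pd i (christoffel g l j k) x)"
      unfolding A_def \<Gamma>_def
      by (subst pd_sum) (auto intro!: sum.cong pd_mult differentiable_mult
          smooth_on_differentiable[OF smooth_christoffel x] smooth_on_differentiable[OF \<theta> x])
    then have 1: "(\<Sum>l\<in>UNIV. \<theta> c l x * pd i (christoffel g l j k) x) = pd i (A c j k) x - (\<Sum>l\<in>UNIV. pd i (\<theta> c l) x * \<Gamma> l j k)"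
      by (simp add: sum.distrib)
    have 2: "pd i (A c j k) x = pd i (pd j (\<theta> c k)) x + (pull (fr x) (\<lambda>b. pd i (conn_form c b j) x) k
        + (\<Sum>b\<in>UNIV. w c b j * pd i (\<theta> b k) x))"
    proof -
      have "pd i (A c j k) x = pd i (\<lambda>y. pd j (\<theta> c k) y + pull (fr y) (\<lambda>b. conn_form c b j y) k) x"
        unfolding A_def by (rule pd_cong[OF U christoffel_conn_form x])
      also have "\<dots> = pd i (pd j (\<theta> c k)) x + pd i (\<lambda>y. pull (fr y) (\<lambda>b. conn_form c b j y) k) x"
        by (rule pd_add) (auto intro!: smooth_on_differentiable[OF _ x] smooth_on_pd \<theta> smooth_pull smooth_conn_form)
      finally show ?thesis by (simp only: pd_pull[OF x smooth_conn_form] w_def)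
    qed
    have "(\<Sum>l\<in>UNIV. \<theta> c l x * (\<Sum>m\<in>UNIV. \<Gamma> l i m * \<Gamma> m j k)) = (\<Sum>m\<in>UNIV. A c i m x * \<Gamma> m j k)"
      unfolding A_def \<Gamma>_def sum_distrib_left sum_distrib_right by (subst sum.swap) (simp add: mult_ac)
    also have "\<dots> = (\<Sum>m\<in>UNIV. pd i (\<theta> c m) x * \<Gamma> m j k) + (\<Sum>m\<in>UNIV. \<Gamma> m j k * pull (fr x) (\<lambda>b. w c b i) m)"
      by (simp add: A distrib_left distrib_right sum.distrib mult.commute)
    also have "(\<Sum>m\<in>UNIV. \<Gamma> m j k * pull (fr x) (\<lambda>b. w c b i) m) = (\<Sum>b\<in>UNIV. w c b i * A b j k x)"
      unfolding pull_def A_def \<Gamma>_def sum_distrib_left by (subst sum.swap) (simp add: mult_ac)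
    also have "\<dots> = (\<Sum>b\<in>UNIV. w c b i * pd j (\<theta> b k) x) + pull (fr x) (\<lambda>d. \<Sum>m\<in>UNIV. w c m i * w m d j) k"
      unfolding A by (simp only: distrib_left sum.distrib pull_sum pull_mult_left)
    finally show ?thesis
      unfolding distrib_left sum.distrib 1 2 by simp
  qed
  have "riemann g l k i j x = (pd i (christoffel g l j k) x + (\<Sum>m\<in>UNIV. \<Gamma> l i m * \<Gamma> m j k))
      - (pd j (christoffel g l i k) x + (\<Sum>m\<in>UNIV. \<Gamma> l j m * \<Gamma> m i k))" for l
    by (simp add: riemann_def \<Gamma>_def sum_subtractf)
  then have "(\<Sum>l\<in>UNIV. \<theta> c l x * riemann g l k i j x) =
      (\<Sum>l\<in>UNIV. \<theta> c l x * (pd i (christoffel g l j k) x + (\<Sum>m\<in>UNIV. \<Gamma> l i m * \<Gamma> m j k)))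
      - (\<Sum>l\<in>UNIV. \<theta> c l x * (pd j (christoffel g l i k) x + (\<Sum>m\<in>UNIV. \<Gamma> l j m * \<Gamma> m i k)))"
    by (simp only: right_diff_distrib sum_subtractf)
  also have "\<dots> = pull (fr x) (\<lambda>d. pd i (conn_form c d j) x) k + pull (fr x) (\<lambda>d. \<Sum>m\<in>UNIV. w c m i * w m d j) k
      - (pull (fr x) (\<lambda>d. pd j (conn_form c d i) x) k + pull (fr x) (\<lambda>d. \<Sum>m\<in>UNIV. w c m j * w m d i) k)"
    unfolding half using pd_commute[OF U \<theta> x, of i j c k] by (simp add: sum.distrib)
  also have "\<dots> = pull (fr x) (\<lambda>d. curvature_form c d i j x) k"
    unfolding curvature_form_def w_def by (simp only: pull_add pull_diff sum_subtractf)
  finally show ?thesis .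
qed

text \<open>The curvature in the frame; there is no bracket term because the frame fields commute.\<close>

definition frame_curvature :: "3 \<Rightarrow> 3 \<Rightarrow> 3 \<Rightarrow> 3 \<Rightarrow> real^3 \<Rightarrow> real" where
  "frame_curvature c d a b x = D a (conn c b d) x - D b (conn c a d) x
     + (\<Sum>m\<in>UNIV. conn c a m x * conn m b d x - conn c b m x * conn m a d x)"

lemma curvature_form_pull:
  assumes x: "x \<in> U"
  shows "curvature_form c d i j x = pull2 (fr x) (\<lambda>a b. frame_curvature c d a b x) i j"
proof -
  have half: "pd i (conn_form c d j) x = pull2 (fr x) (\<lambda>a b. D a (conn c b d) x) i j
      + (\<Sum>a\<in>UNIV. conn c a d x * pd i (\<theta> a j) x)" for i j
    unfolding conn_form_def
    by (simp only: pd_pull[OF x smooth_conn] pd_frame[OF x, where i=i and f="conn _ _ _"] pull_swap[where i=j and j=i])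
  have half': "pd j (conn_form c d i) x = pull2 (fr x) (\<lambda>a b. D b (conn c a d) x) i j
      + (\<Sum>a\<in>UNIV. conn c a d x * pd i (\<theta> a j) x)"
    unfolding half[of j i] by (simp only: pull_swap[where i=j and j=i] closed[OF x, of i _ j])
  have q: "conn_form c m i x * conn_form m d j x = pull2 (fr x) (\<lambda>a b. conn c a m x * conn m b d x) i j"
    "conn_form c m j x * conn_form m d i x = pull2 (fr x) (\<lambda>a b. conn c b m x * conn m a d x) i j" for m
    unfolding conn_form_def by (simp_all only: pull_mult_left pull_mult_right)
  show ?thesis
    unfolding curvature_form_def half[of i j] half' q frame_curvature_def
    by (simp only: pull_add pull_diff pull_sum add_diff_cancel_right)
qed

text \<open>The trace over a coordinate index and its dual turns into the trace over a frame index, since \<open>dual\<close> inverts the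
coframe.\<close>

lemma ricci_coframe:
  assumes x: "x \<in> U"
  shows "ricci g k j x = pull2 (fr x) (\<lambda>d b. \<Sum>c\<in>UNIV. frame_curvature c d c b x) k j"
proof -
  have R: "riemann g l k i j x = (\<Sum>c\<in>UNIV. dual x $ l $ c * (\<Sum>m\<in>UNIV. \<theta> c m x * riemann g m k i j x))" for l i
  proof -
    have "(\<Sum>c\<in>UNIV. dual x $ l $ c * (\<Sum>m\<in>UNIV. \<theta> c m x * riemann g m k i j x)) =
        (\<Sum>m\<in>UNIV. riemann g m k i j x * (\<Sum>c\<in>UNIV. dual x $ l $ c * \<theta> c m x))"
      unfolding sum_distrib_left by (subst sum.swap) (simp add: mult_ac)
    then show ?thesis unfolding dual_right[OF x] by (simp only: sum_mult_delta)
  qed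
  define K where "K = (\<lambda>c d a b. frame_curvature c d a b x)"
  have sw: "pull (fr x) (\<lambda>d. pull2 (fr x) (K c d) i j) k = pull (fr x) (\<lambda>a. pull2 (fr x) (\<lambda>d. K c d a) k j) i" for c i
    by (rule pull_swap)
  have "ricci g k j x = (\<Sum>i\<in>UNIV. \<Sum>c\<in>UNIV. dual x $ i $ c * pull (fr x) (\<lambda>d. pull2 (fr x) (K c d) i j) k)"
  proof -
    have "riemann g i k i j x = (\<Sum>c\<in>UNIV. dual x $ i $ c * pull (fr x) (\<lambda>d. pull2 (fr x) (K c d) i j) k)" for i
      by (subst R) (simp only: riemann_coframe[OF x] curvature_form_pull[OF x] K_def)
    then show ?thesis by (simp only: ricci_def)
  qed
  also have "\<dots> = (\<Sum>c\<in>UNIV. \<Sum>i\<in>UNIV. dual x $ i $ c * pull (fr x) (\<lambda>a. pull2 (fr x) (\<lambda>d. K c d a) k j) i)"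
    unfolding sw by (rule sum.swap)
  also have "\<dots> = (\<Sum>c\<in>UNIV. pull2 (fr x) (\<lambda>d. K c d c) k j)"
    by (simp only: unpull[OF x])
  also have "\<dots> = pull2 (fr x) (\<lambda>d b. \<Sum>c\<in>UNIV. frame_curvature c d c b x) k j"
    unfolding K_def by (simp only: pull_sum)
  finally show ?thesis .
qed

lemma D_conn:
  assumes x: "x \<in> U"
  shows "D a (conn c b d) x = conformal_connection e (\<lambda>m. D a (D m \<sigma>) x) c b d"
proof -
  define k1 where "k1 = (if c = b then 1 else 0 :: real)"
  define k2 where "k2 = (if c = d then 1 else 0 :: real)"
  define k3 where "k3 = (if b = d then e b * e c else 0)"
  have cc: "conformal_connection e s c b d = k1 * s d + k2 * s b - k3 * s c" for s
    unfolding conformal_connection_def k1_def k2_def k3_def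
    by (cases "c = b"; cases "c = d"; cases "b = d"; simp only: if_True if_False simp_thms mult_1_left mult_zero_left)
  have diff: "D m \<sigma> differentiable at x" for m by (rule smooth_on_differentiable[OF smooth_D[OF \<sigma>] x])
  have p': "pd i (\<lambda>x. k1 * D d \<sigma> x + k2 * D b \<sigma> x - k3 * D c \<sigma> x) x =
      k1 * pd i (D d \<sigma>) x + k2 * pd i (D b \<sigma>) x - k3 * pd i (D c \<sigma>) x" for i
  proof -
    have d: "(\<lambda>x. k * D m \<sigma> x) differentiable at x" for k m
      by (intro differentiable_mult differentiable_const diff)
    have p: "pd i (\<lambda>x. k * D m \<sigma> x) x = k * pd i (D m \<sigma>) x" for k m
      by (subst pd_mult) (simp_all add: diff)
    show ?thesis
      by (subst pd_diff[OF differentiable_add[OF d d] d], subst pd_add[OF d d]) (simp only: p)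
  qed
  have "D a (\<lambda>x. k1 * D d \<sigma> x + k2 * D b \<sigma> x - k3 * D c \<sigma> x) x =
      k1 * D a (D d \<sigma>) x + k2 * D a (D b \<sigma>) x - k3 * D a (D c \<sigma>) x"
    unfolding D_def[of a] p' by (simp add: algebra_simps sum.distrib sum_subtractf sum_distrib_left)
  then show ?thesis unfolding conn_def[abs_def] cc .
qed

lemma ricci_conformal:
  assumes x: "x \<in> U"
  shows "ricci g k j x = pull2 (fr x) (conformal_ricci e (\<lambda>a. D a \<sigma> x) (\<lambda>a b. D a (D b \<sigma>) x)) k j"
proof -
  define s where "s = (\<lambda>a. D a \<sigma> x)"
  define s2 where "s2 = (\<lambda>a b. D a (D b \<sigma>) x)"
  have sym: "s2 2 1 = s2 1 2" "s2 3 1 = s2 1 3" "s2 3 2 = s2 2 3"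
    unfolding s2_def by (rule D_commute[OF x \<sigma>])+
  have D_conn': "D a (conn c b d) x = conformal_connection e (s2 a) c b d" for a b c d
    unfolding D_conn[OF x] s2_def ..
  have conn': "conn c a b x = conformal_connection e s c a b" for a b c
    unfolding conn_def s_def ..
  have "(\<Sum>c\<in>UNIV. frame_curvature c d c b x) = conformal_ricci e s s2 d b" for d b
    unfolding frame_curvature_def D_conn' conn'
    by (rule conformal_ricci_contraction[OF e e e sym])
  then show ?thesis unfolding ricci_coframe[OF x] s_def s2_def by (simp only:)
qed

end

section \<open>Solutions of the structural system from solutions of the flat system\<close>

lemma linear_euclidean_expand:
  fixes L :: "'b::euclidean_space \<Rightarrow> 'c::real_vector"
  assumes "linear L"
  shows "L v = (\<Sum>b\<in>Basis. (v \<bullet> b) *\<^sub>R L b)"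
proof -
  have "L v = L (\<Sum>b\<in>Basis. (v \<bullet> b) *\<^sub>R b)" by (simp only: euclidean_representation)
  also have "\<dots> = (\<Sum>b\<in>Basis. (v \<bullet> b) *\<^sub>R L b)"
    by (simp add: linear_sum[OF assms] linear_cmul[OF assms])
  finally show ?thesis .
qed

lemma bilinear_euclidean_expand:
  fixes Q :: "'b::euclidean_space \<Rightarrow> 'b \<Rightarrow> 'c::real_vector"
  assumes "bilinear Q"
  shows "Q u v = (\<Sum>a\<in>Basis. \<Sum>b\<in>Basis. ((u \<bullet> a) * (v \<bullet> b)) *\<^sub>R Q a b)"
proof -
  have 1: "Q u v = (\<Sum>a\<in>Basis. (u \<bullet> a) *\<^sub>R Q a v)"
    by (rule linear_euclidean_expand) (use assms in \<open>simp add: bilinear_def\<close>)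
  have 2: "Q a v = (\<Sum>b\<in>Basis. (v \<bullet> b) *\<^sub>R Q a b)" for a
    by (rule linear_euclidean_expand) (use assms in \<open>simp add: bilinear_def\<close>)
  show ?thesis by (subst 1) (simp only: 2 scaleR_sum_right scaleR_scaleR)
qed

text \<open>The components of \<open>\<partial>\<^sub>i u\<close> are polynomials in the components of \<open>u\<close> with smooth coefficients, so that
\<open>smooth_on_bootstrap\<close> applies.\<close>

lemma smooth_quadratic_system:
  fixes u :: "real^'n \<Rightarrow> 'b::euclidean_space" and c :: "'p::finite \<Rightarrow> 'n::finite \<Rightarrow> real^'n \<Rightarrow> real"
  assumes U: "open U" and c: "\<And>p i. smooth_on U (c p i)" and Q: "\<And>p. bilinear (Q p)"
    and u: "\<And>x. x \<in> U \<Longrightarrow> (u has_derivative (\<lambda>h. \<Sum>i\<in>UNIV. h $ i *\<^sub>R (\<Sum>p\<in>UNIV. c p i x *\<^sub>R Q p (u x) (u x)))) (at x)"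
  shows "smooth_on U (\<lambda>x. u x \<bullet> b)"
proof (rule smooth_on_bootstrap[OF U, where f="\<lambda>b x. u x \<bullet> b"])
  have der: "((\<lambda>x. u x \<bullet> b) has_derivative (\<lambda>h. (\<Sum>i\<in>UNIV. h $ i *\<^sub>R (\<Sum>p\<in>UNIV. c p i x *\<^sub>R Q p (u x) (u x))) \<bullet> b)) (at x)"
    if "x \<in> U" for x b
    using has_derivative_inner_left[OF u[OF that]] .
  show "\<And>b x. x \<in> U \<Longrightarrow> (\<lambda>x. u x \<bullet> b) differentiable at x"
    using der unfolding differentiable_def by blast
  fix k b i assume IH: "\<And>b. Ck_on k U (\<lambda>x. u x \<bullet> b)"
  have "pd i (\<lambda>x. u x \<bullet> b) x = (\<Sum>p\<in>UNIV. c p i x * (\<Sum>a\<in>Basis. \<Sum>a'\<in>Basis. ((u x \<bullet> a) * (u x \<bullet> a')) * (Q p a a' \<bullet> b)))"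
    if x: "x \<in> U" for x
  proof -
    have ax: "(\<Sum>j\<in>UNIV. axis i 1 $ j *\<^sub>R v j) = v i" for v :: "'n \<Rightarrow> 'b"
    proof -
      have "(axis i 1 :: real^'n) $ j *\<^sub>R v j = (if j = i then v i else 0)" for j by (simp add: axis_def)
      then show ?thesis by simp
    qed
    have "pd i (\<lambda>x. u x \<bullet> b) x = (\<Sum>p\<in>UNIV. c p i x *\<^sub>R Q p (u x) (u x)) \<bullet> b"
      unfolding pd_eq[OF der[OF x]] ax ..
    also have "\<dots> = (\<Sum>p\<in>UNIV. c p i x * (Q p (u x) (u x) \<bullet> b))" by (simp add: inner_sum_left)
    moreover have "Q p (u x) (u x) \<bullet> b = (\<Sum>a\<in>Basis. \<Sum>a'\<in>Basis. ((u x \<bullet> a) * (u x \<bullet> a')) * (Q p a a' \<bullet> b))" for p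
      by (subst bilinear_euclidean_expand[OF Q]) (simp add: inner_sum_left)
    ultimately show ?thesis by simp
  qed
  then have "Ck_on k U (pd i (\<lambda>x. u x \<bullet> b)) \<longleftrightarrow>
     Ck_on k U (\<lambda>x. \<Sum>p\<in>UNIV. c p i x * (\<Sum>a\<in>Basis. \<Sum>a'\<in>Basis. ((u x \<bullet> a) * (u x \<bullet> a')) * (Q p a a' \<bullet> b)))"
    by (intro Ck_on_cong U)
  then show "Ck_on k U (pd i (\<lambda>x. u x \<bullet> b))"
    using IH c by (auto simp: smooth_on_def intro!: Ck_on_sum Ck_on_mult Ck_on_const U)
qed

lemma smooth_on_primitive:
  assumes U: "open U" and t: "\<And>x. x \<in> U \<Longrightarrow> t differentiable at x"
    and w: "\<And>i. smooth_on U (w i)" and eq: "\<And>x i. x \<in> U \<Longrightarrow> pd i t x = w i x"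
  shows "smooth_on U t"
  unfolding smooth_on_def
proof
  fix k
  have "Ck_on k U (pd i t)" for i
  proof -
    have "Ck_on k U (pd i t) \<longleftrightarrow> Ck_on k U (w i)" by (intro Ck_on_cong U eq)
    then show ?thesis using w[of i] by (simp only: smooth_on_def)
  qed
  then have "Ck_on (Suc k) U t" using t by simp
  then show "Ck_on k U t" by (rule Ck_on_Suc_imp)
qed

text \<open>The Frobenius theorem for the system \<open>dt = w\<close>, whose right-hand side does not involve the unknown: closedness is the
integrability condition.\<close>

lemma poincare:
  fixes w :: "'n::finite \<Rightarrow> real^'n \<Rightarrow> real"
  assumes U: "open U" "p \<in> U" and w: "\<And>i. smooth_on U (w i)"
    and closed: "\<And>x i j. x \<in> U \<Longrightarrow> pd i (w j) x = pd j (w i) x"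
  shows "\<exists>r>0. \<exists>t. ball p r \<subseteq> U \<and> smooth_on (ball p r) t \<and> (\<forall>x\<in>ball p r. \<forall>i. pd i t x = w i x)"
proof -
  have "\<exists>r>0. \<exists>t. ball p r \<subseteq> U \<and> t p = (0::real) \<and>
     (\<forall>x\<in>ball p r. (t has_derivative (\<lambda>h. \<Sum>i\<in>UNIV. h $ i *\<^sub>R (\<Sum>q\<in>(UNIV::unit set). w i x *\<^sub>R 1))) (at x))"
    by (rule frobenius_separated[OF U, where c="\<lambda>_. w" and Q="\<lambda>_ _. 1" and Q'="\<lambda>_ _. 0"])
       (simp_all add: w closed zero_blinfun.rep_eq)
  then obtain r t where r: "r > 0" "ball p r \<subseteq> U"
    and t': "\<forall>x\<in>ball p r. (t has_derivative (\<lambda>h. \<Sum>i\<in>UNIV. h $ i *\<^sub>R (\<Sum>q\<in>(UNIV::unit set). w i x *\<^sub>R (1::real)))) (at x)"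
    by blast
  have t: "(t has_derivative (\<lambda>h. \<Sum>i\<in>UNIV. h $ i * w i x)) (at x)" if "x \<in> ball p r" for x
    using t'[rule_format, OF that] by simp
  have pt: "pd i t x = w i x" if "x \<in> ball p r" for x i
  proof -
    have "(\<Sum>j\<in>UNIV. axis i (1::real) $ j * w j x) = (\<Sum>j\<in>UNIV. w j x * (if i = j then 1 else 0))"
      by (intro sum.cong) (auto simp: axis_def)
    then show ?thesis unfolding pd_eq[OF t[OF that]] by (simp only: sum_mult_delta)
  qed
  have "smooth_on (ball p r) t"
  proof (rule smooth_on_primitive[where w=w])
    show "open (ball p r)" by simp
    show "\<And>x. x \<in> ball p r \<Longrightarrow> t differentiable at x" using t unfolding differentiable_def by blast
    show "\<And>i. smooth_on (ball p r) (w i)" by (rule smooth_on_subset[OF w r(2)])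
  qed (rule pt)
  then show ?thesis using r pt by blast
qed

lemma linear_cubic_part: "linear (\<lambda>\<tau>. cubic_part e \<tau> i j k)"
proof (rule linearI)
  fix x y :: flat_state and c :: real
  obtain p q r s u v z w where x: "x = ((p, q, r, s, u, v, z), w)" by (metis prod.exhaust)
  obtain p' q' r' s' u' v' z' w' where y: "y = ((p', q', r', s', u', v', z'), w')" by (metis prod.exhaust)
  show "cubic_part e (x + y) i j k = cubic_part e x i j k + cubic_part e y i j k"
    unfolding x y
    by (induction i rule: UNIV_3_cases; induction j rule: UNIV_3_cases; induction k rule: UNIV_3_cases;
        simp only: plus_prod_def fst_conv snd_conv cubic_part_components; algebra)
  show "cubic_part e (c *\<^sub>R x) i j k = c *\<^sub>R cubic_part e x i j k"
    unfolding x
    by (induction i rule: UNIV_3_cases; induction j rule: UNIV_3_cases; induction k rule: UNIV_3_cases;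
        simp only: scaleR_prod_def real_scaleR_def fst_conv snd_conv cubic_part_components; algebra)
qed

lemma linear_linear_part: "linear (\<lambda>\<tau>. linear_part \<tau> i)"
proof (rule linearI)
  fix x y :: flat_state and c :: real
  obtain v a1 b1 c1 where x: "x = (v, (a1, b1, c1))" by (metis prod.exhaust)
  obtain v' a2 b2 c2 where y: "y = (v', (a2, b2, c2))" by (metis prod.exhaust)
  show "linear_part (x + y) i = linear_part x i + linear_part y i"
    unfolding x y by (induction i rule: UNIV_3_cases; simp only: plus_prod_def fst_conv snd_conv linear_part_components)
  show "linear_part (c *\<^sub>R x) i = c *\<^sub>R linear_part x i"
    unfolding x by (induction i rule: UNIV_3_cases;
        simp only: scaleR_prod_def real_scaleR_def fst_conv snd_conv linear_part_components)
qed

text \<open>The Hessian of \<open>t\<close> that the system prescribes is symmetric; hence \<open>t\<close> exists.\<close>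

lemma linear_part_flat_form_sym: "linear_part (flat_form e i \<tau> \<tau>) j = linear_part (flat_form e j \<tau> \<tau>) i"
proof -
  obtain p q r s u v z a b c where t: "\<tau> = ((p, q, r, s, u, v, z), (a, b, c))" by (metis prod.exhaust)
  show ?thesis
    unfolding t
    by (induction i rule: UNIV_3_cases; induction j rule: UNIV_3_cases;
        simp only: flat_form_simps flat_form1_def flat_form2_def flat_form3_def prod.case linear_part_components; algebra)
qed

lemma bilinear_flat_form: "bilinear (flat_form e l)"
  unfolding bilinear_def
  by (intro conjI allI linearI flat_form_add_left flat_form_add_right flat_form_scaleR_left flat_form_scaleR_right)

text \<open>Written with \<open>u\<close> for \<open>\<tau>\<close>, the equation says \<open>du = Q\<^sub>1(u) \<theta>\<^sup>1 + Q\<^sub>2(u) \<theta>\<^sup>2 + Q\<^sub>3(u) \<theta>\<^sup>3\<close> with the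
quadratic vector fields \<open>Q\<^sub>p(u) = flat_form e p u u / 30\<close>: it is the structural system of the metric
\<open>\<Sum>\<^sub>a e\<^sub>a \<theta>\<^sup>a \<theta>\<^sup>a\<close>, expressed in its parallel coframe.\<close>

abbreviation solves_flat_system ::
    "(3 \<Rightarrow> real) \<Rightarrow> (3 \<Rightarrow> 3 \<Rightarrow> real^3 \<Rightarrow> real) \<Rightarrow> (real^3 \<Rightarrow> flat_state) \<Rightarrow> real^3 \<Rightarrow> bool" where
  "solves_flat_system e \<theta> \<tau> x \<equiv> (\<tau> has_derivative (\<lambda>h. \<Sum>i\<in>UNIV. h $ i *\<^sub>R
     (\<Sum>p\<in>UNIV. \<theta> p i x *\<^sub>R ((1/30) *\<^sub>R flat_form e p (\<tau> x) (\<tau> x))))) (at x)"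

text \<open>The first equation of the system prescribes only the trace-free part of the Hessian and takes the trace from
the second one; \<open>hess_rhs\<close> has the second already inserted. Conversely, the trace of the Hessian equation
gives back the divergence equation, because \<open>trace2 G G = 3\<close>.\<close>

lemma structural_systemI:
  fixes g :: "real^3 \<Rightarrow> real^3^3"
  assumes sym: "transpose (g x) = g x" and nz: "det (g x) \<noteq> 0"
    and hess: "\<And>i j. cov1 g (grad t) i j x = hess_rhs (g x) (\<lambda>i j. ricci g i j x) (S x) (grad t x) i j"
    and deriv: "\<And>l i j k. cov3 g S l i j k x = deriv_rhs (g x) (S x) (grad t x) l i j k"
  shows "structural_system g t S x"
proof -
  define G where "G = g x"
  define T where "T = (\<lambda>p q. 3 * ricci g p q x + 1/3 * SS2 G (S x) p q + 1/3 * grad t x p * grad t x q)"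
  define d where "d = 3/4 * trace2 G (\<lambda>i j. ricci g i j x) + 11/60 * trace2 G (SS2 G (S x)) - 1/6 * norm2 G (grad t x)"
  have h: "cov1 g (grad t) i j x = T i j - 1/3 * G $ i $ j * trace2 G T + 1/3 * G $ i $ j * d" for i j
    unfolding hess hess_rhs_def tracefree2_def G_def[symmetric] T_def d_def by (simp add: card_3)
  have GG: "trace2 G (\<lambda>a b. G $ a $ b) = 3"
  proof -
    have "G $ a $ b = G $ b $ a" for a b
      using arg_cong[OF sym, of "\<lambda>A. A $ b $ a"] by (simp add: G_def transpose_def)
    then have "trace2 G (\<lambda>a b. G $ a $ b) = (\<Sum>a\<in>UNIV. \<Sum>b\<in>UNIV. matrix_inv G $ a $ b * G $ b $ a)"
      unfolding trace2_def by (simp only:)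
    also have "\<dots> = (\<Sum>a\<in>(UNIV::3 set). 1)"
      using matrix_inv_entries(2)[OF nz, folded G_def] by simp
    finally show ?thesis by simp
  qed
  have lin: "trace2 G (\<lambda>a b. T a b - 1/3 * G $ a $ b * K + 1/3 * G $ a $ b * d) =
      trace2 G T - 1/3 * K * trace2 G (\<lambda>a b. G $ a $ b) + 1/3 * d * trace2 G (\<lambda>a b. G $ a $ b)" for K
    unfolding trace2_def by (simp add: algebra_simps sum.distrib sum_subtractf sum_distrib_left)
  have "divergence g (grad t) x = trace2 G (\<lambda>a b. T a b - 1/3 * G $ a $ b * trace2 G T + 1/3 * G $ a $ b * d)"
    unfolding divergence_def h G_def ..
  also have "\<dots> = trace2 G T - 1/3 * trace2 G T * trace2 G (\<lambda>a b. G $ a $ b) + 1/3 * d * trace2 G (\<lambda>a b. G $ a $ b)"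
    by (rule lin)
  also have "\<dots> = d" by (simp add: GG)
  finally have div: "divergence g (grad t) x = d" .
  have A: "cov1 g (grad t) i j x =
         tracefree2 G (\<lambda>p q. 3 / (real CARD(3) - 2) * ricci g p q x + 1 / (3 * (real CARD(3) - 2)) * SS2 G (S x) p q
                            + 1/3 * grad t x p * grad t x q) i j
         + 1 / real CARD(3) * G $ i $ j * divergence g (grad t) x" for i j
    unfolding div h by (simp add: tracefree2_def T_def)
  have B: "d = 3 / (2 * (real CARD(3) - 1)) * scalar_curv g x
         + (3 * real CARD(3) + 2) / (6 * (real CARD(3) - 1) * (real CARD(3) + 2)) * trace2 G (SS2 G (S x))
         - (real CARD(3) - 2) / 6 * norm2 G (grad t x)"
  proof -
    have "scalar_curv g x = trace2 G (\<lambda>i j. ricci g i j x)"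
      by (simp add: scalar_curv_def trace2_def G_def)
    then show ?thesis unfolding d_def by simp
  qed
  have C: "cov3 g S l i j k x =
         1/18 * Pi3 G (\<lambda>i j k l. SS4 G (S x) i l j k + 3 * S x i j l * grad t x k + S x i j k * grad t x l
                        + (4 / (real CARD(3) - 2) * SS2 G (S x) j k - 3 * St G (S x) (grad t x) j k) * G $ i $ l) i j k l" for l i j k
    unfolding deriv deriv_rhs_def G_def by simp
  show ?thesis
    unfolding structural_system_def Let_def
    using A B C unfolding G_def div by (intro conjI allI)
qed

context conformal_coframe
begin

text \<open>Along the \<open>a\<close>-th frame field a solution of a system \<open>du = \<Sum>\<^sub>p Q\<^sub>p \<theta>\<^sup>p\<close> moves with velocity \<open>Q\<^sub>a\<close>.\<close>

lemma D_eq_linear: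
  assumes "x \<in> U" "linear L"
    and \<tau>: "(\<tau> has_derivative (\<lambda>h. \<Sum>i\<in>UNIV. h $ i *\<^sub>R (\<Sum>p\<in>UNIV. \<theta> p i x *\<^sub>R Q p))) (at x)"
  shows "D a (\<lambda>y. L (\<tau> y)) x = L (Q a :: 'b::euclidean_space)"
proof (rule D_eqI[OF assms(1)])
  fix i
  have bl: "bounded_linear L" using assms(2) by (rule linear_conv_bounded_linear[THEN iffD1])
  have "(\<Sum>j\<in>UNIV. axis i 1 $ j *\<^sub>R v j) = v i" for v :: "3 \<Rightarrow> 'b"
  proof -
    have "(axis i 1 :: real^3) $ j *\<^sub>R v j = (if j = i then v i else 0)" for j by (simp add: axis_def)
    then show ?thesis by simp
  qed
  then have "pd i (\<lambda>y. L (\<tau> y)) x = L (\<Sum>p\<in>UNIV. \<theta> p i x *\<^sub>R Q p)"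
    using pd_eq[OF bounded_linear.has_derivative[OF bl \<tau>], of i] by simp
  then show "pd i (\<lambda>y. L (\<tau> y)) x = pull (fr x) (\<lambda>a. L (Q a)) i"
    by (simp add: linear_sum[OF assms(2)] linear_cmul[OF assms(2)] pull_def mult.commute)
qed

lemma trace3_conformal:
  assumes L: "L \<noteq> 0"
  shows "trace3 (diagm (\<lambda>a. L * e a)) (\<lambda>a b d. L * c a b d) k = trace3 (diagm e) c k"
proof -
  have e0: "e a \<noteq> 0" and Le0: "L * e a \<noteq> 0" for a using sign_divide(1)[OF e] L by auto
  show ?thesis using L by (simp add: trace3_diagm[where d=e, OF e0] trace3_diagm[where d="\<lambda>a. L * e a", OF Le0])
qed

lemma smooth_linear_image:
  fixes L :: "flat_state \<Rightarrow> real"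
  assumes \<tau>: "\<And>x. x \<in> U \<Longrightarrow> solves_flat_system e \<theta> \<tau> x"
    and L: "linear L"
  shows "smooth_on U (\<lambda>x. L (\<tau> x))"
proof -
  have bil: "bilinear (\<lambda>u v. (1/30) *\<^sub>R flat_form e p u v)" for p
    using bilinear_flat_form[of e p] unfolding bilinear_def
    by (auto intro: linear_compose_scale_right)
  have comp: "smooth_on U (\<lambda>x. \<tau> x \<bullet> b)" for b
    by (rule smooth_quadratic_system[OF U \<theta> bil \<tau>])
  have "L (\<tau> x) = (\<Sum>b\<in>Basis. (\<tau> x \<bullet> b) * L b)" for x
    using linear_euclidean_expand[OF L, of "\<tau> x"] by simp
  then show ?thesis by (simp only:) (intro smooth_on_sum smooth_on_mult smooth_on_const comp U)
qed

text \<open>In \<open>\<partial>\<^sub>i\<close> of the \<open>j\<close>-th component, the derivatives of the state give the symmetric Hessian, and the derivatives of the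
coframe are symmetric because the coframe is closed.\<close>

lemma closed_linear_part:
  assumes \<tau>: "\<And>x. x \<in> U \<Longrightarrow> solves_flat_system e \<theta> \<tau> x"
  shows "smooth_on U (\<lambda>x. pull (fr x) (linear_part (\<tau> x)) i)"
    and "x \<in> U \<Longrightarrow> pd i (\<lambda>x. pull (fr x) (linear_part (\<tau> x)) j) x = pd j (\<lambda>x. pull (fr x) (linear_part (\<tau> x)) i) x"
proof -
  have sm: "smooth_on U (\<lambda>x. linear_part (\<tau> x) a)" for a
    by (rule smooth_linear_image[OF \<tau> linear_linear_part])
  show "smooth_on U (\<lambda>x. pull (fr x) (linear_part (\<tau> x)) i)" for i
    by (rule smooth_pull[OF sm])
  assume x: "x \<in> U"
  define H where "H = (\<lambda>a b. linear_part ((1/30) *\<^sub>R flat_form e a (\<tau> x) (\<tau> x)) b)"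
  have H_sym: "H a b = H b a" for a b
    unfolding H_def linear_cmul[OF linear_linear_part] using linear_part_flat_form_sym[of e a "\<tau> x" b] by simp
  have pd_lin: "pd i (\<lambda>y. linear_part (\<tau> y) b) x = pull (fr x) (\<lambda>a. H a b) i" for i b
    unfolding pd_frame[OF x, where f="\<lambda>y. linear_part (\<tau> y) b"] H_def
    by (simp only: D_eq_linear[OF x linear_linear_part \<tau>[OF x]])
  have second: "pd i (\<lambda>x. pull (fr x) (linear_part (\<tau> x)) j) x =
      pull (fr x) (\<lambda>b. pull (fr x) (\<lambda>a. H a b) i) j + (\<Sum>a\<in>UNIV. linear_part (\<tau> x) a * pd i (\<theta> a j) x)" for i j
    by (subst pd_pull[OF x sm]) (simp only: pd_lin)
  have "pull (fr x) (\<lambda>b. pull (fr x) (\<lambda>a. H a b) i) j = pull (fr x) (\<lambda>a. pull (fr x) (\<lambda>b. H b a) j) i"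
    unfolding pull_swap[where i=j and j=i] by (subst H_sym) (rule refl)
  then show "pd i (\<lambda>x. pull (fr x) (linear_part (\<tau> x)) j) x = pd j (\<lambda>x. pull (fr x) (linear_part (\<tau> x)) i) x"
    unfolding second[of i j] second[of j i] closed[OF x, of i _ j] by (simp only:)
qed

text \<open>Undoes the conformal change. In the frame the two equations of the flat system are those of
\<open>hess_rhs_flat\<close> and \<open>deriv_rhs_flat\<close>; conformal covariance turns them into the equations for \<open>g\<close> in the frame, where
the covariant derivatives are known from \<open>cov1_coframe\<close> and \<open>cov3_coframe\<close>, and pulling back by the coframe gives
the coordinate form.\<close>

lemma structural_solution:
  assumes \<tau>: "\<And>x. x \<in> U \<Longrightarrow> solves_flat_system e \<theta> \<tau> x"
    and q: "smooth_on U q" "\<And>x i. x \<in> U \<Longrightarrow> pd i q x = pull (fr x) (linear_part (\<tau> x)) i"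
  defines "S \<equiv> (\<lambda>x. pull3 (fr x) (\<lambda>a b c. exp (2 * \<sigma> x) * cubic_part e (\<tau> x) a b c))"
    and "t \<equiv> (\<lambda>x. q x - 3 * \<sigma> x)"
  shows "smooth_on U t" "\<And>i j k. smooth_on U (\<lambda>x. S x i j k)"
    "\<And>x. x \<in> U \<Longrightarrow> sym_tracefree (g x) (S x) \<and> structural_system g t S x"
proof -
  have lin_smooth: "smooth_on U (\<lambda>x. L (\<tau> x))" if "linear L" for L :: "flat_state \<Rightarrow> real"
    by (rule smooth_linear_image[OF \<tau> that])
  define s where "s = (\<lambda>a b c y. exp (2 * \<sigma> y) * cubic_part e (\<tau> y) a b c)"
  have s_smooth: "smooth_on U (s a b c)" for a b c
    unfolding s_def by (intro smooth_on_mult smooth_on_exp smooth_on_const \<sigma> U lin_smooth[OF linear_cubic_part])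
  define w where "w = (\<lambda>b y. linear_part (\<tau> y) b - 3 * D b \<sigma> y)"
  have w_smooth: "smooth_on U (w b)" for b
    unfolding w_def by (intro smooth_on_diff smooth_on_mult smooth_on_const smooth_D \<sigma> U lin_smooth[OF linear_linear_part])
  show t_smooth: "smooth_on U t"
    unfolding t_def by (intro smooth_on_diff smooth_on_mult smooth_on_const \<sigma> U q)
  have S_eq: "S y = pull3 (fr y) (\<lambda>a b c. s a b c y)" for y unfolding S_def s_def ..
  show "smooth_on U (\<lambda>x. S x i j k)" for i j k
    unfolding S_eq by (intro smooth_pull s_smooth)
  have grad_eq: "grad t y = pull (fr y) (\<lambda>b. w b y)" if y: "y \<in> U" for y
  proof
    fix i
    have d: "q differentiable at y" "\<sigma> differentiable at y"
      using q(1) \<sigma> y by (auto intro: smooth_on_differentiable)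
    have "grad t y i = pd i q y - 3 * pd i \<sigma> y"
      unfolding grad_def t_def using d by (subst pd_diff) (auto simp: pd_mult intro!: differentiable_mult)
    then show "grad t y i = pull (fr y) (\<lambda>b. w b y) i"
      unfolding q(2)[OF y] pd_frame[OF y, of i \<sigma>] w_def by (simp only: pull_diff pull_mult_left)
  qed
  fix x assume x: "x \<in> U"
  define L where "L = exp (2 * \<sigma> x)"
  have L: "L \<noteq> 0" by (simp add: L_def)
  define c where "c = cubic_part e (\<tau> x)"
  define \<sigma>1 where "\<sigma>1 = (\<lambda>a. D a \<sigma> x)"
  define \<sigma>2 where "\<sigma>2 = (\<lambda>a b. D a (D b \<sigma>) x)"
  define \<eta> where "\<eta> = diagm (\<lambda>a. L * e a)"
  have \<eta>: "frame_metric x = \<eta>" by (simp add: frame_metric_def \<eta>_def L_def)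
  have G: "g x $ i $ j = pull2 (fr x) (\<lambda>a b. \<eta> $ a $ b) i j" for i j
    using metric_pull[OF x] by (simp only: \<eta>)
  have sx: "s a b c' x = L * c a b c'" for a b c' by (simp add: s_def L_def c_def)
  have wxc: "w b x = linear_part (\<tau> x) b - 3 * \<sigma>1 b" for b by (simp add: w_def \<sigma>1_def)
  have ctf: "sym_tracefree (diagm e) c" unfolding c_def by (rule sym_tracefree_cubic_part[OF e])
  have Dw: "D a (w b) x = hess_rhs (diagm e) (\<lambda>_ _. 0) c (linear_part (\<tau> x)) a b - 3 * \<sigma>2 a b" for a b
  proof -
    have "D a (w b) x = D a (\<lambda>y. linear_part (\<tau> y) b) x - 3 * \<sigma>2 a b"
    proof -
      have d: "(\<lambda>y. linear_part (\<tau> y) b) differentiable at x" "D b \<sigma> differentiable at x"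
        using smooth_on_differentiable[OF lin_smooth[OF linear_linear_part] x]
          smooth_on_differentiable[OF smooth_D[OF \<sigma>] x] by blast+
      have p: "pd i (w b) x = pd i (\<lambda>y. linear_part (\<tau> y) b) x - 3 * pd i (D b \<sigma>) x" for i
        unfolding w_def using d by (subst pd_diff) (auto simp: pd_mult intro!: differentiable_mult)
      show ?thesis unfolding \<sigma>2_def D_def[of a] p
        by (simp add: right_diff_distrib sum_subtractf sum_distrib_left mult.left_commute)
    qed
    also have "D a (\<lambda>y. linear_part (\<tau> y) b) x = linear_part ((1/30) *\<^sub>R flat_form e a (\<tau> x) (\<tau> x)) b"
      by (rule D_eq_linear[OF x linear_linear_part \<tau>[OF x]])
    also have "\<dots> = hess_rhs (diagm e) (\<lambda>_ _. 0) c (linear_part (\<tau> x)) a b"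
      unfolding c_def by (rule hess_rhs_flat[OF e, symmetric])
    finally show ?thesis .
  qed
  have hess: "cov1 g (grad t) i j x = hess_rhs (g x) (\<lambda>i j. ricci g i j x) (S x) (grad t x) i j" for i j
  proof -
    have "cov1 g (grad t) i j x = pull2 (fr x) (\<lambda>a b. D a (w b) x - (\<Sum>c\<in>UNIV. conn c a b x * w c x)) i j"
      by (rule cov1_coframe[OF x w_smooth]) (simp add: grad_eq)
    also have "(\<lambda>a b. D a (w b) x - (\<Sum>c\<in>UNIV. conn c a b x * w c x)) =
        (\<lambda>a b. hess_rhs \<eta> (conformal_ricci e \<sigma>1 \<sigma>2) (\<lambda>a b c'. L * c a b c') (\<lambda>b. linear_part (\<tau> x) b - 3 * \<sigma>1 b) a b)"
      unfolding \<eta>_def hess_rhs_conformal[OF e L] Dw wxc conn_def \<sigma>1_def[symmetric] ..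
    also have "pull2 (fr x) \<dots> i j = hess_rhs (g x) (pull2 (fr x) (conformal_ricci e \<sigma>1 \<sigma>2)) (S x) (grad t x) i j"
      unfolding S_eq sx grad_eq[OF x] wxc by (rule hess_rhs_pull[OF G nz[OF x], symmetric])
    also have "pull2 (fr x) (conformal_ricci e \<sigma>1 \<sigma>2) = (\<lambda>i j. ricci g i j x)"
      by (intro ext) (simp only: ricci_conformal[OF x] \<sigma>1_def \<sigma>2_def)
    finally show ?thesis .
  qed
  have Ds: "D d (s a b c') x = L * (2 * \<sigma>1 d * c a b c' + deriv_rhs (diagm e) c (linear_part (\<tau> x)) d a b c')" for d a b c'
  proof -
    have df: "(\<lambda>y. cubic_part e (\<tau> y) a b c') differentiable at x" "\<sigma> differentiable at x"
      using smooth_on_differentiable[OF lin_smooth[OF linear_cubic_part] x] smooth_on_differentiable[OF \<sigma> x] by blast+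
    have ex: "(\<lambda>y. exp (2 * \<sigma> y)) differentiable at x"
      by (rule smooth_on_differentiable[OF _ x]) (intro smooth_on_exp smooth_on_mult smooth_on_const \<sigma> U)
    have pex: "pd i (\<lambda>y. exp (2 * \<sigma> y)) x = L * (2 * pd i \<sigma> x)" for i
      using df(2) by (subst pd_exp) (auto simp: L_def pd_mult intro!: differentiable_mult)
    have p: "pd i (s a b c') x = L * (2 * pd i \<sigma> x) * c a b c' + L * pd i (\<lambda>y. cubic_part e (\<tau> y) a b c') x" for i
      unfolding s_def pd_mult[OF ex df(1)] pex by (simp add: c_def L_def)
    have "D d (s a b c') x = L * (2 * \<sigma>1 d * c a b c' + D d (\<lambda>y. cubic_part e (\<tau> y) a b c') x)"
      unfolding \<sigma>1_def D_def[of d] p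
      by (simp add: algebra_simps sum.distrib sum_distrib_left)
    also have "D d (\<lambda>y. cubic_part e (\<tau> y) a b c') x = cubic_part e ((1/30) *\<^sub>R flat_form e d (\<tau> x) (\<tau> x)) a b c'"
      by (rule D_eq_linear[OF x linear_cubic_part \<tau>[OF x]])
    also have "\<dots> = deriv_rhs (diagm e) c (linear_part (\<tau> x)) d a b c'"
      unfolding c_def by (rule deriv_rhs_flat[OF e, symmetric])
    finally show ?thesis .
  qed
  have deriv: "cov3 g S l i j k x = deriv_rhs (g x) (S x) (grad t x) l i j k" for l i j k
  proof -
    define X where "X = (\<lambda>d a b c'. deriv_rhs \<eta> (\<lambda>a b c'. L * c a b c') (\<lambda>b. linear_part (\<tau> x) b - 3 * \<sigma>1 b) d a b c')"
    have "cov3 g S l i j k x = pull4 (fr x) (\<lambda>d a b c. D d (s a b c) x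
       - (\<Sum>f\<in>UNIV. conn f d a x * s f b c x + conn f d b x * s a f c x + conn f d c x * s a b f x)) l i j k"
      by (rule cov3_coframe[OF x s_smooth]) (simp only: S_eq)
    also have "(\<lambda>d a b c. D d (s a b c) x
       - (\<Sum>f\<in>UNIV. conn f d a x * s f b c x + conn f d b x * s a f c x + conn f d c x * s a b f x)) = X"
    proof (intro ext)
      fix d a b c'
      have "(\<Sum>f\<in>UNIV. conn f d a x * s f b c' x + conn f d b x * s a f c' x + conn f d c' x * s a b f x) =
        L * (\<Sum>f\<in>UNIV. conn f d a x * c f b c' + conn f d b x * c a f c' + conn f d c' x * c a b f)"
        by (simp add: sx sum_distrib_left algebra_simps)
      then show "D d (s a b c') x - (\<Sum>f\<in>UNIV. conn f d a x * s f b c' x + conn f d b x * s a f c' x + conn f d c' x * s a b f x)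
          = X d a b c'"
        unfolding X_def \<eta>_def deriv_rhs_conformal[OF e L ctf] Ds conn_def \<sigma>1_def[symmetric]
        by (simp only: right_diff_distrib)
    qed
    also have "pull4 (fr x) X l i j k = pull3 (fr x) (\<lambda>a b c. pull (fr x) (\<lambda>d. X d a b c) l) i j k"
      by (rule pull_rotate[symmetric])
    also have "\<dots> = deriv_rhs (g x) (S x) (grad t x) l i j k"
      unfolding S_eq sx grad_eq[OF x] wxc X_def by (rule deriv_rhs_pull[OF G nz[OF x], symmetric])
    finally show ?thesis .
  qed
  have sym: "transpose (g x) = g x"
    by (simp add: transpose_def vec_eq_iff metric[OF x] mult_ac)
  have "sym_tracefree (g x) (S x)"
    unfolding sym_tracefree_def totally_symmetric_def
  proof (intro conjI allI)
    have cs: "c a b d = c b a d" "c a b d = c a d b" for a b d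
      using ctf by (simp_all add: sym_tracefree_def totally_symmetric_def)
    fix i j k
    show "S x i j k = S x j i k"
    proof -
      have "S x j i k = pull3 (fr x) (\<lambda>a b d. L * c b a d) i j k" unfolding S_eq sx by (rule pull3_swap12)
      also have "(\<lambda>a b d. L * c b a d) = (\<lambda>a b d. L * c a b d)" using cs(1) by (intro ext) metis
      finally show ?thesis unfolding S_eq sx ..
    qed
    show "S x i j k = S x i k j"
    proof -
      have "S x i k j = pull3 (fr x) (\<lambda>a b d. L * c a d b) i j k" unfolding S_eq sx by (rule pull3_swap23)
      also have "(\<lambda>a b d. L * c a d b) = (\<lambda>a b d. L * c a b d)" using cs(2) by (intro ext) metis
      finally show ?thesis unfolding S_eq sx ..
    qed
    fix k
    have "trace3 \<eta> (\<lambda>a b d. L * c a b d) = (\<lambda>_. 0)"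
    proof
      fix k
      have "trace3 \<eta> (\<lambda>a b d. L * c a b d) k = trace3 (diagm e) c k"
        unfolding \<eta>_def by (rule trace3_conformal[OF L])
      then show "trace3 \<eta> (\<lambda>a b d. L * c a b d) k = 0" using ctf by (simp add: sym_tracefree_def)
    qed
    then show "trace3 (g x) (S x) k = 0"
      unfolding S_eq sx trace3_pull[OF G nz[OF x]] by (simp add: pull_def)
  qed
  then show "sym_tracefree (g x) (S x) \<and> structural_system g t S x"
    using structural_systemI[OF sym nz[OF x] hess deriv] by blast
qed

end

text \<open>In the integrability condition the derivatives of the \<open>\<theta>\<^sup>a\<close> cancel by closedness, and the rest is symmetric in the two
directions because the vector fields commute.\<close>

lemma flat_system_solution:
  fixes \<theta> :: "3 \<Rightarrow> 3 \<Rightarrow> real^3 \<Rightarrow> real"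
  assumes U: "open U" "p \<in> U" and \<theta>: "\<And>a i. smooth_on U (\<theta> a i)"
    and closed: "\<And>x a i j. x \<in> U \<Longrightarrow> pd i (\<theta> a j) x = pd j (\<theta> a i) x"
    and e: "\<And>a. e a * e a = 1"
  shows "\<exists>r>0. \<exists>\<tau>. ball p r \<subseteq> U \<and> \<tau> p = \<tau>0 \<and> (\<forall>x\<in>ball p r. solves_flat_system e \<theta> \<tau> x)"
proof -
  define B where "B = (\<lambda>p u v. (1/30) *\<^sub>R flat_form e p u v)"
  have "bilinear (B p)" for p
    using bilinear_flat_form[of e p] unfolding bilinear_def B_def by (auto intro: linear_compose_scale_right)
  then have B: "bounded_bilinear (B p)" for p by (simp add: bilinear_conv_bounded_bilinear)
  define Q where "Q = (\<lambda>p u. B p u u)"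
  define Q' where "Q' = (\<lambda>p u. Blinfun (\<lambda>h. B p u h + B p h u))"
  have Q'_apply: "Q' p u h = B p u h + B p h u" for p u h
    unfolding Q'_def
    by (subst bounded_linear_Blinfun_apply)
       (auto intro: bounded_linear_add bounded_bilinear.bounded_linear_left[OF B] bounded_bilinear.bounded_linear_right[OF B])
  have commute: "Q' p u (Q q u) = Q' q u (Q p u)" for p q u
    unfolding Q'_apply Q_def B_def flat_form_scaleR_left flat_form_scaleR_right scaleR_add_right[symmetric]
    using flat_form_commute[OF e, where i=p and j=q and \<tau>=u] by (simp only: add.commute)
  have "\<exists>r>0. \<exists>\<tau>. ball p r \<subseteq> U \<and> \<tau> p = \<tau>0 \<and> (\<forall>x\<in>ball p r. (\<tau> has_derivative
      (\<lambda>h. \<Sum>i\<in>UNIV. h $ i *\<^sub>R (\<Sum>p\<in>UNIV. \<theta> p i x *\<^sub>R Q p (\<tau> x)))) (at x))"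
  proof (rule frobenius_separated[OF U, where Q'=Q'])
    show "(Q p has_derivative blinfun_apply (Q' p u)) (at u)" for p u
      using bounded_bilinear.FDERIV[OF B has_derivative_ident has_derivative_ident, of p u UNIV]
      by (simp add: Q_def Q'_apply[abs_def])
    show "continuous_on UNIV (Q' p)" for p
      by (rule continuous_on_blinfun_componentwise, unfold Q'_apply)
         (intro continuous_intros bounded_bilinear.continuous_on[OF B])
    fix x u i j assume x: "x \<in> U"
    have "(\<Sum>p\<in>UNIV. \<theta> p j x *\<^sub>R Q' p u (\<Sum>q\<in>UNIV. \<theta> q i x *\<^sub>R Q q u)) =
        (\<Sum>p\<in>UNIV. \<Sum>q\<in>UNIV. (\<theta> p j x * \<theta> q i x) *\<^sub>R Q' p u (Q q u))" for i j
      by (simp add: blinfun.sum_right blinfun.scaleR_right scaleR_sum_right)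
    moreover have "(\<Sum>p\<in>UNIV. \<Sum>q\<in>UNIV. (\<theta> p j x * \<theta> q i x) *\<^sub>R Q' p u (Q q u)) =
        (\<Sum>p\<in>UNIV. \<Sum>q\<in>UNIV. (\<theta> p i x * \<theta> q j x) *\<^sub>R Q' p u (Q q u))"
    proof -
      have "(\<Sum>p\<in>UNIV. \<Sum>q\<in>UNIV. (\<theta> p j x * \<theta> q i x) *\<^sub>R Q' p u (Q q u)) =
          (\<Sum>p\<in>UNIV. \<Sum>q\<in>UNIV. (\<theta> q j x * \<theta> p i x) *\<^sub>R Q' q u (Q p u))" by (rule sum.swap)
      also have "\<dots> = (\<Sum>p\<in>UNIV. \<Sum>q\<in>UNIV. (\<theta> p i x * \<theta> q j x) *\<^sub>R Q' p u (Q q u))"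
        by (intro sum.cong refl) (subst commute, simp add: mult.commute)
      finally show ?thesis .
    qed
    ultimately show "(\<Sum>p\<in>UNIV. pd i (\<theta> p j) x *\<^sub>R Q p u + \<theta> p j x *\<^sub>R Q' p u (\<Sum>q\<in>UNIV. \<theta> q i x *\<^sub>R Q q u)) =
        (\<Sum>p\<in>UNIV. pd j (\<theta> p i) x *\<^sub>R Q p u + \<theta> p i x *\<^sub>R Q' p u (\<Sum>q\<in>UNIV. \<theta> q j x *\<^sub>R Q q u))"
      by (simp only: sum.distrib closed[OF x, of i _ j])
  qed (rule \<theta>)
  then show ?thesis by (simp only: Q_def B_def)
qed

context conformal_coframe
begin

text \<open>Any initial tensor is attained: pull it back to the frame by the dual frame, divide by the conformal factor, and
read off the seven components.\<close>

lemma frame_components: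
  assumes x: "x \<in> U" and S: "sym_tracefree (g x) S"
  shows "\<exists>\<tau>. pull3 (fr x) (\<lambda>a b c. exp (2 * \<sigma> x) * cubic_part e \<tau> a b c) = S"
proof -
  define dl where "dl = (\<lambda>i a. dual x $ i $ a)"
  define Z where "Z = pull3 dl S"
  define L where "L = exp (2 * \<sigma> x)"
  have L: "L \<noteq> 0" by (simp add: L_def)
  have pd1: "pull (fr x) (\<lambda>a. pull dl X a) i = X i" for X i
  proof -
    have "pull (fr x) (\<lambda>a. pull dl X a) i = (\<Sum>m\<in>UNIV. X m * (\<Sum>a\<in>UNIV. dual x $ m $ a * \<theta> a i x))"
      unfolding pull_def dl_def sum_distrib_left sum_distrib_right by (subst sum.swap) (simp add: mult_ac)
    also have "\<dots> = (\<Sum>m\<in>UNIV. X m * (if i = m then 1 else 0))" by (simp add: dual_right[OF x] eq_commute)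
    finally show ?thesis by (simp only: sum_mult_delta)
  qed
  have pd2: "pull2 (fr x) (\<lambda>b c. pull2 dl Y b c) j k = Y j k" for Y j k
  proof -
    have "pull (fr x) (\<lambda>c. pull dl (\<lambda>j. pull dl (Y j) c) b) k = pull dl (\<lambda>j. pull (fr x) (\<lambda>c. pull dl (Y j) c) k) b" for b
      by (rule pull_swap)
    then show ?thesis by (simp only: pd1)
  qed
  have pull_Z: "pull3 (fr x) Z i j k = S i j k" for i j k
  proof -
    have 1: "pull (fr x) (\<lambda>c. pull dl (\<lambda>i. pull2 dl (S i) b c) a) k = pull dl (\<lambda>i. pull (fr x) (\<lambda>c. pull2 dl (S i) b c) k) a" for a b
      by (rule pull_swap)
    have 2: "pull (fr x) (\<lambda>b. pull dl (\<lambda>i. pull (fr x) (\<lambda>c. pull2 dl (S i) b c) k) a) j =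
        pull dl (\<lambda>i. pull2 (fr x) (\<lambda>b c. pull2 dl (S i) b c) j k) a" for a
      by (rule pull_swap)
    show ?thesis unfolding Z_def 1 2 pd2 pd1 ..
  qed
  have G: "g x $ i $ j = pull2 (fr x) (\<lambda>a b. diagm (\<lambda>a. L * e a) $ a $ b) i j" for i j
    using metric_pull[OF x] by (simp only: frame_metric_def L_def)
  have sS: "S i j k = S j i k" "S i j k = S i k j" for i j k
    using S by (simp_all add: sym_tracefree_def totally_symmetric_def)
  have symZ: "Z a b c = Z b a c" "Z a b c = Z a c b" for a b c
  proof -
    have "Z b a c = pull3 dl (\<lambda>i j k. S j i k) a b c" unfolding Z_def by (rule pull3_swap12)
    also have "(\<lambda>i j k. S j i k) = S" using sS(1) by (intro ext) metis
    finally show "Z a b c = Z b a c" by (simp add: Z_def)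
    have "Z a c b = pull3 dl (\<lambda>i j k. S i k j) a b c" unfolding Z_def by (rule pull3_swap23)
    also have "(\<lambda>i j k. S i k j) = S" using sS(2) by (intro ext) metis
    finally show "Z a b c = Z a c b" by (simp add: Z_def)
  qed
  have "trace3 (diagm (\<lambda>a. L * e a)) Z k = 0" for k
  proof (rule pull_inject[OF x])
    fix i
    have "pull (fr x) (trace3 (diagm (\<lambda>a. L * e a)) Z) i = trace3 (g x) (pull3 (fr x) Z) i"
      by (rule trace3_pull[OF G nz[OF x], symmetric])
    also have "pull3 (fr x) Z = S" by (intro ext pull_Z)
    finally show "pull (fr x) (trace3 (diagm (\<lambda>a. L * e a)) Z) i = pull (fr x) (\<lambda>_. 0) i"
      using S by (simp add: sym_tracefree_def pull_def)
  qed
  moreover have "trace3 (diagm (\<lambda>a. L * e a)) Z k = trace3 (diagm e) (\<lambda>a b c. 1 / L * Z a b c) k" for k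
    using trace3_conformal[OF L, of "\<lambda>a b c. 1 / L * Z a b c" k] L by simp
  ultimately have "sym_tracefree (diagm e) (\<lambda>a b c. 1 / L * Z a b c)"
    using symZ by (simp add: sym_tracefree_def totally_symmetric_def)
  from ex_cubic_part[OF e this] obtain \<tau> where \<tau>: "\<And>i j k. cubic_part e \<tau> i j k = (1 / L) * Z i j k" by blast
  have "pull3 (fr x) (\<lambda>a b c. exp (2 * \<sigma> x) * cubic_part e \<tau> a b c) = pull3 (fr x) Z"
    unfolding \<tau> L_def[symmetric] using L by simp
  also have "\<dots> = S" by (intro ext pull_Z)
  finally show ?thesis by blast
qed

end

text \<open>The theorem in one chart. The radius shrinks three times: for the coframe of the flat metric, for the solution of
the flat system and for the primitive of its linear part.\<close>

theorem local_solution: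
  fixes g :: "real^3 \<Rightarrow> real^3^3" and p :: "real^3"
  assumes X: "open X" "p \<in> X" and g: "\<And>i j. smooth_on X (\<lambda>x. g x $ i $ j)"
    and sym: "\<And>x. x \<in> X \<Longrightarrow> transpose (g x) = g x" and nz: "\<And>x. x \<in> X \<Longrightarrow> det (g x) \<noteq> 0"
    and f: "smooth_on X f"
    and flat: "\<And>x l k i j. x \<in> X \<Longrightarrow> riemann (\<lambda>y. exp (2 * f y) *\<^sub>R g y) l k i j x = 0"
    and S0: "sym_tracefree (g p) S0"
  shows "\<exists>r>0. \<exists>t S. ball p r \<subseteq> X \<and> smooth_on (ball p r) t \<and>
     (\<forall>i j k. smooth_on (ball p r) (\<lambda>x. S x i j k)) \<and> S p = S0 \<and>
     (\<forall>x\<in>ball p r. sym_tracefree (g x) (S x) \<and> structural_system g t S x)"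
proof -
  define h where "h = (\<lambda>x. exp (2 * f x) *\<^sub>R g x)"
  have g_sym: "g x $ i $ j = g x $ j $ i" if "x \<in> X" for x i j
    using arg_cong[OF sym[OF that], of "\<lambda>A. A $ i $ j"] by (simp add: transpose_def)
  have h_smooth: "smooth_on X (\<lambda>x. h x $ i $ j)" for i j
    unfolding h_def by (simp, intro smooth_on_mult smooth_on_exp smooth_on_const f g X)
  have h_nz: "det (h x) \<noteq> 0" if "x \<in> X" for x
  proof -
    have "h x = (\<chi> i. exp (2 * f x) *s (g x $ i))" by (simp add: h_def vec_eq_iff)
    then have "det (h x) = exp (2 * f x) ^ CARD(3) * det (\<chi> i. g x $ i)"
      by (simp only: det_rows_mul) simp
    then show ?thesis using nz[OF that] by simp
  qed
  have h_sym: "h x $ i $ j = h x $ j $ i" if "x \<in> X" for x i j using g_sym[OF that] by (simp add: h_def)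
  have h_flat: "riemann h l k i j x = 0" if "x \<in> X" for x l k i j unfolding h_def using flat[OF that] .
  have "\<exists>r>0. \<exists>e (\<theta> :: 3 \<Rightarrow> 3 \<Rightarrow> real^3 \<Rightarrow> real). ball p r \<subseteq> X \<and> (\<forall>a. e a * e a = 1) \<and>
    (\<forall>a i. smooth_on (ball p r) (\<theta> a i)) \<and>
    (\<forall>x\<in>ball p r. (\<forall>a i j. pd i (\<theta> a j) x = pd j (\<theta> a i) x) \<and>
       (\<forall>i j. h x $ i $ j = (\<Sum>a\<in>UNIV. e a * \<theta> a i x * \<theta> a j x)))"
    by (rule flat_metric_coframe[OF X(1) h_smooth h_sym h_nz h_flat X(2)])
  then obtain r1 e and \<theta> :: "3 \<Rightarrow> 3 \<Rightarrow> real^3 \<Rightarrow> real" where r1: "r1 > 0" "ball p r1 \<subseteq> X"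
    and e: "\<And>a. e a * e a = 1" and \<theta>: "\<And>a i. smooth_on (ball p r1) (\<theta> a i)"
    and closed: "\<And>x a i j. x \<in> ball p r1 \<Longrightarrow> pd i (\<theta> a j) x = pd j (\<theta> a i) x"
    and h_eq: "\<And>x i j. x \<in> ball p r1 \<Longrightarrow> h x $ i $ j = (\<Sum>a\<in>UNIV. e a * \<theta> a i x * \<theta> a j x)"
    by (elim exE conjE, goal_cases) blast
  define \<sigma> where "\<sigma> = (\<lambda>x. - f x)"
  have coframe: "conformal_coframe (ball p r) g \<theta> e \<sigma>" if "r \<le> r1" for r
  proof
    have sub: "ball p r \<subseteq> ball p r1" using that by (rule subset_ball)
    show "open (ball p r)" by simp
    show "smooth_on (ball p r) (\<theta> a i)" for a i by (rule smooth_on_subset[OF \<theta> sub])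
    show "pd i (\<theta> a j) x = pd j (\<theta> a i) x" if "x \<in> ball p r" for x a i j using closed that sub by blast
    show "e a * e a = 1" for a by (rule e)
    show "smooth_on (ball p r) \<sigma>"
      unfolding \<sigma>_def using sub r1(2) by (intro smooth_on_uminus smooth_on_subset[OF f]) auto
    show "g x $ i $ j = exp (2 * \<sigma> x) * (\<Sum>a\<in>UNIV. e a * \<theta> a i x * \<theta> a j x)" if "x \<in> ball p r" for x i j
    proof -
      have "exp (2 * \<sigma> x) * exp (2 * f x) = 1" by (simp add: \<sigma>_def flip: exp_add)
      moreover have "exp (2 * \<sigma> x) * (\<Sum>a\<in>UNIV. e a * \<theta> a i x * \<theta> a j x) = exp (2 * \<sigma> x) * (exp (2 * f x) * g x $ i $ j)"
        using h_eq[of x i j] that sub by (auto simp: h_def)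
      ultimately show ?thesis by (simp flip: mult.assoc)
    qed
    show "det (g x) \<noteq> 0" if "x \<in> ball p r" for x using nz that sub r1(2) by blast
  qed
  have p1: "p \<in> ball p r1" using r1 by simp
  obtain \<tau>0 where \<tau>0: "pull3 (\<lambda>a i. \<theta> a i p) (\<lambda>a b c. exp (2 * \<sigma> p) * cubic_part e \<tau>0 a b c) = S0"
    using conformal_coframe.frame_components[OF coframe[OF order_refl] p1 S0] by blast
  have "\<exists>r>0. \<exists>\<tau>. ball p r \<subseteq> ball p r1 \<and> \<tau> p = \<tau>0 \<and> (\<forall>x\<in>ball p r. solves_flat_system e \<theta> \<tau> x)"
    by (rule flat_system_solution) (use p1 \<theta> closed e in auto)
  then obtain r2 \<tau> where r2: "r2 > 0" "ball p r2 \<subseteq> ball p r1" and \<tau>p: "\<tau> p = \<tau>0"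
    and \<tau>: "\<And>x. x \<in> ball p r2 \<Longrightarrow> solves_flat_system e \<theta> \<tau> x"
    by blast
  define R where "R = min r1 r2"
  have R: "R > 0" "R \<le> r1" "ball p R \<subseteq> ball p r2" using r1 r2 by (auto simp: R_def)
  interpret C: conformal_coframe "ball p R" g \<theta> e \<sigma> by (rule coframe[OF R(2)])
  have \<tau>R: "solves_flat_system e \<theta> \<tau> x"
    if "x \<in> ball p R" for x using \<tau> that R(3) by blast
  have "\<exists>r>0. \<exists>q. ball p r \<subseteq> ball p R \<and> smooth_on (ball p r) q \<and>
      (\<forall>x\<in>ball p r. \<forall>i. pd i q x = pull (\<lambda>a i. \<theta> a i x) (linear_part (\<tau> x)) i)"
    by (rule poincare[OF open_ball])
       (use R(1) C.closed_linear_part[OF \<tau>R] in auto)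
  then obtain r q where r: "r > 0" "ball p r \<subseteq> ball p R" and q: "smooth_on (ball p r) q"
    "\<And>x i. x \<in> ball p r \<Longrightarrow> pd i q x = pull (\<lambda>a i. \<theta> a i x) (linear_part (\<tau> x)) i" by blast
  define \<rho> where "\<rho> = min r R"
  have \<rho>: "\<rho> > 0" "\<rho> \<le> r1" "ball p \<rho> \<subseteq> ball p r" "ball p \<rho> \<subseteq> ball p R" using r R by (auto simp: \<rho>_def)
  interpret C': conformal_coframe "ball p \<rho>" g \<theta> e \<sigma> by (rule coframe[OF \<rho>(2)])
  have \<tau>\<rho>: "solves_flat_system e \<theta> \<tau> x"
    if "x \<in> ball p \<rho>" for x using \<tau>R that \<rho>(4) by blast
  have q\<rho>: "smooth_on (ball p \<rho>) q" "\<And>x i. x \<in> ball p \<rho> \<Longrightarrow> pd i q x = pull (\<lambda>a i. \<theta> a i x) (linear_part (\<tau> x)) i"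
    using q \<rho>(3) by (auto intro: smooth_on_subset simp del: mem_ball)
  note sol = C'.structural_solution[OF \<tau>\<rho> q\<rho>]
  show ?thesis
  proof (intro exI conjI)
    show "\<rho> > 0" by (rule \<rho>(1))
    show "ball p \<rho> \<subseteq> X" using \<rho>(2) r1(2) subset_ball by blast
    show "smooth_on (ball p \<rho>) (\<lambda>x. q x - 3 * \<sigma> x)" by (rule sol(1))
    show "\<forall>i j k. smooth_on (ball p \<rho>) (\<lambda>x. pull3 (\<lambda>a i. \<theta> a i x) (\<lambda>a b c. exp (2 * \<sigma> x) * cubic_part e (\<tau> x) a b c) i j k)"
      using sol(2) by blast
    show "pull3 (\<lambda>a i. \<theta> a i p) (\<lambda>a b c. exp (2 * \<sigma> p) * cubic_part e (\<tau> p) a b c) = S0"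
      unfolding \<tau>p by (rule \<tau>0)
    show "\<forall>x\<in>ball p \<rho>. sym_tracefree (g x) (pull3 (\<lambda>a i. \<theta> a i x) (\<lambda>a b c. exp (2 * \<sigma> x) * cubic_part e (\<tau> x) a b c)) \<and>
       structural_system g (\<lambda>x. q x - 3 * \<sigma> x) (\<lambda>x. pull3 (\<lambda>a i. \<theta> a i x) (\<lambda>a b c. exp (2 * \<sigma> x) * cubic_part e (\<tau> x) a b c)) x"
      using sol(3) by blast
  qed
qed

text \<open>The system involves only the germs of \<open>t\<close> and \<open>S\<close>. Reading a function on the manifold in the chart reproduces the
given coordinate expression only on the image of the chart domain, so this is needed to transport the solution.\<close>

lemma structural_system_cong:
  assumes B: "open B" "x \<in> B" and t: "\<And>y. y \<in> B \<Longrightarrow> t' y = t y" and S: "\<And>y. y \<in> B \<Longrightarrow> S' y = S y"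
  shows "structural_system g t' S' x \<longleftrightarrow> structural_system g t S x"
proof -
  have gr: "grad t' y = grad t y" if "y \<in> B" for y
    unfolding grad_def by (intro ext pd_cong[OF B(1) t that])
  have "pd i (\<lambda>y. grad t' y j) x = pd i (\<lambda>y. grad t y j) x" for i j
    by (rule pd_cong[OF B(1) _ B(2)]) (simp add: gr)
  then have c1: "cov1 g (grad t') i j x = cov1 g (grad t) i j x" for i j
    by (simp add: cov1_def gr[OF B(2)])
  have "pd l (\<lambda>y. S' y i j k) x = pd l (\<lambda>y. S y i j k) x" for l i j k
    by (rule pd_cong[OF B(1) _ B(2)]) (simp add: S)
  then have c3: "cov3 g S' l i j k x = cov3 g S l i j k x" for l i j k
    by (simp add: cov3_def S[OF B(2)])
  have dv: "divergence g (grad t') x = divergence g (grad t) x"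
    by (simp add: divergence_def c1)
  show ?thesis unfolding structural_system_def c1 c3 dv gr[OF B(2)] S[OF B(2)] ..
qed

section \<open>Integrability of the structural system\<close>

theorem corollary6p3:
  fixes A :: "('m::{t2_space, second_countable_topology}, 3) chart set"
    and g :: "('m, 3) chart \<Rightarrow> real^3 \<Rightarrow> real^3^3"
    and x\<^sub>0 :: 'm
    and U :: "'m set" and \<phi> :: "'m \<Rightarrow> real^3"
    and S\<^sub>0 :: "3 \<Rightarrow> 3 \<Rightarrow> 3 \<Rightarrow> real"
  assumes "analytic_atlas A" and "analytic_metric A g" and "conformally_flat A g"
    and "(U, \<phi>) \<in> A" and "x\<^sub>0 \<in> U"
    and "sym_tracefree (g (U, \<phi>) (\<phi> x\<^sub>0)) S\<^sub>0"
  shows "\<exists>V (t :: 'm \<Rightarrow> real) (S :: 'm \<Rightarrow> 3 \<Rightarrow> 3 \<Rightarrow> 3 \<Rightarrow> real).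
     open V \<and> x\<^sub>0 \<in> V \<and> V \<subseteq> U \<and>
     smooth_on (\<phi> ` V) (in_chart (U, \<phi>) t) \<and>
     (\<forall>i j k. smooth_on (\<phi> ` V) (\<lambda>x. in_chart (U, \<phi>) S x i j k)) \<and>
     S x\<^sub>0 = S\<^sub>0 \<and>
     (\<forall>x\<in>\<phi> ` V. sym_tracefree (g (U, \<phi>) x) (in_chart (U, \<phi>) S x) \<and>
        structural_system (g (U, \<phi>)) (in_chart (U, \<phi>) t) (in_chart (U, \<phi>) S) x)"
proof -
  define c where "c = (U, \<phi>)"
  have cA: "c \<in> A" using assms(4) by (simp add: c_def)
  have fst_c: "fst c = U" and snd_c: "snd c = \<phi>" by (simp_all add: c_def)
  have chart: "is_chart c" using assms(1) cA by (simp add: analytic_atlas_def)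
  then obtain \<psi> where openU: "open U" and openI: "open (\<phi> ` U)" and \<psi>: "homeomorphism U (\<phi> ` U) \<phi> \<psi>"
    by (auto simp: is_chart_def fst_c snd_c)
  have inj: "inj_on \<phi> U" using homeomorphism_apply1[OF \<psi>] by (rule inj_on_inverseI)
  have inv: "inv_into U \<phi> (\<phi> m) = m" if "m \<in> U" for m using inv_into_f_f[OF inj that] .
  have chart_val: "in_chart c H (\<phi> m) = H m" if "m \<in> U" for H :: "'m \<Rightarrow> 'b" and m
    using inv[OF that] by (simp add: in_chart_def fst_c snd_c)
  obtain W f where W: "open W" "x\<^sub>0 \<in> W" and f: "smooth_on (\<phi> ` (U \<inter> W)) (in_chart c f)"
    and flat: "\<And>x l k i j. x \<in> \<phi> ` (U \<inter> W) \<Longrightarrow> riemann (\<lambda>y. exp (2 * in_chart c f y) *\<^sub>R g c y) l k i j x = 0"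
  proof -
    from assms(3)[unfolded conformally_flat_def, THEN spec, of x\<^sub>0]
    obtain W f where W: "open W" "x\<^sub>0 \<in> W"
      and flat_chart: "\<forall>c\<in>A. smooth_on (snd c ` (fst c \<inter> W)) (in_chart c f) \<and>
           (\<forall>x\<in>snd c ` (fst c \<inter> W). \<forall>l k i j. riemann (\<lambda>y. exp (2 * in_chart c f y) *\<^sub>R g c y) l k i j x = 0)"
      by (elim exE conjE)
    note fc = bspec[OF flat_chart cA, unfolded fst_c snd_c]
    show thesis
      by (rule that[OF W conjunct1[OF fc]]) (rule conjunct2[OF fc, rule_format])
  qed
  define X where "X = \<phi> ` (U \<inter> W)"
  have open_image: "open (\<phi> ` V)" if "open V" "V \<subseteq> U" for V
  proof -
    have "openin (top_of_set U) V" using that by (simp add: openin_open_eq openU)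
    from homeomorphism_imp_open_map[OF \<psi> this] show ?thesis using openI openin_open_trans by blast
  qed
  have X: "open X" "\<phi> x\<^sub>0 \<in> X" "X \<subseteq> \<phi> ` U"
    using open_image[of "U \<inter> W"] openU W assms(5) by (auto simp: X_def)
  have smooth_g: "smooth_on X (\<lambda>x. g c x $ i $ j)" for i j
  proof -
    have "real_analytic_on (\<phi> ` U) (\<lambda>x. g c x $ i $ j)"
      using bspec[OF conjunct1[OF assms(2)[unfolded analytic_metric_def]] cA] unfolding fst_c snd_c by blast
    then show ?thesis using X(3) smooth_on_subset unfolding real_analytic_on_def by blast
  qed
  have g_alg: "transpose (g c x) = g c x" "det (g c x) \<noteq> 0" if "x \<in> X" for x
    using bspec[OF conjunct1[OF assms(2)[unfolded analytic_metric_def]] cA] subsetD[OF X(3) that]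
    unfolding fst_c snd_c by blast+
  have "\<exists>r>0. \<exists>t S. ball (\<phi> x\<^sub>0) r \<subseteq> X \<and> smooth_on (ball (\<phi> x\<^sub>0) r) t \<and>
     (\<forall>i j k. smooth_on (ball (\<phi> x\<^sub>0) r) (\<lambda>x. S x i j k)) \<and> S (\<phi> x\<^sub>0) = S\<^sub>0 \<and>
     (\<forall>x\<in>ball (\<phi> x\<^sub>0) r. sym_tracefree (g c x) (S x) \<and> structural_system (g c) t S x)"
    using assms(6) by (intro local_solution[where f="in_chart c f"] X smooth_g g_alg f[folded X_def] flat[folded X_def])
      (simp_all add: c_def)
  then obtain r t S where r: "r > 0" "ball (\<phi> x\<^sub>0) r \<subseteq> X" and t: "smooth_on (ball (\<phi> x\<^sub>0) r) t"
    and S: "\<And>i j k. smooth_on (ball (\<phi> x\<^sub>0) r) (\<lambda>x. S x i j k)" "S (\<phi> x\<^sub>0) = S\<^sub>0"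
    and sol: "\<And>x. x \<in> ball (\<phi> x\<^sub>0) r \<Longrightarrow> sym_tracefree (g c x) (S x) \<and> structural_system (g c) t S x" by blast
  define B where "B = ball (\<phi> x\<^sub>0) r"
  \<comment> \<open>The ball lies in the image of the chart, hence \<open>\<phi>\<close> maps \<open>V\<close> onto it.\<close>
  define V where "V = U \<inter> \<phi> -` B"
  have V_image: "\<phi> ` V = B" using r(2) X(3) by (auto simp: V_def B_def)
  have "open V"
    unfolding V_def using homeomorphism_cont1[OF \<psi>] openU
    by (simp add: B_def continuous_on_open_vimage[OF openU] Int_commute continuous_open_preimage)
  have tB: "in_chart c (t \<circ> \<phi>) x = t x" and SB: "in_chart c (S \<circ> \<phi>) x = S x" if xB: "x \<in> B" for x
  proof -
    obtain m where m: "m \<in> U" "x = \<phi> m" using xB r(2) X(3) unfolding B_def by blast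
    show "in_chart c (t \<circ> \<phi>) x = t x" "in_chart c (S \<circ> \<phi>) x = S x"
      unfolding m(2) chart_val[OF m(1)] by simp_all
  qed
  have B: "open B" by (simp add: B_def)
  have system: "structural_system (g c) (in_chart c (t \<circ> \<phi>)) (in_chart c (S \<circ> \<phi>)) x" if x: "x \<in> B" for x
    using structural_system_cong[OF B x tB SB] sol x by (simp add: B_def)
  show ?thesis
  proof (intro exI[of _ V] exI[of _ "t \<circ> \<phi>"] exI[of _ "S \<circ> \<phi>"] conjI allI ballI)
    show "open V" by fact
    show "x\<^sub>0 \<in> V" using assms(5) r(1) by (simp add: V_def B_def)
    show "V \<subseteq> U" by (simp add: V_def)
    show "smooth_on (\<phi> ` V) (in_chart (U, \<phi>) (t \<circ> \<phi>))"
      unfolding V_image c_def[symmetric] using smooth_on_cong[OF B tB] t by (simp add: B_def)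
    show "smooth_on (\<phi> ` V) (\<lambda>x. in_chart (U, \<phi>) (S \<circ> \<phi>) x i j k)" for i j k
      unfolding V_image c_def[symmetric]
      using smooth_on_cong[OF B, of "\<lambda>x. in_chart c (S \<circ> \<phi>) x i j k" "\<lambda>x. S x i j k"] SB S(1) by (simp add: B_def)
    show "(S \<circ> \<phi>) x\<^sub>0 = S\<^sub>0" using S(2) by simp
    fix x assume "x \<in> \<phi> ` V"
    then have x: "x \<in> B" by (simp add: V_image)
    show "sym_tracefree (g (U, \<phi>) x) (in_chart (U, \<phi>) (S \<circ> \<phi>) x)"
      using sol[of x] x SB[OF x] by (simp add: c_def B_def)
    show "structural_system (g (U, \<phi>)) (in_chart (U, \<phi>) (t \<circ> \<phi>)) (in_chart (U, \<phi>) (S \<circ> \<phi>)) x"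
      using system[OF x] by (simp add: c_def)
  qed
qed

end
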